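(* Let $\Omega\subset\mathbb{R}^N$ be a bounded domain with $C^2$ boundary, let $s\in(0,1)$ and $p$ satisfy $s+1<p<\frac{s}{1-s}$, and let $u_0\ge 0$, $u_0\in C^\beta(\overline{\Omega})$ for some $\beta>\beta^*:=\frac{p-2s}{p-1}$, with $u_0(x)=0$ for all $x\in\partial\Omega$. Then there exists $T^*>0$, depending only on $N,\Omega,s,p$ and the Hölder seminorm $[u_0]_{C^\beta(\overline\Omega)}$, such that the viscosity solution $u$ of $$u_t+(-\Delta)^s u=|Du|^p \ \text{ in }\Omega\times(0,T),\qquad u=0\ \text{ in }(\mathbb{R}^N\setminus\Omega)\times(0,T),\qquad u(x,0)=u_0(x)\ \text{ in }\overline\Omega$$ (boundary data understood in the generalized viscosity sense) satisfies the boundary and initial conditions in the classical sense for all $0\le t\le T^*$; that is, $u(x,t)=0$ for all $x\in\partial\Omega$, $0\le t\le T^*$, and $u(x,0)=u_0(x)$ for all $x\in\overline\Omega$.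
   Context: Fractional Laplacian: $(-\Delta)^s u(x,t)=C_{N,s}\,\mathrm{P.V.}\int_{\mathbb{R}^N}\frac{u(x,t)-u(y,t)}{|x-y|^{N+2s}}\,dy$, with $C_{N,s}>0$ the usual normalization constant. Viscosity solutions. For measurable $A\subset\mathbb{R}^N$ and bounded measurable $\psi$, let $I[A](\psi(\cdot,t))(x)=C_{N,s}\,\mathrm{P.V.}\int_A\frac{\psi(x,t)-\psi(y,t)}{|x-y|^{N+2s}}\,dy$. For $\delta>0$, $\phi\in C^2(B_\delta(x)\times(t-\delta,t+\delta))$ and bounded measurable $v$, let $$E_\delta(v,\phi,x,t)=\phi_t(x,t)+I[B_\delta(x)](\phi(\cdot,t))(x)+I[\mathbb{R}^N\setminus B_\delta(x)](v(\cdot,t))(x)-|D\phi(x,t)|^p.$$ For $u$ defined on $\overline\Omega\times[0,T]$, its upper (resp. lower) $0$-extension $u^0$ (resp. $u_{0}$-extension, denoted $\tilde u$) equals $u$ in $\Omega\times[0,T]$, equals $0$ in $(\mathbb{R}^N\setminus\overline\Omega)\times[0,T]$, and equals $\max\{u,0\}$ (resp. $\min\{u,0\}$) on $\partial\Omega\times[0,T]$. An upper semicontinuous $u$ on $\overline\Omega\times[0,T]$ is a subsolution of the problem if for every $\delta>0$, every $C^2$ test function $\phi$ on $B_\delta(x_0)\times(t_0-\delta,t_0+\delta)$ and every maximum point $(x_0,t_0)$ of $u^0-\phi$ over $B_\delta(x_0)\times(t_0-\delta,t_0+\delta)$ (times restricted to $[0,T]$): $E_\delta(u^0,\phi,x_0,t_0)\le0$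 if $(x_0,t_0)\in\Omega\times(0,T]$; $\min\{E_\delta(u^0,\phi,x_0,t_0),u(x_0,t_0)\}\le 0$ if $(x_0,t_0)\in\partial\Omega\times(0,T]$; $\min\{E_\delta(u^0,\phi,x_0,t_0),u(x_0,t_0)-u_0(x_0)\}\le0$ if $x_0\in\overline\Omega$, $t_0=0$. A lower semicontinuous $v$ is a supersolution if at every minimum point $(x_0,t_0)$ of $\tilde v-\phi$: $E_\delta(\tilde v,\phi,x_0,t_0)\ge0$ in $\Omega\times(0,T]$; $\max\{E_\delta(\tilde v,\phi,x_0,t_0),v(x_0,t_0)\}\ge0$ on $\partial\Omega\times(0,T]$; $\max\{E_\delta(\tilde v,\phi,x_0,t_0),v(x_0,t_0)-u_0(x_0)\}\ge0$ if $x_0\in\overline\Omega$, $t_0=0$. A viscosity solution is a function whose upper and lower semicontinuous envelopes are respectively a sub- and a supersolution. Known background: under these assumptions the problem has a unique viscosity solution, defined globally in time, $u\in C(\overline\Omega\times[0,\infty))\cap L^\infty(\Omega\times(0,T))$ for all $T>0$; "the viscosity solution" refers to it. The seminorm is $[u_0]_{C^\beta(\overline\Omega)}=\sup_{x\ne y\in\overline\Omega}\frac{|u_0(x)-u_0(y)|}{|x-y|^\beta}$. *)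

theory Defs
  imports "HOL-Analysis.Analysis"
begin

text \<open>Functions of space and time are functions on \<^typ>\<open>(real^'n) \<times> real\<close>; the dimension
  $N$ is \<^term>\<open>CARD('n)\<close>.\<close>

section \<open>Regularity of functions and domains\<close>

text \<open>Twice continuous Frechet differentiability; meant for open \<open>S\<close>.\<close>

definition C2_on :: "'a::real_normed_vector set \<Rightarrow> ('a \<Rightarrow> real) \<Rightarrow> bool" where
  "C2_on S f \<longleftrightarrow>
     (\<exists>(f' :: 'a \<Rightarrow> 'a \<Rightarrow>\<^sub>L real) (f'' :: 'a \<Rightarrow> 'a \<Rightarrow>\<^sub>L 'a \<Rightarrow>\<^sub>L real).
        (\<forall>x\<in>S. (f has_derivative blinfun_apply (f' x)) (at x)) \<and>
        (\<forall>x\<in>S. (f' has_derivative blinfun_apply (f'' x)) (at x)) \<and>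
        continuous_on S f'')"

text \<open>Near each of its points the boundary is, after a rotation taking \<open>e\<close> to the last coordinate
  vector, the graph of a \<open>C\<^sup>2\<close> function \<open>\<gamma>\<close> of the remaining coordinates, with the
  set lying on one side.  The argument \<open>x - (x \<bullet> e) *\<^sub>R e\<close> is the projection of \<open>x\<close>
  to the hyperplane orthogonal to \<open>e\<close>, so only the values of \<open>\<gamma>\<close> on that hyperplane matter.\<close>

definition C2_boundary :: "(real^'n) set \<Rightarrow> bool" where
  "C2_boundary \<Omega> \<longleftrightarrow>
     (\<forall>z\<in>frontier \<Omega>. \<exists>r>0. \<exists>e \<gamma>. norm e = 1 \<and> C2_on UNIV \<gamma> \<and>
        \<Omega> \<inter> ball z r = {x \<in> ball z r. x \<bullet> e > \<gamma> (x - (x \<bullet> e) *\<^sub>R e)})"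

definition bounded_C2_domain :: "(real^'n) set \<Rightarrow> bool" where
  "bounded_C2_domain \<Omega> \<longleftrightarrow>
     \<Omega> \<noteq> {} \<and> open \<Omega> \<and> connected \<Omega> \<and> bounded \<Omega> \<and> C2_boundary \<Omega>"

definition holder_quotients :: "real \<Rightarrow> (real^'n) set \<Rightarrow> (real^'n \<Rightarrow> real) \<Rightarrow> real set" where
  "holder_quotients \<beta> S f =
     {\<bar>f x - f y\<bar> / norm (x - y) powr \<beta> | x y. x \<in> S \<and> y \<in> S \<and> x \<noteq> y}"

definition holder_on :: "real \<Rightarrow> (real^'n) set \<Rightarrow> (real^'n \<Rightarrow> real) \<Rightarrow> bool" where
  "holder_on \<beta> S f \<longleftrightarrow> bdd_above (holder_quotients \<beta> S f)"

definition holder_seminorm :: "real \<Rightarrow> (real^'n) set \<Rightarrow> (real^'n \<Rightarrow> real) \<Rightarrow> real" where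
  "holder_seminorm \<beta> S f = Sup (holder_quotients \<beta> S f)"

definition usc_on :: "'a::topological_space set \<Rightarrow> ('a \<Rightarrow> real) \<Rightarrow> bool" where
  "usc_on S f \<longleftrightarrow> (\<forall>a. openin (top_of_set S) {z \<in> S. f z < a})"

definition lsc_on :: "'a::topological_space set \<Rightarrow> ('a \<Rightarrow> real) \<Rightarrow> bool" where
  "lsc_on S f \<longleftrightarrow> (\<forall>a. openin (top_of_set S) {z \<in> S. f z > a})"

text \<open>Semicontinuous envelopes relative to \<open>S\<close>, for functions bounded on \<open>S\<close>.\<close>

definition usc_envelope :: "'a::metric_space set \<Rightarrow> ('a \<Rightarrow> real) \<Rightarrow> 'a \<Rightarrow> real" where
  "usc_envelope S f z = (INF r\<in>{0<..}. SUP w\<in>S \<inter> ball z r. f w)"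

definition lsc_envelope :: "'a::metric_space set \<Rightarrow> ('a \<Rightarrow> real) \<Rightarrow> 'a \<Rightarrow> real" where
  "lsc_envelope S f z = (SUP r\<in>{0<..}. INF w\<in>S \<inter> ball z r. f w)"

section \<open>The nonlocal operator\<close>

text \<open>$C_{N,s} = 4^s\,\Gamma(N/2+s) / (\pi^{N/2}\,|\Gamma(-s)|)$, where
  $|\Gamma(-s)| = \Gamma(1-s)/s$ for $0 < s < 1$; this makes $(-\Delta)^s$ the Fourier
  multiplier $|\xi|^{2s}$.\<close>

definition frac_const :: "'n itself \<Rightarrow> real \<Rightarrow> real" where
  "frac_const _ s =
     s * 4 powr s * Gamma (real CARD('n) / 2 + s)
       / (pi powr (real CARD('n) / 2) * Gamma (1 - s))"

definition pv_integral :: "real^'n \<Rightarrow> (real^'n) set \<Rightarrow> (real^'n \<Rightarrow> real) \<Rightarrow> real" where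
  "pv_integral x A f =
     Lim (at_right 0) (\<lambda>\<epsilon>. set_lebesgue_integral lebesgue (A - ball x \<epsilon>) f)"

text \<open>\<open>frac_op s UNIV\<close> is the fractional Laplacian $(-\Delta)^s$.\<close>

definition frac_op :: "real \<Rightarrow> (real^'n) set \<Rightarrow> (real^'n \<Rightarrow> real) \<Rightarrow> real^'n \<Rightarrow> real" where
  "frac_op s A \<psi> x =
     frac_const TYPE('n) s *
       pv_integral x A (\<lambda>y. (\<psi> x - \<psi> y) / norm (x - y) powr (real CARD('n) + 2 * s))"

definition gradient :: "('a::real_inner \<Rightarrow> real) \<Rightarrow> 'a \<Rightarrow> 'a" where
  "gradient f x = (THE D. GDERIV f x :> D)"

definition E_visc :: "real \<Rightarrow> real \<Rightarrow> real \<Rightarrow> ((real^'n) \<times> real \<Rightarrow> real) \<Rightarrow>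
    ((real^'n) \<times> real \<Rightarrow> real) \<Rightarrow> real^'n \<Rightarrow> real \<Rightarrow> real" where
  "E_visc s p \<delta> v \<phi> x t =
     deriv (\<lambda>\<tau>. \<phi> (x, \<tau>)) t
     + frac_op s (ball x \<delta>) (\<lambda>y. \<phi> (y, t)) x
     + frac_op s (- ball x \<delta>) (\<lambda>y. v (y, t)) x
     - norm (gradient (\<lambda>y. \<phi> (y, t)) x) powr p"

section \<open>Viscosity solutions\<close>

definition upper_ext :: "(real^'n) set \<Rightarrow> ((real^'n) \<times> real \<Rightarrow> real) \<Rightarrow>
    (real^'n) \<times> real \<Rightarrow> real" where
  "upper_ext \<Omega> u = (\<lambda>(x, t). if x \<in> \<Omega> then u (x, t)
     else if x \<in> frontier \<Omega> then max (u (x, t)) 0 else 0)"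

definition lower_ext :: "(real^'n) set \<Rightarrow> ((real^'n) \<times> real \<Rightarrow> real) \<Rightarrow>
    (real^'n) \<times> real \<Rightarrow> real" where
  "lower_ext \<Omega> u = (\<lambda>(x, t). if x \<in> \<Omega> then u (x, t)
     else if x \<in> frontier \<Omega> then min (u (x, t)) 0 else 0)"

definition cylinder :: "real \<Rightarrow> real^'n \<Rightarrow> real \<Rightarrow> ((real^'n) \<times> real) set" where
  "cylinder \<delta> x t = ball x \<delta> \<times> {t - \<delta><..<t + \<delta>}"

text \<open>A \<open>C\<^sup>2\<close> function on the open cylinder may blow up at its boundary.  The operator on
  \<open>ball x \<delta>\<close> is only defined for bounded functions, so boundedness of the time slice it is
  applied to is part of being a test function.\<close>

definition test_function :: "real \<Rightarrow> real^'n \<Rightarrow> real \<Rightarrow> ((real^'n) \<times> real \<Rightarrow> real) \<Rightarrow> bool" where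
  "test_function \<delta> x t \<phi> \<longleftrightarrow>
     C2_on (cylinder \<delta> x t) \<phi> \<and> bounded ((\<lambda>y. \<phi> (y, t)) ` ball x \<delta>)"

definition max_point :: "real \<Rightarrow> real \<Rightarrow> ((real^'n) \<times> real \<Rightarrow> real) \<Rightarrow> real^'n \<Rightarrow> real \<Rightarrow> bool" where
  "max_point T \<delta> w x t \<longleftrightarrow>
     (\<forall>z \<in> cylinder \<delta> x t \<inter> (UNIV \<times> {0..T}). w z \<le> w (x, t))"

definition min_point :: "real \<Rightarrow> real \<Rightarrow> ((real^'n) \<times> real \<Rightarrow> real) \<Rightarrow> real^'n \<Rightarrow> real \<Rightarrow> bool" where
  "min_point T \<delta> w x t \<longleftrightarrow>
     (\<forall>z \<in> cylinder \<delta> x t \<inter> (UNIV \<times> {0..T}). w (x, t) \<le> w z)"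

text \<open>Boundedness is required because \<open>E_visc\<close> involves integrals of the extension of the
  function over the complement of a ball.\<close>

definition visc_subsolution :: "(real^'n) set \<Rightarrow> real \<Rightarrow> real \<Rightarrow> (real^'n \<Rightarrow> real) \<Rightarrow> real \<Rightarrow>
    ((real^'n) \<times> real \<Rightarrow> real) \<Rightarrow> bool" where
  "visc_subsolution \<Omega> s p u0 T u \<longleftrightarrow>
     usc_on (closure \<Omega> \<times> {0..T}) u \<and> bounded (u ` (closure \<Omega> \<times> {0..T})) \<and>
     (\<forall>\<delta>>0. \<forall>x\<in>closure \<Omega>. \<forall>t\<in>{0..T}. \<forall>\<phi>.
        test_function \<delta> x t \<phi> \<longrightarrow>
        max_point T \<delta> (\<lambda>z. upper_ext \<Omega> u z - \<phi> z) x t \<longrightarrow>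
          (x \<in> \<Omega> \<and> 0 < t \<longrightarrow>
             E_visc s p \<delta> (upper_ext \<Omega> u) \<phi> x t \<le> 0) \<and>
          (x \<in> frontier \<Omega> \<and> 0 < t \<longrightarrow>
             min (E_visc s p \<delta> (upper_ext \<Omega> u) \<phi> x t) (u (x, t)) \<le> 0) \<and>
          (t = 0 \<longrightarrow>
             min (E_visc s p \<delta> (upper_ext \<Omega> u) \<phi> x t) (u (x, t) - u0 x) \<le> 0))"

definition visc_supersolution :: "(real^'n) set \<Rightarrow> real \<Rightarrow> real \<Rightarrow> (real^'n \<Rightarrow> real) \<Rightarrow> real \<Rightarrow>
    ((real^'n) \<times> real \<Rightarrow> real) \<Rightarrow> bool" where
  "visc_supersolution \<Omega> s p u0 T v \<longleftrightarrow>
     lsc_on (closure \<Omega> \<times> {0..T}) v \<and> bounded (v ` (closure \<Omega> \<times> {0..T})) \<and>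
     (\<forall>\<delta>>0. \<forall>x\<in>closure \<Omega>. \<forall>t\<in>{0..T}. \<forall>\<phi>.
        test_function \<delta> x t \<phi> \<longrightarrow>
        min_point T \<delta> (\<lambda>z. lower_ext \<Omega> v z - \<phi> z) x t \<longrightarrow>
          (x \<in> \<Omega> \<and> 0 < t \<longrightarrow>
             E_visc s p \<delta> (lower_ext \<Omega> v) \<phi> x t \<ge> 0) \<and>
          (x \<in> frontier \<Omega> \<and> 0 < t \<longrightarrow>
             max (E_visc s p \<delta> (lower_ext \<Omega> v) \<phi> x t) (v (x, t)) \<ge> 0) \<and>
          (t = 0 \<longrightarrow>
             max (E_visc s p \<delta> (lower_ext \<Omega> v) \<phi> x t) (v (x, t) - u0 x) \<ge> 0))"

definition visc_solution :: "(real^'n) set \<Rightarrow> real \<Rightarrow> real \<Rightarrow> (real^'n \<Rightarrow> real) \<Rightarrow> real \<Rightarrow>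
    ((real^'n) \<times> real \<Rightarrow> real) \<Rightarrow> bool" where
  "visc_solution \<Omega> s p u0 T u \<longleftrightarrow>
     bounded (u ` (closure \<Omega> \<times> {0..T})) \<and>
     visc_subsolution \<Omega> s p u0 T (usc_envelope (closure \<Omega> \<times> {0..T}) u) \<and>
     visc_supersolution \<Omega> s p u0 T (lsc_envelope (closure \<Omega> \<times> {0..T}) u)"

text \<open>The class $C(\overline\Omega\times[0,\infty)) \cap L^\infty(\Omega\times(0,T))$ for all
  $T$, in which the global viscosity solution is unique.\<close>

definition global_visc_solution :: "(real^'n) set \<Rightarrow> real \<Rightarrow> real \<Rightarrow> (real^'n \<Rightarrow> real) \<Rightarrow>
    ((real^'n) \<times> real \<Rightarrow> real) \<Rightarrow> bool" where
  "global_visc_solution \<Omega> s p u0 u \<longleftrightarrow>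
     continuous_on (closure \<Omega> \<times> {0..}) u \<and>
     (\<forall>T>0. bounded (u ` (\<Omega> \<times> {0<..<T})) \<and> visc_solution \<Omega> s p u0 T u)"

end

theory Submission
  imports Defs
begin

text \<open>
  The upper bound at the boundary uses a smooth strict supersolution as test function, so that no
  comparison principle between viscosity solutions is needed.  At \<open>z\<close> in the boundary let
  \<open>ball c r\<^sub>0\<close> be an exterior ball.  The barrier \<open>A (1 + K t) (|x - c|\<^sup>2 - r\<^sup>2)\<^sub>+\<^sup>b\<close> with
  \<open>r < r\<^sub>0\<close> is smooth near the closure of \<open>\<Omega>\<close>; the exponent \<open>b \<le> \<beta>\<close> lies in \<open>(\<beta>\<^sup>*, s)\<close>, an interval
  which is nonempty exactly because \<open>p < s / (1 - s)\<close>.  With \<open>D = |x - c|\<^sup>2 - r\<^sup>2\<close>, the fractional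
  Laplacian of the barrier is bounded below by a multiple of \<open>D powr (b - 2 s)\<close> for small \<open>D\<close>, because
  \<open>x\<^sub>+\<^sup>b\<close> has positive fractional Laplacian on the half line for \<open>b < s\<close>, and this beats the gradient
  term of order \<open>D powr ((b - 1) p)\<close> because \<open>b > \<beta>\<^sup>*\<close>.  Where \<open>D\<close> is not small, the time derivative
  dominates once \<open>K\<close> is large, and the barrier stays comparable to its initial value up to time
  \<open>1 / K\<close>.  Letting \<open>r\<close> tend to \<open>r\<^sub>0\<close> gives \<open>u(z, t) \<le> 0\<close>.  For the lower bound, and for the initial
  condition, it is enough to test with \<open>L |x - x\<^sub>1|\<^sup>2 + C t\<close> for suitable \<open>L\<close> and \<open>C\<close>.
\<close>

text \<open>Three difficulties shape the proof. A touching point may lie on the boundary or at time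
  zero; the barrier is positive on the closure of \<Omega> and lies above the initial data, so where
  \<open>u\<close> exceeds it \<open>u\<close> is positive (and above \<open>u0\<close> at time
  zero), and each alternative in the generalized conditions reduces to the interior inequality.
  Next, \<open>K\<close> and hence the existence time must not depend on \<open>r\<close>, or the
  limit would be empty; all estimates therefore use only bounds on \<open>|x - c|\<close> and on
  \<open>D\<close>. Finally, the sign of the fractional Laplacian is needed uniformly. Rescaling by
  \<open>D / 2\<rho>\<close> leaves two parameters, a unit direction and a curvature
  \<open>\<eta> = D / 4\<rho>\<^sup>2\<close>. For \<open>\<eta> = 0\<close> homogeneity factorizes
  the integral into an angular and a one-dimensional part, and the latter is compared with the
  exponent \<open>s\<close>, where an explicit primitive exists. Small \<open>\<eta>\<close> follow
  by compactness.\<close>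

section \<open>Second differences of powers of the positive part\<close>

lemma powr_le_Bernoulli:
  fixes x b :: real
  assumes "-1 \<le> x" "0 \<le> b" "b \<le> 1"
  shows "(1 + x) powr b \<le> 1 + b * x"
proof (cases "x = -1")
  case True
  then show ?thesis using assms by simp
next
  case False
  with assms have x: "0 < 1 + x" by simp
  have "(1 + x) powr b * 1 powr (1 - b) \<le> b * (1 + x) + (1 - b) * 1"
    using Youngs_inequality_0[of b "1 - b" "1 + x" 1] assms x by simp
  then show ?thesis by (simp add: algebra_simps)
qed

text \<open>Bernoulli's inequality at \<open>- t\<close>, with \<open>t = x / (1 + x)\<close> and
  \<open>1 - t = 1 / (1 + x)\<close>, bounds the reciprocal power from above; inverting it gives the
  lower bound \<open>1 + b * t\<close>. The constant 4 comes from
  \<open>x - t = x\<^sup>2 / (1 + x)\<close> and \<open>1 + x \<ge> 1/4\<close>.\<close>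

lemma powr_ge_quadratic:
  fixes x b :: real
  assumes "-3/4 \<le> x" "0 \<le> b" "b \<le> 1"
  shows "1 + b * x - 4 * x\<^sup>2 \<le> (1 + x) powr b"
proof -
  have x: "0 < 1 + x" using assms by simp
  define t where "t = x / (1 + x)"
  have t1: "1 - t = 1 / (1 + x)" using x by (simp add: t_def field_simps)
  have "0 < 1 - t" using t1 x by simp
  then have t2: "-1 \<le> -t" by simp
  have "(1 - t) powr b \<le> 1 - b * t"
    using powr_le_Bernoulli[of "-t" b] assms t2 by simp
  moreover have "(1 - t) powr b = 1 / (1 + x) powr b"
    using x by (simp add: t1 powr_divide)
  ultimately have le: "1 / (1 + x) powr b \<le> 1 - b * t" by simp
  have pos: "0 < (1 + x) powr b" using x by simp
  have "1 \<le> (1 - b * t) * (1 + x) powr b"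
    using le pos by (simp add: field_simps)
  moreover have "(1 + b * t) * ((1 - b * t) * (1 + x) powr b) \<le> (1 + x) powr b"
  proof -
    have "(1 + b * t) * (1 - b * t) = 1 - (b * t)\<^sup>2"
      by (simp add: algebra_simps power2_eq_square)
    then have "(1 + b * t) * (1 - b * t) \<le> 1" by simp
    then have "((1 + b * t) * (1 - b * t)) * (1 + x) powr b \<le> 1 * (1 + x) powr b"
      using pos by (intro mult_right_mono) auto
    then show ?thesis by (simp add: mult.assoc)
  qed
  ultimately have "1 + b * t \<le> (1 + x) powr b"
  proof (cases "0 \<le> 1 + b * t")
    case True
    then show ?thesis
      using mult_left_mono[OF \<open>1 \<le> (1 - b * t) * (1 + x) powr b\<close>, of "1 + b * t"]
        \<open>(1 + b * t) * ((1 - b * t) * (1 + x) powr b) \<le> (1 + x) powr b\<close> by simp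
  next
    case False
    then show ?thesis using pos by linarith
  qed
  moreover have "b * x - 4 * x\<^sup>2 \<le> b * t"
  proof -
    have "b * x - b * t = b * (x\<^sup>2 / (1 + x))"
      using x by (simp add: t_def field_simps power2_eq_square)
    also have "\<dots> \<le> 1 * (4 * x\<^sup>2)"
    proof (intro mult_mono)
      have "x\<^sup>2 * 1 \<le> x\<^sup>2 * (4 * (1 + x))"
        by (intro mult_left_mono) (use assms in auto)
      then show "x\<^sup>2 / (1 + x) \<le> 4 * x\<^sup>2" using x by (simp add: field_simps)
    qed (use assms x in auto)
    finally show ?thesis by simp
  qed
  ultimately show ?thesis by simp
qed

definition pospow :: "real \<Rightarrow> real \<Rightarrow> real" where
  "pospow b x = max 0 x powr b"

lemma pospow_nonneg [simp]: "0 \<le> pospow b x"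
  by (simp add: pospow_def)

lemma pospow_mono: "0 \<le> b \<Longrightarrow> x \<le> y \<Longrightarrow> pospow b x \<le> pospow b y"
  unfolding pospow_def by (intro powr_mono2) auto

lemma pospow_pos_eq: "0 < x \<Longrightarrow> pospow b x = x powr b"
  by (simp add: pospow_def max_def)

lemma pospow_mult: "0 \<le> c \<Longrightarrow> pospow b (c * x) = c powr b * pospow b x"
  unfolding pospow_def
  by (metis max.cobounded1 max_mult_distrib_left mult_zero_right powr_mult)

lemma tendsto_pospow [tendsto_intros]:
  assumes "(f \<longlongrightarrow> l) F" "0 < b"
  shows "((\<lambda>x. pospow b (f x)) \<longlongrightarrow> pospow b l) F"
  unfolding pospow_def using assms
  by (intro tendsto_powr2 tendsto_max tendsto_const) auto

lemma continuous_on_pospow [continuous_intros]: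
  "continuous_on S f \<Longrightarrow> 0 < b \<Longrightarrow> continuous_on S (\<lambda>x. pospow b (f x))"
  unfolding continuous_on_def by (auto intro: tendsto_pospow)

lemma borel_measurable_pospow [measurable (raw)]:
  "f \<in> borel_measurable M \<Longrightarrow> (\<lambda>x. pospow b (f x)) \<in> borel_measurable M"
  unfolding pospow_def by measurable

text \<open>After rescaling, the barrier along a line is the \<open>b\<close>-th power of \<open>1 + a + q\<close> with \<open>a\<close> linear and
  \<open>q\<close> quadratic in the increment.\<close>

definition sdiff :: "real \<Rightarrow> real \<Rightarrow> real \<Rightarrow> real" where
  "sdiff b a q = 2 - pospow b (1 + a + q) - pospow b (1 - a + q)"

text \<open>Far from the origin this is the growth of the \<open>b\<close>-th power of a quadratic
  polynomial. The constant 22 = 8 + 7 + 7 comes from that range, where \<open>2\<close> is at most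
  \<open>8 * \<rho> powr (2 * b)\<close> and each power at most
  \<open>7 * \<rho> powr (2 * b)\<close>; for small \<rho> the constant 16 + 1/2 would do.\<close>

definition sdiff_bound :: "real \<Rightarrow> real \<Rightarrow> real" where
  "sdiff_bound b \<rho> = 22 * (if \<rho> \<le> 1/2 then \<rho>\<^sup>2 else \<rho> powr (2 * b))"

lemma sdiff_bound_nonneg: "0 \<le> sdiff_bound b \<rho>"
  by (simp add: sdiff_bound_def)

lemma abs_sdiff_le:
  assumes b: "0 < b" "b \<le> 1" and a: "\<bar>a\<bar> \<le> \<rho>" and q: "0 \<le> q" "q \<le> \<rho>\<^sup>2 / 4"
  shows "\<bar>sdiff b a q\<bar> \<le> sdiff_bound b \<rho>"
proof (cases "\<rho> \<le> 1/2")
  case True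
  have \<rho>: "0 \<le> \<rho>" using a by simp
  have q': "q \<le> \<rho> / 8"
  proof -
    have "\<rho>\<^sup>2 \<le> \<rho> * (1/2)" unfolding power2_eq_square using True \<rho> by (intro mult_left_mono) auto
    then show ?thesis using q by simp
  qed
  have *: "\<bar>(1 + x) powr b - 1 - b * x\<bar> \<le> 8 * \<rho>\<^sup>2" if "\<bar>x\<bar> \<le> 9/8 * \<rho>" for x
  proof -
    have "\<bar>x\<bar> \<le> 9/16" using that True by simp
    then have x: "-3/4 \<le> x" by simp
    have "x\<^sup>2 \<le> (9/8 * \<rho>)\<^sup>2" using that by (metis abs_ge_zero power2_abs power_mono)
    moreover have "(9/8 * \<rho>)\<^sup>2 = 81/64 * \<rho>\<^sup>2" by (simp add: power_mult_distrib power_divide)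
    ultimately have "4 * x\<^sup>2 \<le> 8 * \<rho>\<^sup>2" using zero_le_power2[of \<rho>] by linarith
    then show ?thesis
      using powr_le_Bernoulli[of x b] powr_ge_quadratic[of x b] x b by simp
  qed
  have x1: "\<bar>a + q\<bar> \<le> 9/8 * \<rho>" and x2: "\<bar>- a + q\<bar> \<le> 9/8 * \<rho>" using a q q' by linarith+
  have p: "1 + (a + q) > 0" "1 + (- a + q) > 0" using x1 x2 True by linarith+
  have "sdiff b a q = 2 - (1 + (a + q)) powr b - (1 + (- a + q)) powr b"
    using pospow_pos_eq[OF p(1), of b] pospow_pos_eq[OF p(2), of b]
    by (simp add: sdiff_def algebra_simps)
  also have "\<bar>\<dots>\<bar> \<le> 16 * \<rho>\<^sup>2 + 2 * (b * q)"
  proof -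
    define P Q u v where "P = (1 + (a + q)) powr b" "Q = (1 + (- a + q)) powr b" "u = b * a" "v = b * q"
    have "b * (a + q) = u + v" "b * (- a + q) = - u + v" "0 \<le> v"
      using b q by (simp_all add: P_Q_u_v_def algebra_simps)
    then have "\<bar>P - 1 - (u + v)\<bar> \<le> 8 * \<rho>\<^sup>2" "\<bar>Q - 1 - (- u + v)\<bar> \<le> 8 * \<rho>\<^sup>2" "0 \<le> v"
      using *[OF x1] *[OF x2] by (simp_all add: P_Q_u_v_def)
    then have "\<bar>2 - P - Q\<bar> \<le> 16 * \<rho>\<^sup>2 + 2 * v" unfolding abs_le_iff by linarith
    then show ?thesis by (simp add: P_Q_u_v_def)
  qed
  also have "b * q \<le> 1 * (\<rho>\<^sup>2 / 4)" using b q by (intro mult_mono) auto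
  finally show ?thesis using True zero_le_power2[of \<rho>] unfolding sdiff_bound_def by simp
next
  case False
  then have \<rho>: "1/2 < \<rho>" by simp
  have s: "\<rho> \<le> 2 * \<rho>\<^sup>2" "1 \<le> 4 * \<rho>\<^sup>2"
  proof -
    have "(1/2) * \<rho> \<le> \<rho> * \<rho>" by (intro mult_right_mono) (use \<rho> in auto)
    then show "\<rho> \<le> 2 * \<rho>\<^sup>2" by (simp add: power2_eq_square)
    then show "1 \<le> 4 * \<rho>\<^sup>2" using \<rho> by linarith
  qed
  have *: "pospow b (1 + x + q) \<le> 7 * \<rho> powr (2 * b)" if "\<bar>x\<bar> \<le> \<rho>" for x
  proof -
    have "pospow b (1 + x + q) \<le> pospow b (7 * \<rho>\<^sup>2)"
      using that q s b by (intro pospow_mono) auto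
    also have "\<dots> = 7 powr b * \<rho> powr (2 * b)"
      using \<rho> by (simp add: pospow_pos_eq powr_mult powr_powr[symmetric] flip: powr_numeral)
    also have "\<dots> \<le> 7 powr 1 * \<rho> powr (2 * b)"
      using b by (intro mult_right_mono powr_mono) auto
    finally show ?thesis by simp
  qed
  have "1 = (4 * \<rho>\<^sup>2) powr 0" using \<rho> by simp
  also have "\<dots> \<le> (4 * \<rho>\<^sup>2) powr b" using s b by (intro powr_mono) auto
  also have "\<dots> = 4 powr b * \<rho> powr (2 * b)"
    using \<rho> by (simp add: powr_mult powr_powr[symmetric] flip: powr_numeral)
  also have "\<dots> \<le> 4 powr 1 * \<rho> powr (2 * b)"
    using b by (intro mult_right_mono powr_mono) auto
  finally have 1: "1 \<le> 4 * \<rho> powr (2 * b)" by simp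
  have "\<bar>sdiff b a q\<bar> \<le> 2 + pospow b (1 + a + q) + pospow b (1 + (- a) + q)"
    unfolding sdiff_def using pospow_nonneg[of b "1 + a + q"] pospow_nonneg[of b "1 - a + q"]
    by (simp add: abs_if)
  then show ?thesis using *[of a] *[of "- a"] a 1 False by (simp add: sdiff_bound_def)
qed

lemma sdiff_even: "sdiff b (- a) q = sdiff b a q"
  by (simp add: sdiff_def)

lemma sdiff_abs: "sdiff b \<bar>a\<bar> q = sdiff b a q"
  by (simp add: abs_if sdiff_even)

lemma sdiff_zero [simp]: "sdiff b 0 0 = 0"
  by (simp add: sdiff_def pospow_def)

lemma borel_measurable_sdiff [measurable (raw)]:
  assumes [measurable]: "f \<in> borel_measurable M" "g \<in> borel_measurable M"
  shows "(\<lambda>x. sdiff b (f x) (g x)) \<in> borel_measurable M"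
  unfolding sdiff_def by measurable

lemma borel_measurable_sdiff_bound [measurable (raw)]:
  assumes [measurable]: "f \<in> borel_measurable M"
  shows "(\<lambda>x. sdiff_bound b (f x)) \<in> borel_measurable M"
  unfolding sdiff_bound_def by measurable

section \<open>Polar coordinates by rescaling an annulus\<close>

lemma nn_integral_scaleR:
  fixes f :: "'a::euclidean_space \<Rightarrow> ennreal"
  assumes [measurable]: "f \<in> borel_measurable borel" and c: "c > 0"
  shows "(\<integral>\<^sup>+x. f x \<partial>lborel) = ennreal (c ^ DIM('a)) * (\<integral>\<^sup>+x. f (c *\<^sub>R x) \<partial>lborel)"
proof -
  have "(\<integral>\<^sup>+x. f x \<partial>lborel) =
      (\<integral>\<^sup>+x. f x \<partial>density (distr lborel borel (\<lambda>x. 0 + c *\<^sub>R x)) (\<lambda>_. \<bar>c\<bar> ^ DIM('a)))"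
    using c lborel_affine[of c "0::'a"] by simp
  also have "\<dots> = (\<integral>\<^sup>+x. ennreal (c ^ DIM('a)) * f (c *\<^sub>R x) \<partial>lborel)"
    using c by (simp add: nn_integral_density nn_integral_distr)
  finally show ?thesis by (simp add: nn_integral_cmult)
qed

lemma nn_integral_inverse_Icc:
  fixes a b :: real
  assumes "0 < a" "a \<le> b"
  shows "(\<integral>\<^sup>+x. ennreal (inverse x) * indicator {a..b} x \<partial>lborel) = ennreal (ln b - ln a)"
  using assms
  by (intro nn_integral_FTC_Icc) (auto intro!: derivative_eq_intros simp: divide_inverse)

abbreviation annulus :: "'a::real_normed_vector set" where
  "annulus \<equiv> {w. 1 \<le> norm w \<and> norm w \<le> 2}"

text \<open>A substitute for polar coordinates that needs no surface measure. A point
  \<open>z \<noteq> 0\<close> lies in the dilated annulus exactly for \<open>l\<close> between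
  \<open>norm z / 2\<close> and \<open>norm z\<close>, an interval of measure \<open>ln 2\<close>
  for \<open>dl / l\<close>, so averaging over all dilations counts every point with the same
  weight.\<close>

lemma nn_integral_annulus:
  fixes F :: "'a::euclidean_space \<Rightarrow> ennreal"
  assumes [measurable]: "F \<in> borel_measurable borel"
  shows "(\<integral>\<^sup>+w. (\<integral>\<^sup>+l. F (l *\<^sub>R w) * ennreal (l ^ DIM('a)) * ennreal (inverse l) *
             indicator {0<..} l \<partial>lborel) * indicator annulus w \<partial>lborel)
       = ennreal (ln 2) * (\<integral>\<^sup>+z. F z \<partial>lborel)" (is "?L = ?R")
proof -
  have "?L = (\<integral>\<^sup>+w. (\<integral>\<^sup>+l. F (l *\<^sub>R w) * ennreal (l ^ DIM('a)) * ennreal (inverse l) *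
             indicator {0<..} l * indicator annulus w \<partial>lborel) \<partial>(lborel::'a measure))"
    by (subst nn_integral_multc[symmetric]) auto
  also have "\<dots> = (\<integral>\<^sup>+l. (\<integral>\<^sup>+w. F (l *\<^sub>R w) * ennreal (l ^ DIM('a)) * ennreal (inverse l) *
             indicator {0<..} l * indicator annulus w \<partial>(lborel::'a measure)) \<partial>(lborel))"
    by (intro lborel_pair.Fubini' ) measurable
  also have "\<dots> = (\<integral>\<^sup>+l. ennreal (inverse l) * indicator {0<..} l *
       (\<integral>\<^sup>+z. F z * indicator {z. l \<le> norm z \<and> norm z \<le> 2 * l} z \<partial>(lborel::'a measure)) \<partial>lborel)"
  proof (intro nn_integral_cong)
    fix l :: real
    show "(\<integral>\<^sup>+w. F (l *\<^sub>R w) * ennreal (l ^ DIM('a)) * ennreal (inverse l) *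
             indicator {0<..} l * indicator annulus w \<partial>(lborel::'a measure)) =
       ennreal (inverse l) * indicator {0<..} l *
       (\<integral>\<^sup>+z. F z * indicator {z. l \<le> norm z \<and> norm z \<le> 2 * l} z \<partial>(lborel::'a measure))"
    proof (cases "0 < l")
      case True
      have "(\<integral>\<^sup>+z. F z * indicator {z. l \<le> norm z \<and> norm z \<le> 2 * l} z \<partial>(lborel::'a measure))
        = ennreal (l ^ DIM('a)) *
          (\<integral>\<^sup>+w. F (l *\<^sub>R w) * indicator {z. l \<le> norm z \<and> norm z \<le> 2 * l} (l *\<^sub>R w) \<partial>lborel)"
        by (rule nn_integral_scaleR[OF _ True]) measurable
      also have "(\<lambda>w::'a. indicator {z. l \<le> norm z \<and> norm z \<le> 2 * l} (l *\<^sub>R w) :: ennreal) = indicator annulus"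
        using True by (auto simp: fun_eq_iff indicator_def)
      finally have 1: "(\<integral>\<^sup>+z. F z * indicator {z. l \<le> norm z \<and> norm z \<le> 2 * l} z \<partial>(lborel::'a measure))
        = ennreal (l ^ DIM('a)) * (\<integral>\<^sup>+w. F (l *\<^sub>R w) * indicator annulus w \<partial>lborel)"
        by simp
      have "(\<integral>\<^sup>+w. F (l *\<^sub>R w) * ennreal (l ^ DIM('a)) * ennreal (inverse l) *
             indicator {0<..} l * indicator annulus w \<partial>(lborel::'a measure)) =
          (\<integral>\<^sup>+w. (ennreal (inverse l) * ennreal (l ^ DIM('a))) *
             (F (l *\<^sub>R w) * indicator annulus w) \<partial>(lborel::'a measure))"
        using True by (intro nn_integral_cong) (auto simp: indicator_def mult_ac)
      also have "\<dots> = (ennreal (inverse l) * ennreal (l ^ DIM('a))) *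
          (\<integral>\<^sup>+w. F (l *\<^sub>R w) * indicator annulus w \<partial>(lborel::'a measure))"
        by (rule nn_integral_cmult) measurable
      finally show ?thesis
        using True unfolding 1 by (simp add: mult.assoc)
    qed simp
  qed
  also have "\<dots> = (\<integral>\<^sup>+l. (\<integral>\<^sup>+z. ennreal (inverse l) * indicator {0<..} l *
        (F z * indicator {z. l \<le> norm z \<and> norm z \<le> 2 * l} z) \<partial>(lborel::'a measure)) \<partial>lborel)"
    by (intro nn_integral_cong nn_integral_cmult[symmetric]) measurable
  also have "\<dots> = (\<integral>\<^sup>+z. (\<integral>\<^sup>+l. ennreal (inverse l) * indicator {0<..} l *
        (F z * indicator {z. l \<le> norm z \<and> norm z \<le> 2 * l} z) \<partial>lborel) \<partial>(lborel::'a measure))"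
    by (intro lborel_pair.Fubini') measurable
  also have "\<dots> = (\<integral>\<^sup>+z. F z * ennreal (ln 2) \<partial>(lborel::'a measure))"
  proof (intro nn_integral_cong_AE)
    have "AE z in lborel. z \<noteq> (0::'a)" by (rule AE_lborel_singleton)
    then show "AE z in (lborel::'a measure). (\<integral>\<^sup>+l. ennreal (inverse l) * indicator {0<..} l *
        (F z * indicator {z. l \<le> norm z \<and> norm z \<le> 2 * l} z) \<partial>lborel) = F z * ennreal (ln 2)"
    proof eventually_elim
      fix z :: 'a assume "z \<noteq> 0"
      then have z: "0 < norm z" by simp
      have "(\<integral>\<^sup>+l. ennreal (inverse l) * indicator {0<..} l *
        (F z * indicator {z. l \<le> norm z \<and> norm z \<le> 2 * l} z) \<partial>lborel) =
        (\<integral>\<^sup>+l. F z * (ennreal (inverse l) * indicator {norm z / 2..norm z} l) \<partial>lborel)"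
        using z by (intro nn_integral_cong) (auto simp: indicator_def ac_simps)
      also have "\<dots> = F z * (\<integral>\<^sup>+l. ennreal (inverse l) * indicator {norm z / 2..norm z} l \<partial>lborel)"
        by (rule nn_integral_cmult) measurable
      also have "\<dots> = F z * ennreal (ln 2)"
        using z by (subst nn_integral_inverse_Icc) (auto simp: ln_div)
      finally show "(\<integral>\<^sup>+l. ennreal (inverse l) * indicator {0<..} l *
        (F z * indicator {z. l \<le> norm z \<and> norm z \<le> 2 * l} z) \<partial>lborel) = F z * ennreal (ln 2)" .
    qed
  qed
  finally show ?thesis by (simp add: nn_integral_multc mult.commute)
qed

section \<open>Positivity in one dimension\<close>

lemma sdiff_nonneg:
  fixes b t :: real
  assumes "0 < b" "b \<le> 1" "0 \<le> t" "t \<le> 1"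
  shows "0 \<le> sdiff b t 0"
proof -
  have "pospow b (1 + t) \<le> 1 + b * t" "pospow b (1 - t) \<le> 1 - b * t"
    using powr_le_Bernoulli[of t b] powr_le_Bernoulli[of "-t" b] assms by (simp_all add: pospow_def max_def)
  then show ?thesis by (simp add: sdiff_def)
qed

text \<open>This primitive is the reason why \<open>x\<^sub>+\<^sup>s\<close> is \<open>s\<close>-harmonic on the half line.\<close>

lemma has_integral_critical:
  fixes s a :: real
  assumes s: "0 < s" "s < 1" and a: "0 < a" "a \<le> 1"
  shows "((\<lambda>x. (1 - (1 - x) powr s) * (1 - (1 - x) powr (s - 1)) * x powr (- 1 - 2 * s)) has_integral
     ((1 - (1 - a) powr s)\<^sup>2 * a powr (- 2 * s) / (2 * s) - 1 / (2 * s))) {a..1}"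
proof -
  define g where "g x = - ((1 - (1 - x) powr s)\<^sup>2 * x powr (- 2 * s) / (2 * s))" for x
  have "((\<lambda>x. (1 - (1 - x) powr s) * (1 - (1 - x) powr (s - 1)) * x powr (- 1 - 2 * s)) has_integral
     g 1 - g a) {a..1}"
  proof (rule fundamental_theorem_of_calculus_interior)
    have *: "continuous_on {a..1} (\<lambda>x. (1 - x) powr s)"
      by (intro continuous_on_powr' continuous_intros) (use s in auto)
    have "continuous_on {a..1} (\<lambda>x. - ((1 - p x)\<^sup>2 * x powr (- 2 * s) / (2 * s)))"
      if "continuous_on {a..1} p" for p
      using that s a by (intro continuous_intros) auto
    from this[OF *] show "continuous_on {a..1} g" unfolding g_def .
    fix x assume "x \<in> {a<..<1}"
    then have x: "0 < x" "x < 1" using a by auto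
    define y where "y = 1 - x"
    have y: "0 < y" "x = 1 - y" using x by (auto simp: y_def)
    have e1: "x powr (- 2 * s) = x * x powr (- 1 - 2 * s)"
      using x powr_add[of x 1 "-1 - 2 * s"] by simp
    have e2: "y powr s = y * y powr (s - 1)"
      using y powr_add[of y 1 "s - 1"] by simp
    have "(g has_real_derivative
       - ((2 * (1 - (1 - x) powr s) * (s * (1 - x) powr (s - 1))) * x powr (- 2 * s) +
          (1 - (1 - x) powr s)\<^sup>2 * (- 2 * s * x powr (- 2 * s - 1))) / (2 * s)) (at x)"
      unfolding g_def using x s
      by (auto intro!: derivative_eq_intros simp: field_simps)
    also have "x powr (- 2 * s - 1) = x powr (- 1 - 2 * s)"
      by (rule arg_cong[where f = "\<lambda>z. x powr z"]) simp
    also have "- ((2 * (1 - (1 - x) powr s) * (s * (1 - x) powr (s - 1))) * x powr (- 2 * s) +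
          (1 - (1 - x) powr s)\<^sup>2 * (- 2 * s * x powr (- 1 - 2 * s))) / (2 * s)
       = (1 - (1 - x) powr s) * (1 - (1 - x) powr (s - 1)) * x powr (- 1 - 2 * s)"
      unfolding e1 y_def[symmetric] e2 using s unfolding y(2)
      by (simp add: field_simps power2_eq_square)
    finally show "(g has_vector_derivative
      (1 - (1 - x) powr s) * (1 - (1 - x) powr (s - 1)) * x powr (- 1 - 2 * s)) (at x)"
      by (simp add: has_real_derivative_iff_has_vector_derivative)
  qed (use a in auto)
  then show ?thesis by (simp add: g_def)
qed

text \<open>Pairing \<open>y = 1 - x\<close> with \<open>1 / y = 1 + x / (1 - x)\<close> turns the principal value over the whole
  half line into an integral over \<open>(0, 1)\<close>.\<close>

lemma has_integral_inversion:
  fixes s a b :: real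
  assumes a: "0 < a" "a < 1"
    and f: "(\<lambda>t. (1 - (1 + t) powr b) * t powr (- 1 - 2 * s)) absolutely_integrable_on {a / (1 - a)..}"
  shows "((\<lambda>x. (1 - (1 - x) powr (- b)) * (1 - x) powr (2 * s - 1) * x powr (- 1 - 2 * s)) has_integral
     integral {a / (1 - a)..} (\<lambda>t. (1 - (1 + t) powr b) * t powr (- 1 - 2 * s))) {a..<1}"
proof -
  define g where "g x = x / (1 - x)" for x :: real
  define h where "h x = 1 / (1 - x)\<^sup>2" for x :: real
  define k where "k t = (1 - (1 + t) powr b) * t powr (- 1 - 2 * s)" for t
  have im: "g ` {a..<1} = {a / (1 - a)..}"
  proof (intro equalityI subsetI)
    fix t assume "t \<in> g ` {a..<1}"
    then obtain x where x: "a \<le> x" "x < 1" "t = x / (1 - x)" by (auto simp: g_def)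
    then show "t \<in> {a / (1 - a)..}" using a by (auto intro!: frac_le)
  next
    fix t assume t: "t \<in> {a / (1 - a)..}"
    have "0 \<le> a / (1 - a)" using a by simp
    with t have t0: "0 \<le> t" by simp
    have "a \<le> t * (1 - a)" using t a by (simp add: field_simps)
    then have "a \<le> t / (1 + t)" using t0 by (simp add: field_simps)
    moreover have "t / (1 + t) < 1" "g (t / (1 + t)) = t" using t0 by (simp_all add: g_def field_simps)
    ultimately show "t \<in> g ` {a..<1}" by (metis atLeastLessThan_iff imageI)
  qed
  have inj: "inj_on g {a..<1}" by (auto simp: inj_on_def g_def field_simps)
  have "(\<lambda>x. \<bar>h x\<bar> * k (g x)) absolutely_integrable_on {a..<1} \<and>
      integral {a..<1} (\<lambda>x. \<bar>h x\<bar> * k (g x)) = integral {a / (1 - a)..} k"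
  proof (subst has_absolute_integral_change_of_variables_1'[where g = g])
    show "(g has_real_derivative h x) (at x within {a..<1})" if "x \<in> {a..<1}" for x
      unfolding g_def h_def using that
      by (auto intro!: derivative_eq_intros simp: power2_eq_square field_simps)
  qed (use f inj im in \<open>auto simp: k_def[abs_def]\<close>)
  then have "((\<lambda>x. \<bar>h x\<bar> * k (g x)) has_integral integral {a / (1 - a)..} k) {a..<1}"
    using has_integral_integral set_lebesgue_integral_eq_integral(1) by metis
  moreover have "\<bar>h x\<bar> * k (g x) =
      (1 - (1 - x) powr (- b)) * (1 - x) powr (2 * s - 1) * x powr (- 1 - 2 * s)" if "x \<in> {a..<1}" for x
  proof -
    define y where "y = 1 - x"
    have x: "0 < x" "0 < y" "x = 1 - y" using that a by (auto simp: y_def)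
    have "k (g x) = (1 - (1 / y) powr b) * (x / y) powr (- 1 - 2 * s)"
      unfolding k_def g_def y_def[symmetric] using x by (simp add: field_simps)
    also have "(1 / y) powr b = y powr (- b)"
      using x by (simp add: powr_divide powr_minus_divide)
    also have "(x / y) powr (- 1 - 2 * s) = x powr (- 1 - 2 * s) * y powr (1 + 2 * s)"
      using x powr_minus_divide[of y "1 + 2 * s"] by (simp add: powr_divide)
    also have "y powr (1 + 2 * s) = y powr (2 * s - 1) * y\<^sup>2"
      using x powr_add[of y "2 * s - 1" 2] by simp
    finally have "k (g x) = (1 - y powr (- b)) * (x powr (- 1 - 2 * s) * (y powr (2 * s - 1) * y\<^sup>2))" .
    then show ?thesis using x(2) unfolding h_def y_def[symmetric] by simp
  qed
  ultimately show ?thesis unfolding k_def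
    by (rule has_integral_eq[rotated]) simp
qed

text \<open>With \<open>y = 1 - x\<close>, right side minus left side is the product
  \<open>(y powr (s - 1) - y powr b) * (1 - y powr (s - b))\<close>. The right side is the paired
  integrand for the exponent \<open>b\<close>, and the left side is what it becomes for
  \<open>b = s\<close>.\<close>

lemma critical_gap:
  fixes b s x :: real
  assumes "0 < b" "b < s" "s < 1" "0 < x" "x < 1"
  shows "(1 - (1 - x) powr s) * (1 - (1 - x) powr (s - 1)) <
     (1 - (1 - x) powr b) + (1 - (1 - x) powr (- b)) * (1 - x) powr (2 * s - 1)"
proof -
  define y where "y = 1 - x"
  have y: "0 < y" "y < 1" using assms by (auto simp: y_def)
  have "y powr b < y powr (s - 1)" "y powr (s - b) < 1"
    using y assms by (auto simp: powr_less_mono' powr01_less_one)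
  then have "0 < (y powr (s - 1) - y powr b) * (1 - y powr (s - b))" by simp
  also have "\<dots> = y powr (s - 1) - y powr (2 * s - 1 - b) - y powr b + y powr s"
    using y by (simp add: algebra_simps powr_add[symmetric])
  also have "\<dots> = ((1 - y powr b) + (1 - y powr (- b)) * y powr (2 * s - 1)) -
     (1 - y powr s) * (1 - y powr (s - 1))"
    using y by (simp add: algebra_simps powr_add[symmetric])
  finally show ?thesis by (simp add: y_def)
qed

text \<open>After cutting off at \<open>a\<close> and pairing by inversion, the integrand exceeds
  the one for the exponent \<open>s\<close>, whose integral is known from the primitive. The excess
  survives the limit because it is bounded below on a fixed interval, while the cut-off costs only a
  power of \<open>a\<close>.\<close>

lemma integral_sdiff_pos:
  assumes b: "0 < b" "b < s" and s: "s < 1"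
    and int: "(\<lambda>t. sdiff b t 0 * t powr (- 1 - 2 * s)) absolutely_integrable_on {0..}"
  shows "0 < integral {0..} (\<lambda>t. sdiff b t 0 * t powr (- 1 - 2 * s))"
proof -
  define w where "w t = t powr (- 1 - 2 * s)" for t :: real
  define G where "G x = (1 - (1 - x) powr s) * (1 - (1 - x) powr (s - 1)) * w x" for x
  define f1 where "f1 t = (1 - (1 + t) powr b) * w t" for t
  define f2 where "f2 t = (1 - pospow b (1 - t)) * w t" for t
  define h where "h x = (1 - (1 - x) powr (- b)) * (1 - x) powr (2 * s - 1) * w x" for x
  have gap: "G x < h x + f2 x" if "0 < x" "x < 1" for x
  proof -
    have "((1 - (1 - x) powr s) * (1 - (1 - x) powr (s - 1))) * w x <
     ((1 - (1 - x) powr b) + (1 - (1 - x) powr (- b)) * (1 - x) powr (2 * s - 1)) * w x"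
      using critical_gap[of b s x] b s that by (intro mult_strict_right_mono) (auto simp: w_def)
    then show ?thesis
      using that by (simp add: G_def h_def f2_def pospow_pos_eq algebra_simps)
  qed
  \<comment> \<open>The gap is positive only pointwise; compactness makes it uniform on an interval
    away from both singular ends. \<gamma> is fixed before \<open>a\<close>, so \<open>a\<close> can
    be chosen to make the cut-off error small against it.\<close>
  obtain \<gamma> where \<gamma>: "0 < \<gamma>" "\<And>x. x \<in> {1/2..3/4} \<Longrightarrow> \<gamma> \<le> h x + f2 x - G x"
  proof -
    have "continuous_on {1/2..3/4} (\<lambda>x. h x + f2 x - G x)"
      unfolding h_def f2_def G_def w_def using b s by (intro continuous_intros) auto
    then obtain x0 where x0: "x0 \<in> {1/2..3/4::real}"
        "\<And>x. x \<in> {1/2..3/4} \<Longrightarrow> h x0 + f2 x0 - G x0 \<le> h x + f2 x - G x"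
      using continuous_attains_inf[of "{1/2..3/4::real}" "\<lambda>x. h x + f2 x - G x"] by force
    show ?thesis
      by (rule that[of "h x0 + f2 x0 - G x0"]) (use x0 gap[of x0] in auto)
  qed
  define a where "a = min (1/2) ((\<gamma> / 16) powr (1 / (2 - 2 * s)))"
  have a: "0 < a" "a \<le> 1/2" using \<gamma> by (auto simp: a_def)
  have a2: "a powr (2 - 2 * s) \<le> \<gamma> / 16"
  proof -
    have "a powr (2 - 2 * s) \<le> ((\<gamma> / 16) powr (1 / (2 - 2 * s))) powr (2 - 2 * s)"
      using a s by (intro powr_mono2) (auto simp: a_def)
    then show ?thesis using s \<gamma> by (simp add: powr_powr)
  qed
  \<comment> \<open>Inversion carries \<open>[a, 1)\<close> onto \<open>[a', \<infinity>)\<close>,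
    so \<open>f1\<close> on \<open>[a, a']\<close> has no partner. That interval has length at most
    \<open>2 * a\<^sup>2\<close> and \<open>f1\<close> is at least
    \<open>- (a powr (- 2 * s))\<close> on it, a loss of at most \<open>\<gamma> / 8\<close> by the
    choice of \<open>a\<close>.\<close>
  define a' where "a' = a / (1 - a)"
  have a': "a \<le> a'" "a' \<le> 1" "a' - a \<le> 2 * a\<^sup>2"
  proof -
    have "1 - a \<ge> 1/2" using a by simp
    have "a' - a = a\<^sup>2 / (1 - a)" using a by (simp add: a'_def field_simps power2_eq_square)
    moreover have "a\<^sup>2 / (1 - a) \<le> a\<^sup>2 / (1/2)" using a by (intro divide_left_mono) auto
    moreover have "0 \<le> a\<^sup>2 / (1 - a)" using a by simp
    ultimately show "a \<le> a'" "a' - a \<le> 2 * a\<^sup>2" by auto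
    show "a' \<le> 1" using a by (simp add: a'_def)
  qed
  have kf: "sdiff b t 0 * w t = f1 t + f2 t" if "0 < t" for t
    using that by (simp add: sdiff_def f1_def f2_def pospow_pos_eq algebra_simps)
  have int_w: "(w has_integral c powr (- 2 * s) / (2 * s)) {c..}" if "0 < c" for c
    using has_integral_powr_to_inf[of "- 1 - 2 * s" c] that b s by (simp add: w_def[abs_def] field_simps)
  have abs_int_f2: "f2 absolutely_integrable_on {a..}"
  proof (rule measurable_bounded_by_integrable_imp_absolutely_integrable)
    have "continuous_on {a..} f2"
      unfolding f2_def w_def using a b by (intro continuous_intros) auto
    then show "f2 \<in> borel_measurable (lebesgue_on {a..})"
      by (intro continuous_imp_measurable_on_sets_lebesgue) auto
    show "w integrable_on {a..}" using int_w[of a] a by blast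
    fix t assume "t \<in> {a..}"
    then have "0 \<le> pospow b (1 - t)" "pospow b (1 - t) \<le> 1"
      using a b by (auto simp: pospow_def powr_le1)
    then have "\<bar>1 - pospow b (1 - t)\<bar> * w t \<le> 1 * w t"
      by (intro mult_right_mono) (auto simp: w_def)
    then show "norm (f2 t) \<le> w t" by (simp add: f2_def abs_mult w_def)
  qed auto
  have int_k: "(\<lambda>t. sdiff b t 0 * w t) absolutely_integrable_on S" if "S \<subseteq> {0..}" "S \<in> sets borel" for S
    using int that unfolding w_def by (auto intro: set_integrable_subset)
  have int_f2: "f2 absolutely_integrable_on S" if "S \<subseteq> {a..}" "S \<in> sets borel" for S
    using abs_int_f2 that by (auto intro: set_integrable_subset)
  have int_f1: "f1 absolutely_integrable_on S" if S: "S \<subseteq> {a..}" "S \<in> sets borel" for S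
  proof -
    have "(\<lambda>t. sdiff b t 0 * w t - f2 t) absolutely_integrable_on S"
      using S a by (intro set_integral_diff int_k int_f2) auto
    then show ?thesis
      by (rule set_integrable_cong[THEN iffD1, rotated -1]) (use S a kf in \<open>force+\<close>)
  qed
  note int_HK = set_lebesgue_integral_eq_integral(1)
  have h_int: "(h has_integral integral {a'..} f1) {a..<1}"
    using has_integral_inversion[of a b s] a a' int_f1[of "{a'..}"]
    unfolding h_def f1_def[abs_def] w_def a'_def by (auto simp: mult.assoc)
  have "integral {a..} f1 = integral {a..a'} f1 + integral {a'..} f1"
  proof -
    have "(f1 has_integral (integral {a..a'} f1 + integral {a'..} f1)) ({a..a'} \<union> {a'..})"
    proof (rule has_integral_Un)
      have "{a..a'} \<inter> {a'..} \<subseteq> {a'}" by auto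
      then show "negligible ({a..a'} \<inter> {a'..})" using negligible_subset by blast
    qed (use int_HK[OF int_f1] a' in auto)
    moreover have "{a..a'} \<union> {a'..} = {a..}" using a' by auto
    ultimately show ?thesis by (simp add: integral_unique)
  qed
  moreover have "integral {a..} f2 = integral {a..1} f2 + 1 / (2 * s)"
  proof -
    have "(f2 has_integral (integral {a..1} f2 + 1 / (2 * s))) ({a..1} \<union> {1..})"
    proof (rule has_integral_Un)
      have "{a..1} \<inter> {1..} \<subseteq> {1}" by auto
      then show "negligible ({a..1} \<inter> {1..})" using negligible_subset by blast
      have "(w has_integral 1 / (2 * s)) {1..}" using int_w[of 1] by simp
      then show "(f2 has_integral 1 / (2 * s)) {1..}"
        by (rule has_integral_eq[rotated]) (auto simp: f2_def pospow_def max_def)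
    qed (use int_HK[OF int_f2] a in auto)
    moreover have "{a..1} \<union> {1..} = {a..}" using a by auto
    ultimately show ?thesis by (simp add: integral_unique)
  qed
  moreover have "integral {a..} (\<lambda>t. sdiff b t 0 * w t) = integral {a..} f1 + integral {a..} f2"
  proof -
    have "integral {a..} (\<lambda>t. sdiff b t 0 * w t) = integral {a..} (\<lambda>t. f1 t + f2 t)"
      using a kf by (intro Henstock_Kurzweil_Integration.integral_cong) auto
    also have "\<dots> = integral {a..} f1 + integral {a..} f2"
      using int_HK[OF int_f1] int_HK[OF int_f2]
      by (intro Henstock_Kurzweil_Integration.integral_add) auto
    finally show ?thesis .
  qed
  moreover have "- (\<gamma> / 8) \<le> integral {a..a'} f1"
  proof -
    have "- (a powr (- 2 * s)) \<le> f1 t" if "t \<in> {a..a'}" for t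
    proof -
      have t: "0 < t" using that a by auto
      have "(1 + t) powr b - 1 \<le> b * t" using powr_le_Bernoulli[of t b] t b s by simp
      also have "b * t \<le> 1 * t" using b s t by (intro mult_right_mono) auto
      finally have "((1 + t) powr b - 1) * w t \<le> t * w t"
        by (intro mult_right_mono) (auto simp: w_def)
      also have "t * w t = t powr (- 2 * s)"
        using t powr_add[of t 1 "- 1 - 2 * s"] by (simp add: w_def)
      also have "\<dots> \<le> a powr (- 2 * s)"
        using that a b s by (intro powr_mono2') auto
      finally show ?thesis by (simp add: f1_def algebra_simps)
    qed
    then have "integral {a..a'} (\<lambda>_. - (a powr (- 2 * s))) \<le> integral {a..a'} f1"
      using int_HK[OF int_f1] by (intro integral_le) auto
    moreover have "(a' - a) * a powr (- 2 * s) \<le> \<gamma> / 8"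
    proof -
      have "(a' - a) * a powr (- 2 * s) \<le> (2 * a\<^sup>2) * a powr (- 2 * s)"
        using a' by (intro mult_right_mono) auto
      also have "\<dots> = 2 * a powr (2 - 2 * s)"
        using a powr_add[of a 2 "- 2 * s"] by simp
      finally show ?thesis using a2 by simp
    qed
    ultimately show ?thesis using a' by (simp add: mult.commute)
  qed
  \<comment> \<open>The integral of \<open>G\<close> is at least \<open>- 1 / (2 * s)\<close>, which
    cancels the contribution of \<open>f2\<close> on \<open>{1..}\<close>. What remains is \<gamma>
    on an interval of length 1/4, and this exceeds the loss on \<open>[a, a']\<close>.\<close>
  moreover have "- 1 / (2 * s) + \<gamma> / 4 \<le> integral {a'..} f1 + integral {a..1} f2"
  proof -
    have Ico: "(f has_integral i) {a..<1} \<longleftrightarrow> (f has_integral i) {a..1}" for f :: "real \<Rightarrow> real" and i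
      by (rule has_integral_spike_set_eq) (rule negligible_subset[of "{1}"]; auto)+
    define I where "I = (1 - (1 - a) powr s)\<^sup>2 * a powr (- 2 * s) / (2 * s) - 1 / (2 * s)"
    have "(G has_integral I) {a..1}"
      unfolding G_def w_def I_def using a b s by (intro has_integral_critical) auto
    then have "(G has_integral I) {a..<1}" by (simp add: Ico)
    moreover have "((\<lambda>x. if x \<in> {1/2..3/4::real} then \<gamma> else 0) has_integral \<gamma> / 4) {a..<1}"
    proof (subst has_integral_restrict)
      show "{1 / 2..3 / 4 :: real} \<subseteq> {a..<1}" using a by auto
      show "((\<lambda>x. \<gamma>) has_integral \<gamma> / 4) {1 / 2..3 / 4 :: real}"
        using has_integral_const_real[of \<gamma> "1/2" "3/4"] by simp
    qed
    ultimately have 1: "((\<lambda>x. G x + (if x \<in> {1/2..3/4::real} then \<gamma> else 0)) has_integral I + \<gamma> / 4) {a..<1}"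
      by (rule has_integral_add)
    have "(f2 has_integral integral {a..1} f2) {a..1}"
      using int_HK[OF int_f2] by auto
    then have "(f2 has_integral integral {a..1} f2) {a..<1}" by (simp add: Ico)
    with h_int have 2: "((\<lambda>x. h x + f2 x) has_integral integral {a'..} f1 + integral {a..1} f2) {a..<1}"
      by (rule has_integral_add)
    have "I + \<gamma> / 4 \<le> integral {a'..} f1 + integral {a..1} f2"
      using 1 2
    proof (rule has_integral_le)
      fix x assume "x \<in> {a..<1}"
      then show "G x + (if x \<in> {1/2..3/4::real} then \<gamma> else 0) \<le> h x + f2 x"
        using gap[of x] \<gamma>(2)[of x] a by auto
    qed
    moreover have "- 1 / (2 * s) \<le> I" using b s by (simp add: I_def)
    ultimately show ?thesis by linarith
  qed
  ultimately have "0 < integral {a..} (\<lambda>t. sdiff b t 0 * w t)"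
    using \<gamma> by linarith
  also have "\<dots> \<le> integral {0..a} (\<lambda>t. sdiff b t 0 * w t) + integral {a..} (\<lambda>t. sdiff b t 0 * w t)"
  proof -
    have "0 \<le> integral {0..a} (\<lambda>t. sdiff b t 0 * w t)"
      using int_HK[OF int_k] sdiff_nonneg[of b] b s a
      by (intro Henstock_Kurzweil_Integration.integral_nonneg) (auto simp: w_def)
    then show ?thesis by simp
  qed
  also have "\<dots> = integral {0..} (\<lambda>t. sdiff b t 0 * w t)"
  proof -
    have "((\<lambda>t. sdiff b t 0 * w t) has_integral (integral {0..a} (\<lambda>t. sdiff b t 0 * w t) +
       integral {a..} (\<lambda>t. sdiff b t 0 * w t))) ({0..a} \<union> {a..})"
    proof (rule has_integral_Un)
      have "{0..a} \<inter> {a..} \<subseteq> {a}" by auto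
      then show "negligible ({0..a} \<inter> {a..})" using negligible_subset by blast
    qed (use int_HK[OF int_k] a in auto)
    moreover have "{0..a} \<union> {a..} = {0..}" using a by auto
    ultimately show ?thesis by (simp add: integral_unique)
  qed
  finally show ?thesis by (simp add: w_def)
qed

section \<open>The kernel in higher dimension\<close>

text \<open>On the ray through \<open>w\<close> the integrand is a function of
  \<open>m w * l\<close>, so the substitution \<open>t = m w * l\<close> splits off an angular
  factor and leaves the same radial integral for every \<open>w\<close>. Since
  \<open>ennreal\<close> cuts off negative values, a signed \<open>G\<close> is treated by using the
  lemma for \<open>G\<close> and for \<open>- G\<close>.\<close>

lemma nn_integral_homogeneous:
  fixes m :: "'a::euclidean_space \<Rightarrow> real" and G :: "real \<Rightarrow> real" and s :: real
  assumes [measurable]: "m \<in> borel_measurable borel" "G \<in> borel_measurable borel"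
    and m: "\<And>l w. 0 < l \<Longrightarrow> m (l *\<^sub>R w) = l * m w" "\<And>w. 0 \<le> m w" and G: "G 0 = 0"
  shows "ennreal (ln 2) * (\<integral>\<^sup>+z. ennreal (G (m z) / norm z powr (real DIM('a) + 2 * s)) \<partial>lborel) =
    (\<integral>\<^sup>+w. ennreal (m w powr (2 * s) / norm w powr (real DIM('a) + 2 * s)) * indicator annulus w \<partial>lborel) *
    (\<integral>\<^sup>+t. ennreal (G t * t powr (- 1 - 2 * s)) * indicator {0<..} t \<partial>lborel)"
proof -
  let ?N = "real DIM('a)"
  define K where "K = (\<integral>\<^sup>+t. ennreal (G t * t powr (- 1 - 2 * s)) * indicator {0<..} t \<partial>lborel)"
  define F where "F z = ennreal (G (m z) / norm z powr (?N + 2 * s))" for z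
  have [measurable]: "F \<in> borel_measurable borel" unfolding F_def by measurable
  have inner: "(\<integral>\<^sup>+l. F (l *\<^sub>R w) * ennreal (l ^ DIM('a)) * ennreal (inverse l) * indicator {0<..} l \<partial>lborel)
     = ennreal (m w powr (2 * s) / norm w powr (?N + 2 * s)) * K" if w: "w \<in> annulus" for w
  proof -
    have nw: "0 < norm w" using w by auto
    have "(\<integral>\<^sup>+l. F (l *\<^sub>R w) * ennreal (l ^ DIM('a)) * ennreal (inverse l) * indicator {0<..} l \<partial>lborel)
      = (\<integral>\<^sup>+l. ennreal (1 / norm w powr (?N + 2 * s)) *
          (ennreal (G (m w * l) * l powr (- 1 - 2 * s)) * indicator {0<..} l) \<partial>lborel)"
    proof (intro nn_integral_cong)
      fix l :: real
      show "F (l *\<^sub>R w) * ennreal (l ^ DIM('a)) * ennreal (inverse l) * indicator {0<..} l =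
        ennreal (1 / norm w powr (?N + 2 * s)) *
          (ennreal (G (m w * l) * l powr (- 1 - 2 * s)) * indicator {0<..} l)"
      proof (cases "0 < l")
        case True
        have "l powr (- 1 - 2 * s) * l powr (?N + 2 * s) = l powr (?N - 1)"
          by (simp add: powr_add[symmetric])
        also have "\<dots> = l ^ DIM('a) * inverse l"
          using True by (simp add: powr_diff powr_realpow divide_inverse)
        finally have e: "l ^ DIM('a) * inverse l = l powr (- 1 - 2 * s) * l powr (?N + 2 * s)" by simp
        have "F (l *\<^sub>R w) * ennreal (l ^ DIM('a)) * ennreal (inverse l) =
          ennreal (G (m (l *\<^sub>R w)) / norm (l *\<^sub>R w) powr (?N + 2 * s) * (l ^ DIM('a) * inverse l))"
          using True unfolding F_def
          by (simp add: ennreal_mult''[symmetric] mult.assoc)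
        also have "G (m (l *\<^sub>R w)) / norm (l *\<^sub>R w) powr (?N + 2 * s) * (l ^ DIM('a) * inverse l) =
          1 / norm w powr (?N + 2 * s) * (G (m w * l) * l powr (- 1 - 2 * s))"
          unfolding e using True nw by (simp add: m powr_mult field_simps)
        finally show ?thesis using True by (simp add: ennreal_mult'[symmetric])
      qed simp
    qed
    also have "\<dots> = ennreal (1 / norm w powr (?N + 2 * s)) *
      (\<integral>\<^sup>+l. ennreal (G (m w * l) * l powr (- 1 - 2 * s)) * indicator {0<..} l \<partial>lborel)"
      by (rule nn_integral_cmult) measurable
    also have "(\<integral>\<^sup>+l. ennreal (G (m w * l) * l powr (- 1 - 2 * s)) * indicator {0<..} l \<partial>lborel)
      = ennreal (m w powr (2 * s)) * K"
    proof (cases "m w = 0")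
      case True
      then show ?thesis by (simp add: G)
    next
      case False
      then have mw: "0 < m w" using m(2)[of w] by simp
      have "K = ennreal (m w ^ DIM(real)) * (\<integral>\<^sup>+l. ennreal (G (m w *\<^sub>R l) * (m w *\<^sub>R l) powr (- 1 - 2 * s)) *
          indicator {0<..} (m w *\<^sub>R l) \<partial>lborel)"
        unfolding K_def by (rule nn_integral_scaleR[OF _ mw]) measurable
      also have "\<dots> = ennreal (m w) * (\<integral>\<^sup>+l. ennreal (m w powr (- 1 - 2 * s)) *
          (ennreal (G (m w * l) * l powr (- 1 - 2 * s)) * indicator {0<..} l) \<partial>lborel)"
      proof -
        have "ennreal (G (m w *\<^sub>R l) * (m w *\<^sub>R l) powr (- 1 - 2 * s)) * indicator {0<..} (m w *\<^sub>R l) =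
          ennreal (m w powr (- 1 - 2 * s)) *
            (ennreal (G (m w * l) * l powr (- 1 - 2 * s)) * indicator {0<..} l)" for l :: real
          using mw by (cases "0 < l")
            (auto simp: zero_less_mult_iff powr_mult ennreal_mult'[symmetric] mult_ac)
        then show ?thesis by simp
      qed
      also have "\<dots> = ennreal (m w * m w powr (- 1 - 2 * s)) *
          (\<integral>\<^sup>+l. ennreal (G (m w * l) * l powr (- 1 - 2 * s)) * indicator {0<..} l \<partial>lborel)"
        using mw by (subst nn_integral_cmult) (auto simp: ennreal_mult' mult.assoc)
      finally have "ennreal (m w powr (2 * s)) * K =
          ennreal (m w powr (2 * s) * (m w * m w powr (- 1 - 2 * s))) *
          (\<integral>\<^sup>+l. ennreal (G (m w * l) * l powr (- 1 - 2 * s)) * indicator {0<..} l \<partial>lborel)"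
        by (simp add: ennreal_mult' mult.assoc)
      also have "m w powr (2 * s) * (m w * m w powr (- 1 - 2 * s)) = 1"
        using mw powr_add[of "m w" 1 "- 1 - 2 * s"] powr_add[of "m w" "2 * s" "- 2 * s"] by simp
      finally show ?thesis by simp
    qed
    finally show ?thesis
      by (simp add: ennreal_mult'[symmetric] mult.assoc[symmetric])
  qed
  have "ennreal (ln 2) * (\<integral>\<^sup>+z. F z \<partial>lborel) =
    (\<integral>\<^sup>+w. (\<integral>\<^sup>+l. F (l *\<^sub>R w) * ennreal (l ^ DIM('a)) * ennreal (inverse l) *
             indicator {0<..} l \<partial>lborel) * indicator annulus w \<partial>lborel)"
    by (rule nn_integral_annulus[symmetric]) measurable
  also have "\<dots> = (\<integral>\<^sup>+w. ennreal (m w powr (2 * s) / norm w powr (?N + 2 * s)) * indicator annulus w * K \<partial>lborel)"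
    using inner by (intro nn_integral_cong) (auto simp: indicator_def)
  also have "\<dots> = (\<integral>\<^sup>+w. ennreal (m w powr (2 * s) / norm w powr (?N + 2 * s)) * indicator annulus w \<partial>lborel) * K"
    by (rule nn_integral_multc) measurable
  finally show ?thesis unfolding F_def K_def .
qed

lemma set_nn_integral_annulus_finite:
  fixes m :: "'a::euclidean_space \<Rightarrow> real" and s :: real
  assumes m: "\<And>w. 0 \<le> m w" "\<And>w. m w \<le> norm w" and s: "0 < s"
  shows "(\<integral>\<^sup>+w. ennreal (m w powr (2 * s) / norm w powr (real DIM('a) + 2 * s)) * indicator annulus w \<partial>lborel) < \<infinity>"
proof -
  have "(\<integral>\<^sup>+w. ennreal (m w powr (2 * s) / norm w powr (real DIM('a) + 2 * s)) * indicator annulus w \<partial>lborel)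
    \<le> (\<integral>\<^sup>+w. indicator (cball (0::'a) 2) w \<partial>lborel)"
  proof (intro nn_integral_mono)
    fix w :: 'a
    have "m w powr (2 * s) / norm w powr (real DIM('a) + 2 * s) \<le> 1" if "1 \<le> norm w"
    proof -
      have "m w powr (2 * s) \<le> norm w powr (2 * s)" using m s by (intro powr_mono2) auto
      also have "\<dots> \<le> norm w powr (real DIM('a) + 2 * s)" using that by (intro powr_mono) auto
      finally have "m w powr (2 * s) \<le> norm w powr (real DIM('a) + 2 * s)" .
      moreover have "w \<noteq> 0" using that by auto
      ultimately show ?thesis by (subst divide_le_eq_1_pos) auto
    qed
    then show "ennreal (m w powr (2 * s) / norm w powr (real DIM('a) + 2 * s)) * indicator annulus w
      \<le> indicator (cball (0::'a) 2) w"
      by (auto simp: indicator_def ennreal_le_1)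
  qed
  also have "\<dots> = emeasure lborel (cball (0::'a) 2)" by simp
  also have "\<dots> < \<infinity>" by (rule emeasure_lborel_cball_finite)
  finally show ?thesis .
qed

text \<open>The integrand is of order \<open>t powr (1 - 2 * s)\<close> at zero and
  \<open>t powr (2 * b - 1 - 2 * s)\<close> at infinity. The first is integrable because
  \<open>s < 1\<close>, the second because \<open>b < s\<close>.\<close>

lemma sdiff_bound_nn_integral_finite:
  fixes b s :: real
  assumes b: "0 < b" "b < s" and s: "s < 1"
  shows "(\<integral>\<^sup>+t. ennreal (sdiff_bound b t * t powr (- 1 - 2 * s)) * indicator {0<..} t \<partial>lborel) < \<infinity>"
proof -
  have "(\<integral>\<^sup>+t. ennreal (sdiff_bound b t * t powr (- 1 - 2 * s)) * indicator {0<..} t \<partial>lborel)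
    \<le> (\<integral>\<^sup>+t. ennreal (22 * t powr (1 - 2 * s)) * indicator {0..1/2} t +
          ennreal (22 * t powr (2 * b - 1 - 2 * s)) * indicator {1/2..} t \<partial>lborel)"
  proof (intro nn_integral_mono)
    fix t :: real
    have "t\<^sup>2 * t powr (- 1 - 2 * s) = t powr (1 - 2 * s)" if "0 < t"
      using that powr_add[of t 2 "- 1 - 2 * s"] by simp
    moreover have "t powr (2 * b) * t powr (- 1 - 2 * s) = t powr (2 * b - 1 - 2 * s)"
      unfolding powr_add[symmetric] by (rule arg_cong[where f = "\<lambda>z. t powr z"]) simp
    ultimately show "ennreal (sdiff_bound b t * t powr (- 1 - 2 * s)) * indicator {0<..} t \<le>
      ennreal (22 * t powr (1 - 2 * s)) * indicator {0..1/2} t +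
          ennreal (22 * t powr (2 * b - 1 - 2 * s)) * indicator {1/2..} t"
      by (auto simp: indicator_def sdiff_bound_def mult.assoc)
  qed
  also have "\<dots> = (\<integral>\<^sup>+t. ennreal (22 * t powr (1 - 2 * s)) * indicator {0..1/2} t \<partial>lborel) +
     (\<integral>\<^sup>+t. ennreal (22 * t powr (2 * b - 1 - 2 * s)) * indicator {1/2..} t \<partial>lborel)"
    by (rule nn_integral_add) auto
  also have "\<dots> < \<infinity>"
  proof -
    have "((\<lambda>t. 22 * t powr (1 - 2 * s)) has_integral 22 * ((1/2) powr (1 - 2 * s + 1) / (1 - 2 * s + 1))) {0..1/2}"
      using s by (intro has_integral_mult_right has_integral_powr_from_0) auto
    moreover have "((\<lambda>t. 22 * t powr (2 * b - 1 - 2 * s)) has_integral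
        22 * (- ((1/2) powr (2 * b - 1 - 2 * s + 1)) / (2 * b - 1 - 2 * s + 1))) {1/2..}"
      using b by (intro has_integral_mult_right has_integral_powr_to_inf) auto
    ultimately show ?thesis
      by (simp add: nn_integral_has_integral_lebesgue')
  qed
  finally show ?thesis .
qed

lemma integrable_sdiff_bound_kernel:
  fixes b s :: real
  assumes b: "0 < b" "b < s" and s: "s < 1"
  shows "integrable lborel (\<lambda>z::'a::euclidean_space. sdiff_bound b (norm z) / norm z powr (real DIM('a) + 2 * s))"
proof (rule integrableI_nonneg)
  let ?I = "\<integral>\<^sup>+z. ennreal (sdiff_bound b (norm (z::'a)) / norm z powr (real DIM('a) + 2 * s)) \<partial>lborel"
  have "ennreal (ln 2) * ?I < \<infinity>"
    using sdiff_bound_nn_integral_finite[OF b s] b s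
      set_nn_integral_annulus_finite[of "norm :: 'a \<Rightarrow> real" s]
    by (subst nn_integral_homogeneous) (auto simp: sdiff_bound_def ennreal_mult_less_top)
  then show "?I < \<infinity>" by (auto simp: ennreal_mult_less_top)
qed (auto simp: sdiff_bound_nonneg)

section \<open>The rescaled fractional Laplacian of the barrier\<close>

text \<open>Up to the factor \<open>frac_const / 2\<close>, this is the fractional Laplacian at the
  origin of the \<open>b\<close>-th power of the positive part of
  \<open>1 + w \<bullet> e + \<eta> * (norm w)\<^sup>2\<close>. The half space corresponds to
  \<open>\<eta> = 0\<close>.\<close>

definition profile :: "real \<Rightarrow> real \<Rightarrow> 'a::euclidean_space \<Rightarrow> real \<Rightarrow> real" where
  "profile b s e \<eta> =
     (\<integral>w. sdiff b (w \<bullet> e) (\<eta> * (norm w)\<^sup>2) / norm w powr (real DIM('a) + 2 * s) \<partial>lborel)"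

lemma profile_bound:
  fixes w e :: "'a::euclidean_space"
  assumes "0 < b" "b \<le> 1" "norm e = 1" "0 \<le> \<eta>" "\<eta> \<le> 1/4"
  shows "\<bar>sdiff b (w \<bullet> e) (\<eta> * (norm w)\<^sup>2) / norm w powr k\<bar> \<le> sdiff_bound b (norm w) / norm w powr k"
proof -
  have "\<bar>sdiff b (w \<bullet> e) (\<eta> * (norm w)\<^sup>2)\<bar> \<le> sdiff_bound b (norm w)"
    using assms Cauchy_Schwarz_ineq2[of w e] mult_right_mono[of \<eta> "1/4" "(norm w)\<^sup>2"]
    by (intro abs_sdiff_le) auto
  then show ?thesis by (simp add: divide_right_mono)
qed

lemma integrable_profile:
  fixes e :: "'a::euclidean_space" and b s :: real
  assumes b: "0 < b" "b < s" and s: "s < 1" and e: "norm e = 1" "0 \<le> \<eta>" "\<eta> \<le> 1/4"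
  shows "integrable lborel (\<lambda>w. sdiff b (w \<bullet> e) (\<eta> * (norm w)\<^sup>2) / norm w powr (real DIM('a) + 2 * s))"
  using integrable_sdiff_bound_kernel[OF b s, where ?'a = 'a]
proof (rule Bochner_Integration.integrable_bound)
  show "AE w in lborel. norm (sdiff b (w \<bullet> e) (\<eta> * (norm w)\<^sup>2) / norm w powr (real DIM('a) + 2 * s)) \<le>
    norm (sdiff_bound b (norm w) / norm w powr (real DIM('a) + 2 * s))"
    using profile_bound[of b e \<eta> _ "real DIM('a) + 2 * s"] b s e
    by (intro always_eventually allI) (simp add: sdiff_bound_nonneg)
qed measurable

text \<open>Without curvature the second difference depends on \<open>w\<close> only through
  \<open>\<bar>w \<bullet> e\<bar>\<close>, which is homogeneous of degree one. Positive and
  negative parts thus factorize with the same finite positive angular factor \<open>Z\<close>, and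
  their difference is \<open>Z\<close> times the one-dimensional integral.\<close>

lemma profile_zero_pos:
  fixes e :: "'a::euclidean_space" and b s :: real
  assumes b: "0 < b" "b < s" and s: "s < 1" and e: "norm e = 1"
  shows "0 < profile b s e 0"
proof -
  let ?k = "\<lambda>t. sdiff b t 0 * t powr (- 1 - 2 * s)"
  let ?f = "\<lambda>w::'a. sdiff b \<bar>w \<bullet> e\<bar> 0 / norm w powr (real DIM('a) + 2 * s)"
  define Z where "Z = (\<integral>\<^sup>+w. ennreal (\<bar>w \<bullet> e\<bar> powr (2 * s) / norm w powr (real DIM('a) + 2 * s)) * indicator annulus w \<partial>lborel)"
  define Kp where "Kp = (\<integral>\<^sup>+t. ennreal (?k t) * indicator {0<..} t \<partial>lborel)"
  define Km where "Km = (\<integral>\<^sup>+t. ennreal (- ?k t) * indicator {0<..} t \<partial>lborel)"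
  have kb: "\<bar>?k t\<bar> \<le> sdiff_bound b t * t powr (- 1 - 2 * s)" if "0 < t" for t
    using abs_sdiff_le[of b t t 0] b s that by (simp add: abs_mult mult_right_mono)
  have K_abs: "(\<integral>\<^sup>+t. ennreal \<bar>?k t\<bar> * indicator {0<..} t \<partial>lborel) < \<infinity>"
  proof -
    have "(\<integral>\<^sup>+t. ennreal \<bar>?k t\<bar> * indicator {0<..} t \<partial>lborel) \<le>
       (\<integral>\<^sup>+t. ennreal (sdiff_bound b t * t powr (- 1 - 2 * s)) * indicator {0<..} t \<partial>lborel)"
      using kb by (intro nn_integral_mono) (auto simp: indicator_def ennreal_leI)
    then show ?thesis using sdiff_bound_nn_integral_finite[OF b s] by (rule le_less_trans)
  qed
  have int1: "integrable lborel (\<lambda>t. indicator {0<..} t *\<^sub>R ?k t)"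
  proof (rule integrableI_bounded)
    show "(\<integral>\<^sup>+t. ennreal (norm (indicator {0<..} t *\<^sub>R ?k t)) \<partial>lborel) < \<infinity>"
      by (rule le_less_trans[OF _ K_abs], intro nn_integral_mono) (auto simp: indicator_def)
  qed measurable
  have K_pos: "0 < (\<integral>t. indicator {0<..} t *\<^sub>R ?k t \<partial>lborel)"
  proof -
    have eq: "indicator {0<..} t *\<^sub>R ?k t = indicator {0..} t *\<^sub>R ?k t" for t
      by (cases "t = 0") (auto simp: indicator_def)
    have ai: "?k absolutely_integrable_on {0..}"
      using int1 unfolding eq set_integrable_def by (subst integrable_completion) auto
    have "(\<integral>t. indicator {0<..} t *\<^sub>R ?k t \<partial>lborel) = (LINT t:{0..}|lebesgue. ?k t)"
      unfolding eq set_lebesgue_integral_def by (subst integral_completion) auto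
    also have "\<dots> = integral {0..} ?k"
      by (rule set_lebesgue_integral_eq_integral(2)[OF ai])
    finally show ?thesis using integral_sdiff_pos[OF b s ai] by simp
  qed
  have K_eq: "(\<integral>t. indicator {0<..} t *\<^sub>R ?k t \<partial>lborel) = enn2real Kp - enn2real Km"
  proof -
    have 1: "ennreal (indicator {0<..} t *\<^sub>R ?k t) = ennreal (?k t) * indicator {0<..} t"
      "ennreal (- (indicator {0<..} t *\<^sub>R ?k t)) = ennreal (- ?k t) * indicator {0<..} t" for t
      by (auto simp: indicator_def)
    show ?thesis
      unfolding real_lebesgue_integral_def[OF int1] Kp_def Km_def 1 ..
  qed
  have fin: "Z < \<infinity>"
    unfolding Z_def using b s e Cauchy_Schwarz_ineq2[of _ e]
    by (intro set_nn_integral_annulus_finite) auto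
  have Z_pos: "0 < Z"
  proof -
    \<comment> \<open>A ball inside the annulus on which \<open>w \<bullet> e \<ge> 1\<close>, so
      that the integrand of \<open>Z\<close> is at least \<open>c\<close> there.\<close>
    define B where "B = ball ((3/2) *\<^sub>R e) (1/2)"
    define c where "c = 1 / 2 powr (real DIM('a) + 2 * s)"
    have c: "0 < c" by (simp add: c_def)
    have B: "w \<in> annulus" "1 \<le> w \<bullet> e" if "w \<in> B" for w
    proof -
      have d: "norm ((3/2) *\<^sub>R e - w) < 1/2" using that by (simp add: B_def dist_norm)
      then have "norm ((3/2) *\<^sub>R e) - norm w < 1/2" "norm w - norm ((3/2) *\<^sub>R e) < 1/2"
        by norm+
      then show "w \<in> annulus" using e by simp
      have "((3/2) *\<^sub>R e - w) \<bullet> e \<le> norm ((3/2) *\<^sub>R e - w)"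
        using norm_cauchy_schwarz[of "(3/2) *\<^sub>R e - w" e] e by simp
      moreover have "((3/2) *\<^sub>R e - w) \<bullet> e = 3/2 - w \<bullet> e"
        using e by (simp add: inner_diff_left dot_square_norm)
      ultimately show "1 \<le> w \<bullet> e" using d by linarith
    qed
    have "(0::ennreal) < ennreal c * emeasure lborel B"
    proof -
      have "0 < emeasure lborel B"
        unfolding B_def by (simp add: emeasure_ball unit_ball_vol_pos)
      then show ?thesis using c by (simp add: ennreal_zero_less_mult_iff)
    qed
    also have "\<dots> = (\<integral>\<^sup>+w. ennreal c * indicator B w \<partial>lborel)"
      by (rule nn_integral_cmult_indicator[symmetric]) (simp add: B_def)
    also have "\<dots> \<le> Z" unfolding Z_def
    proof (intro nn_integral_mono)
      fix w
      have "c \<le> \<bar>w \<bullet> e\<bar> powr (2 * s) / norm w powr (real DIM('a) + 2 * s)" if "w \<in> B"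
        unfolding c_def using B[OF that] b s
        by (intro frac_le ge_one_powr_ge_zero powr_mono2) auto
      then show "ennreal c * indicator B w \<le>
        ennreal (\<bar>w \<bullet> e\<bar> powr (2 * s) / norm w powr (real DIM('a) + 2 * s)) * indicator annulus w"
        using B(1)[of w] by (auto simp: indicator_def ennreal_leI)
    qed
    finally show ?thesis .
  qed
  have pos: "ennreal (ln 2) * (\<integral>\<^sup>+w. ennreal (?f w) \<partial>lborel) = Z * Kp"
    unfolding Z_def Kp_def by (rule nn_integral_homogeneous) (auto simp: abs_mult)
  have neg: "ennreal (ln 2) * (\<integral>\<^sup>+w. ennreal (- ?f w) \<partial>lborel) = Z * Km"
    unfolding Z_def Km_def
    using nn_integral_homogeneous[of "\<lambda>w. \<bar>w \<bullet> e\<bar>" "\<lambda>t. - sdiff b t 0" s]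
    by (simp add: abs_mult)
  have intf: "integrable lborel ?f"
    using integrable_profile[OF b s e, of 0] by (simp add: sdiff_abs)
  have "ln 2 * profile b s e 0 = ln 2 * (\<integral>w. ?f w \<partial>lborel)"
    unfolding profile_def by (simp add: sdiff_abs)
  also have "\<dots> = enn2real (ennreal (ln 2) * (\<integral>\<^sup>+w. ennreal (?f w) \<partial>lborel)) -
      enn2real (ennreal (ln 2) * (\<integral>\<^sup>+w. ennreal (- ?f w) \<partial>lborel))"
    unfolding real_lebesgue_integral_def[OF intf]
    by (simp add: enn2real_mult right_diff_distrib)
  also have "\<dots> = enn2real Z * (\<integral>t. indicator {0<..} t *\<^sub>R ?k t \<partial>lborel)"
    unfolding pos neg K_eq by (simp add: enn2real_mult right_diff_distrib)
  also have "\<dots> > 0"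
    using K_pos Z_pos fin by (intro mult_pos_pos) (auto simp: enn2real_positive_iff)
  finally show ?thesis by (simp add: zero_less_mult_iff)
qed

text \<open>For curvatures that are not small the sign of the profile is not controlled. A bound
  uniform in direction and curvature is enough, because the time derivative of the barrier takes
  over there.\<close>

lemma profile_ge:
  fixes e :: "'a::euclidean_space" and b s :: real
  assumes b: "0 < b" "b < s" and s: "s < 1" and e: "norm e = 1" "0 \<le> \<eta>" "\<eta> \<le> 1/4"
  shows "- (\<integral>z. sdiff_bound b (norm (z::'a)) / norm z powr (real DIM('a) + 2 * s) \<partial>lborel) \<le> profile b s e \<eta>"
proof -
  have "(\<integral>z. - (sdiff_bound b (norm (z::'a)) / norm z powr (real DIM('a) + 2 * s)) \<partial>lborel) \<le> profile b s e \<eta>"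
    unfolding profile_def
  proof (rule integral_mono[OF _ integrable_profile[OF assms]])
    show "integrable lborel (\<lambda>z::'a. - (sdiff_bound b (norm z) / norm z powr (real DIM('a) + 2 * s)))"
      using integrable_sdiff_bound_kernel[OF b s] by simp
    show "- (sdiff_bound b (norm z) / norm z powr (real DIM('a) + 2 * s)) \<le>
        sdiff b (z \<bullet> e) (\<eta> * (norm z)\<^sup>2) / norm z powr (real DIM('a) + 2 * s)" for z :: 'a
    proof -
      have "\<bar>sdiff b (z \<bullet> e) (\<eta> * (norm z)\<^sup>2) / norm z powr (real DIM('a) + 2 * s)\<bar> \<le>
          sdiff_bound b (norm z) / norm z powr (real DIM('a) + 2 * s)"
        using b s e by (intro profile_bound) auto
      then show ?thesis by linarith
    qed
  qed
  then show ?thesis by simp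
qed

text \<open>Counterexamples with curvature tending to zero would have directions converging along a
  subsequence on the unit sphere; dominated convergence then gives a nonpositive profile at zero
  curvature. Uniformity in the direction makes \<kappa> and \<eta>0 independent of the touching
  point and of the exterior ball.\<close>

lemma profile_uniform_pos:
  fixes b s :: real
  assumes b: "0 < b" "b < s" and s: "s < 1"
  obtains \<kappa> \<eta>0 where "0 < \<kappa>" "0 < \<eta>0"
    "\<And>(e::'a::euclidean_space) \<eta>. norm e = 1 \<Longrightarrow> 0 \<le> \<eta> \<Longrightarrow> \<eta> \<le> \<eta>0 \<Longrightarrow> \<eta> \<le> 1/4 \<Longrightarrow> \<kappa> \<le> profile b s e \<eta>"
proof (rule ccontr)
  assume contra: "\<not> thesis"
  have "\<exists>(e::'a) \<eta>. norm e = 1 \<and> 0 \<le> \<eta> \<and> \<eta> \<le> 1 / Suc n \<and> \<eta> \<le> 1/4 \<and> profile b s e \<eta> < 1 / Suc n" for n :: nat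
    using contra that[of "1 / Suc n" "1 / Suc n"] by (force simp: not_le)
  then obtain e :: "nat \<Rightarrow> 'a" and \<eta> where e: "\<And>n. norm (e n) = 1"
    and \<eta>: "\<And>n. 0 \<le> \<eta> n" "\<And>n. \<eta> n \<le> 1 / Suc n" "\<And>n. \<eta> n \<le> 1/4"
    and p: "\<And>n. profile b s (e n) (\<eta> n) < 1 / Suc n"
    by metis
  obtain l r where l: "l \<in> sphere (0::'a) 1" and r: "strict_mono r" "(e \<circ> r) \<longlonglongrightarrow> l"
    using compact_sphere[of "0::'a" 1] e unfolding compact_def by (metis mem_sphere_0)
  have Suc0: "(\<lambda>n. 1 / real (Suc n)) \<longlonglongrightarrow> 0"
    using LIMSEQ_inverse_real_of_nat by (simp add: inverse_eq_divide)
  have "\<eta> \<longlonglongrightarrow> 0"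
    by (rule tendsto_sandwich[OF _ _ tendsto_const Suc0]) (use \<eta> in auto)
  then have \<eta>r: "(\<eta> \<circ> r) \<longlonglongrightarrow> 0" using r(1) by (rule LIMSEQ_subseq_LIMSEQ)
  have "(\<lambda>n. profile b s ((e \<circ> r) n) ((\<eta> \<circ> r) n)) \<longlonglongrightarrow> profile b s l 0"
    unfolding profile_def
  proof (rule integral_dominated_convergence[OF _ _ integrable_sdiff_bound_kernel[OF b s]])
    show "AE w in lborel. (\<lambda>n. sdiff b (w \<bullet> (e \<circ> r) n) ((\<eta> \<circ> r) n * (norm w)\<^sup>2) / norm w powr (real DIM('a) + 2 * s))
       \<longlonglongrightarrow> sdiff b (w \<bullet> l) (0 * (norm w)\<^sup>2) / norm w powr (real DIM('a) + 2 * s)"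
    proof (intro always_eventually allI)
      fix w :: 'a
      have 1: "(\<lambda>n. sdiff b (w \<bullet> (e \<circ> r) n) ((\<eta> \<circ> r) n * (norm w)\<^sup>2)) \<longlonglongrightarrow> sdiff b (w \<bullet> l) (0 * (norm w)\<^sup>2)"
        unfolding sdiff_def using b r(2) \<eta>r by (intro tendsto_intros)
      show "(\<lambda>n. sdiff b (w \<bullet> (e \<circ> r) n) ((\<eta> \<circ> r) n * (norm w)\<^sup>2) / norm w powr (real DIM('a) + 2 * s))
       \<longlonglongrightarrow> sdiff b (w \<bullet> l) (0 * (norm w)\<^sup>2) / norm w powr (real DIM('a) + 2 * s)"
      proof (cases "w = 0")
        case False
        then show ?thesis using 1 by (intro tendsto_divide tendsto_const) auto
      qed simp
    qed
    show "AE w in lborel. norm (sdiff b (w \<bullet> (e \<circ> r) n) ((\<eta> \<circ> r) n * (norm w)\<^sup>2) /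
        norm w powr (real DIM('a) + 2 * s)) \<le> sdiff_bound b (norm w) / norm w powr (real DIM('a) + 2 * s)" for n
      using profile_bound[of b "(e \<circ> r) n" "(\<eta> \<circ> r) n" _ "real DIM('a) + 2 * s"] b s e \<eta> by simp
  qed measurable
  moreover have "(\<lambda>n. 1 / real (Suc (r n))) \<longlonglongrightarrow> 0"
    using LIMSEQ_subseq_LIMSEQ[OF Suc0 r(1)] by (simp add: o_def)
  ultimately have "profile b s l 0 \<le> 0"
    by (rule LIMSEQ_le) (use p in \<open>auto intro: less_imp_le\<close>)
  moreover have "0 < profile b s l 0"
    using profile_zero_pos[OF b s] l by simp
  ultimately show False by simp
qed

section \<open>Evaluating the nonlocal operator\<close>

lemma
  fixes f :: "'a::euclidean_space \<Rightarrow> real"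
  assumes [measurable]: "f \<in> borel_measurable borel" and c: "c \<noteq> 0"
  shows integrable_affine: "integrable lborel (\<lambda>x. f (t + c *\<^sub>R x)) \<longleftrightarrow> integrable lborel f"
    and integral_affine: "(\<integral>x. f x \<partial>lborel) = \<bar>c\<bar> ^ DIM('a) * (\<integral>x. f (t + c *\<^sub>R x) \<partial>lborel)"
proof -
  have eq: "lborel = density (distr lborel borel (\<lambda>x. t + c *\<^sub>R x)) (\<lambda>_. ennreal (\<bar>c\<bar> ^ DIM('a)))"
    using lborel_affine[OF c, of t] by simp
  have "integrable lborel f \<longleftrightarrow> integrable (distr lborel borel (\<lambda>x. t + c *\<^sub>R x)) (\<lambda>x. \<bar>c\<bar> ^ DIM('a) *\<^sub>R f x)"
    by (subst eq, subst integrable_density) auto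
  also have "\<dots> \<longleftrightarrow> integrable lborel (\<lambda>x. f (t + c *\<^sub>R x))"
    using c by (subst integrable_distr_eq) auto
  finally show "integrable lborel (\<lambda>x. f (t + c *\<^sub>R x)) \<longleftrightarrow> integrable lborel f" by simp
  show "(\<integral>x. f x \<partial>lborel) = \<bar>c\<bar> ^ DIM('a) * (\<integral>x. f (t + c *\<^sub>R x) \<partial>lborel)"
    by (subst eq, subst integral_density, simp_all, subst integral_distr) auto
qed

text \<open>The kernel of \<open>sdiff_bound\<close> already dominates growth of order
  \<open>2 * b\<close> where \<open>norm z > 1/2\<close>. On the remaining shell
  \<open>\<delta> \<le> norm z \<le> 1/2\<close> the quadratic branch does so after division by
  \<open>\<delta>\<^sup>2\<close>, which is the origin of the factor
  \<open>1 + 1 / \<delta>\<^sup>2\<close>.\<close>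

lemma integrable_kernel_outside:
  fixes f :: "'a::euclidean_space \<Rightarrow> real" and b s C \<delta> :: real
  assumes b: "0 < b" "b < s" and s: "s < 1" and \<delta>: "0 < \<delta>"
    and f [measurable]: "f \<in> borel_measurable borel"
    and C: "\<And>z. \<delta> \<le> norm z \<Longrightarrow> \<bar>f z\<bar> \<le> C * norm z powr (2 * b)"
  shows "integrable lborel (\<lambda>z. indicator (- ball 0 \<delta>) z * (f z / norm z powr (real DIM('a) + 2 * s)))"
proof (rule Bochner_Integration.integrable_bound)
  let ?k = "real DIM('a) + 2 * s"
  define A where "A = \<bar>C\<bar> * (1 + 1 / \<delta>\<^sup>2)"
  show "integrable lborel (\<lambda>z::'a. A * (sdiff_bound b (norm z) / norm z powr ?k))"
    by (intro integrable_mult_right integrable_sdiff_bound_kernel[OF b s])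
  show "AE z in lborel. norm (indicator (- ball 0 \<delta>) z * (f z / norm z powr ?k)) \<le>
      norm (A * (sdiff_bound b (norm z) / norm z powr ?k))"
  proof (intro always_eventually allI)
    fix z :: 'a
    show "norm (indicator (- ball 0 \<delta>) z * (f z / norm z powr ?k)) \<le>
      norm (A * (sdiff_bound b (norm z) / norm z powr ?k))"
    proof (cases "\<delta> \<le> norm z")
      case True
      have "norm z powr (2 * b) \<le> (1 + 1 / \<delta>\<^sup>2) * sdiff_bound b (norm z)"
      proof (cases "norm z \<le> 1/2")
        case small: True
        have "norm z powr (2 * b) \<le> 1" using small b by (intro powr_le1) auto
        also have "1 \<le> (norm z)\<^sup>2 / \<delta>\<^sup>2" using True \<delta> by (simp add: power_mono)
        also have "\<dots> \<le> (1 + 1 / \<delta>\<^sup>2) * sdiff_bound b (norm z)"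
        proof -
          have "(norm z)\<^sup>2 * (1 / \<delta>\<^sup>2) \<le> sdiff_bound b (norm z) * (1 + 1 / \<delta>\<^sup>2)"
            using small by (intro mult_mono) (auto simp: sdiff_bound_def)
          then show ?thesis by (simp add: mult.commute)
        qed
        finally show ?thesis .
      next
        case False
        have "1 * norm z powr (2 * b) \<le> (1 + 1 / \<delta>\<^sup>2) * sdiff_bound b (norm z)"
          using False by (intro mult_mono) (auto simp: sdiff_bound_def)
        then show ?thesis by simp
      qed
      then have "\<bar>C\<bar> * norm z powr (2 * b) \<le> A * sdiff_bound b (norm z)"
        unfolding A_def mult.assoc by (intro mult_left_mono) auto
      moreover have "\<bar>f z\<bar> \<le> \<bar>C\<bar> * norm z powr (2 * b)"
        using C[OF True] by (smt (verit) mult_right_mono powr_ge_zero)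
      ultimately have "\<bar>f z\<bar> / norm z powr ?k \<le> A * sdiff_bound b (norm z) / norm z powr ?k"
        by (intro divide_right_mono) auto
      then show ?thesis
        by (simp add: abs_mult indicator_def A_def sdiff_bound_nonneg)
    qed simp
  qed
qed measurable

lemma frac_const_pos: "0 < s \<Longrightarrow> s < 1 \<Longrightarrow> 0 < frac_const TYPE('n::finite) s"
  unfolding frac_const_def by (intro divide_pos_pos mult_pos_pos Gamma_real_pos) auto

lemma tendsto_at_right_0_dominated_convergence:
  fixes s :: "real \<Rightarrow> 'a \<Rightarrow> real"
  assumes meas: "\<And>r. s r \<in> borel_measurable M" "f \<in> borel_measurable M"
    and w: "integrable M w"
    and lim: "\<And>x. x \<in> space M \<Longrightarrow> ((\<lambda>r. s r x) \<longlongrightarrow> f x) (at_right 0)"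
    and bound: "\<And>r x. 0 < r \<Longrightarrow> \<bar>s r x\<bar> \<le> w x"
  shows "((\<lambda>r. \<integral>x. s r x \<partial>M) \<longlongrightarrow> (\<integral>x. f x \<partial>M)) (at_right 0)"
  unfolding filterlim_at_right_to_top
proof (rule integral_dominated_convergence_at_top[OF meas(2) _ w])
  show "AE x in M. ((\<lambda>i. s (inverse i) x) \<longlongrightarrow> f x) at_top"
    using lim unfolding filterlim_at_right_to_top by (intro AE_I2)
  show "\<forall>\<^sub>F i in at_top. AE x in M. norm (s (inverse i) x) \<le> w x"
    using eventually_gt_at_top[of "0::real"] by eventually_elim (auto intro!: bound)
qed (use meas in auto)

text \<open>The second difference form, which removes the principal value.\<close>

definition kernel_sdiff :: "real \<Rightarrow> (real^'n \<Rightarrow> real) \<Rightarrow> real^'n \<Rightarrow> real^'n \<Rightarrow> real" where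
  "kernel_sdiff s g x z = (2 * g x - g (x + z) - g (x - z)) / norm z powr (real CARD('n) + 2 * s)"

lemma borel_measurable_kernel_sdiff [measurable (raw)]:
  assumes [measurable]: "g \<in> borel_measurable borel" "f \<in> borel_measurable M"
  shows "(\<lambda>z. kernel_sdiff s g x (f z)) \<in> borel_measurable M"
  unfolding kernel_sdiff_def[abs_def] by measurable

lemma sets_borel_ball [measurable]: "ball (x :: 'a::metric_space) r \<in> sets borel"
  by simp

text \<open>Here \<open>B\<close> is \<open>A\<close> translated by \<open>x\<close>. Reflection
  \<open>z \<mapsto> - z\<close> preserves \<open>A\<close>, so the first difference may be averaged
  with its mirror image. The integrability assumption on the single difference is why this is used
  only at positive distance from \<open>x\<close>.\<close>

lemma set_integral_symmetrize:
  fixes g :: "real^'n \<Rightarrow> real" and A :: "(real^'n) set"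
  assumes [measurable]: "g \<in> borel_measurable borel" "A \<in> sets borel"
    and sym: "\<And>z. - z \<in> A \<longleftrightarrow> z \<in> A"
    and B: "\<And>y. y \<in> B \<longleftrightarrow> y - x \<in> A"
    and int: "integrable lborel (\<lambda>z. indicator A z * ((g x - g (x + z)) / norm z powr (real CARD('n) + 2 * s)))"
  shows "set_lebesgue_integral lebesgue B (\<lambda>y. (g x - g y) / norm (x - y) powr (real CARD('n) + 2 * s))
    = 1/2 * (\<integral>z. indicator A z * kernel_sdiff s g x z \<partial>lborel)"
proof -
  let ?k = "real CARD('n) + 2 * s"
  define q where "q z = indicator A z * ((g x - g (x + z)) / norm z powr ?k)" for z
  have [measurable]: "q \<in> borel_measurable borel" unfolding q_def by measurable
  have B': "B = {y. y - x \<in> A}" using B by auto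
  have [measurable]: "B \<in> sets borel" unfolding B' by measurable
  have q_eq: "(\<integral>z. q (- z) \<partial>lborel) = (\<integral>z. q z \<partial>lborel)" and q_int: "integrable lborel (\<lambda>z. q (- z))"
    using integral_affine[of q "-1" 0] integrable_affine[of q "-1" 0] int by (simp_all add: q_def[abs_def])
  have "set_lebesgue_integral lebesgue B (\<lambda>y. (g x - g y) / norm (x - y) powr ?k)
     = (\<integral>y. indicator B y * ((g x - g y) / norm (x - y) powr ?k) \<partial>lborel)"
    unfolding set_lebesgue_integral_def by (subst integral_completion) auto
  also have "\<dots> = (\<integral>z. q z \<partial>lborel)"
    by (subst integral_affine[of _ 1 x]) (auto simp: q_def[abs_def] indicator_def B intro!: Bochner_Integration.integral_cong)
  also have "\<dots> = 1/2 * ((\<integral>z. q z \<partial>lborel) + (\<integral>z. q (- z) \<partial>lborel))"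
    by (simp add: q_eq)
  also have "(\<integral>z. q z \<partial>lborel) + (\<integral>z. q (- z) \<partial>lborel) = (\<integral>z. q z + q (- z) \<partial>lborel)"
    using int q_int by (intro Bochner_Integration.integral_add[symmetric]) (auto simp: q_def[abs_def])
  also have "\<dots> = (\<integral>z. indicator A z * kernel_sdiff s g x z \<partial>lborel)"
    by (intro Bochner_Integration.integral_cong)
      (auto simp: q_def kernel_sdiff_def sym indicator_def add_divide_distrib[symmetric] algebra_simps)
  finally show ?thesis .
qed

text \<open>Each truncated integral over \<open>ball x \<delta> - ball x \<epsilon>\<close>
  converges because \<open>g\<close> is bounded, so it can be symmetrized. The second difference is
  integrable up to the singularity, and dominated convergence as \<epsilon> tends to zero gives the
  principal value.\<close>

lemma frac_op_ball:
  fixes g :: "real^'n \<Rightarrow> real"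
  assumes g [measurable]: "g \<in> borel_measurable borel" and \<delta>: "0 < \<delta>" and s: "0 < s"
    and bdd: "\<And>y. y \<in> ball x \<delta> \<Longrightarrow> \<bar>g y\<bar> \<le> C"
    and int: "integrable lborel (\<lambda>z. indicator (ball 0 \<delta>) z * kernel_sdiff s g x z)"
  shows "frac_op s (ball x \<delta>) g x =
    frac_const TYPE('n) s * (1/2 * (\<integral>z. indicator (ball 0 \<delta>) z * kernel_sdiff s g x z \<partial>lborel))"
proof -
  let ?k = "real CARD('n) + 2 * s"
  have C: "0 \<le> C" using bdd[of x] \<delta> by (meson abs_ge_zero centre_in_ball order_trans)
  have "((\<lambda>\<epsilon>. 1/2 * (\<integral>z. indicator (ball 0 \<delta> - ball 0 \<epsilon>) z * kernel_sdiff s g x z \<partial>lborel))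
     \<longlongrightarrow> 1/2 * (\<integral>z. indicator (ball 0 \<delta>) z * kernel_sdiff s g x z \<partial>lborel)) (at_right 0)"
  proof (rule tendsto_mult[OF tendsto_const], rule tendsto_at_right_0_dominated_convergence
      [where w = "\<lambda>z. \<bar>indicator (ball 0 \<delta>) z * kernel_sdiff s g x z\<bar>"])
    show "(\<lambda>z. indicator (ball 0 \<delta> - ball 0 r) z * kernel_sdiff s g x z) \<in> borel_measurable lborel" for r
      by measurable
    show "(\<lambda>z. indicator (ball 0 \<delta>) z * kernel_sdiff s g x z) \<in> borel_measurable lborel"
      by measurable
    show "integrable lborel (\<lambda>z. \<bar>indicator (ball 0 \<delta>) z * kernel_sdiff s g x z\<bar>)"
      using int by (rule integrable_abs)
    show "\<bar>indicator (ball 0 \<delta> - ball 0 r) z * kernel_sdiff s g x z\<bar> \<le> \<bar>indicator (ball 0 \<delta>) z * kernel_sdiff s g x z\<bar>" for r z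
      by (auto simp: indicator_def)
    fix z :: "real^'n"
    show "((\<lambda>r. indicator (ball 0 \<delta> - ball 0 r) z * kernel_sdiff s g x z) \<longlongrightarrow>
        indicator (ball 0 \<delta>) z * kernel_sdiff s g x z) (at_right 0)"
    proof (cases "z = 0")
      case False
      then have "\<forall>\<^sub>F r in at_right 0. r \<in> {0<..<norm z}" by (intro eventually_at_right_real) simp
      then have "\<forall>\<^sub>F r in at_right 0. indicator (ball 0 \<delta> - ball 0 r) z * kernel_sdiff s g x z =
        indicator (ball 0 \<delta>) z * kernel_sdiff s g x z"
        by eventually_elim (auto simp: indicator_def)
      then show ?thesis by (rule tendsto_eventually)
    qed (simp add: kernel_sdiff_def)
  qed
  moreover have "\<forall>\<^sub>F \<epsilon> in at_right 0. 1/2 * (\<integral>z. indicator (ball 0 \<delta> - ball 0 \<epsilon>) z * kernel_sdiff s g x z \<partial>lborel) =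
     set_lebesgue_integral lebesgue (ball x \<delta> - ball x \<epsilon>) (\<lambda>y. (g x - g y) / norm (x - y) powr ?k)"
    using eventually_at_right_less[of "0::real"]
  proof eventually_elim
    fix \<epsilon> :: real assume \<epsilon>: "0 < \<epsilon>"
    show "1/2 * (\<integral>z. indicator (ball 0 \<delta> - ball 0 \<epsilon>) z * kernel_sdiff s g x z \<partial>lborel) =
     set_lebesgue_integral lebesgue (ball x \<delta> - ball x \<epsilon>) (\<lambda>y. (g x - g y) / norm (x - y) powr ?k)"
    proof (rule set_integral_symmetrize[symmetric])
      show "integrable lborel (\<lambda>z. indicator (ball 0 \<delta> - ball 0 \<epsilon>) z * ((g x - g (x + z)) / norm z powr ?k))"
      proof (rule Bochner_Integration.integrable_bound)
        show "integrable lborel (\<lambda>z. indicator (ball (0::real^'n) \<delta>) z * (2 * C / \<epsilon> powr ?k))"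
          by (intro integrable_mult_left integrable_real_indicator emeasure_lborel_ball_finite) simp
        show "AE z in lborel. norm (indicator (ball 0 \<delta> - ball 0 \<epsilon>) z * ((g x - g (x + z)) / norm z powr ?k))
          \<le> norm (indicator (ball (0::real^'n) \<delta>) z * (2 * C / \<epsilon> powr ?k))"
        proof (intro always_eventually allI)
          fix z :: "real^'n"
          show "norm (indicator (ball 0 \<delta> - ball 0 \<epsilon>) z * ((g x - g (x + z)) / norm z powr ?k))
          \<le> norm (indicator (ball (0::real^'n) \<delta>) z * (2 * C / \<epsilon> powr ?k))"
          proof (cases "z \<in> ball 0 \<delta> - ball 0 \<epsilon>")
            case True
            have "\<bar>g x\<bar> \<le> C" "\<bar>g (x + z)\<bar> \<le> C" using True \<delta> by (auto intro!: bdd simp: dist_norm)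
            then have "\<bar>g x - g (x + z)\<bar> \<le> 2 * C" by linarith
            then have "\<bar>g x - g (x + z)\<bar> / norm z powr ?k \<le> 2 * C / \<epsilon> powr ?k"
              using True \<epsilon> s by (intro frac_le powr_mono2) auto
            then show ?thesis using True C by (simp add: indicator_def)
          qed (use C in \<open>auto simp: indicator_def\<close>)
        qed
      qed measurable
    qed (auto simp: dist_norm norm_minus_commute)
  qed
  ultimately have "((\<lambda>\<epsilon>. set_lebesgue_integral lebesgue (ball x \<delta> - ball x \<epsilon>) (\<lambda>y. (g x - g y) / norm (x - y) powr ?k))
     \<longlongrightarrow> 1/2 * (\<integral>z. indicator (ball 0 \<delta>) z * kernel_sdiff s g x z \<partial>lborel)) (at_right 0)"
    by (rule Lim_transform_eventually)
  then show ?thesis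
    unfolding frac_op_def pv_integral_def by (subst tendsto_Lim) auto
qed

lemma frac_op_outside:
  fixes v :: "real^'n \<Rightarrow> real"
  assumes \<delta>: "0 < \<delta>"
  shows "frac_op s (- ball x \<delta>) v x = frac_const TYPE('n) s *
    set_lebesgue_integral lebesgue (- ball x \<delta>) (\<lambda>y. (v x - v y) / norm (x - y) powr (real CARD('n) + 2 * s))"
proof -
  let ?f = "\<lambda>y. (v x - v y) / norm (x - y) powr (real CARD('n) + 2 * s)"
  have "\<forall>\<^sub>F \<epsilon> in at_right 0. set_lebesgue_integral lebesgue (- ball x \<delta>) ?f =
     set_lebesgue_integral lebesgue (- ball x \<delta> - ball x \<epsilon>) ?f"
    using eventually_at_right_real[OF \<delta>]
  proof eventually_elim
    fix \<epsilon> :: real assume "\<epsilon> \<in> {0<..<\<delta>}"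
    then have "- ball x \<delta> - ball x \<epsilon> = - ball x \<delta>" by auto
    then show "set_lebesgue_integral lebesgue (- ball x \<delta>) ?f =
     set_lebesgue_integral lebesgue (- ball x \<delta> - ball x \<epsilon>) ?f" by simp
  qed
  then have "((\<lambda>\<epsilon>. set_lebesgue_integral lebesgue (- ball x \<delta> - ball x \<epsilon>) ?f) \<longlongrightarrow>
     set_lebesgue_integral lebesgue (- ball x \<delta>) ?f) (at_right 0)"
    by (rule Lim_transform_eventually[OF tendsto_const])
  then show ?thesis
    unfolding frac_op_def pv_integral_def by (subst tendsto_Lim) auto
qed

text \<open>Outside the ball a bounded function is at most a multiple of
  \<open>norm z powr s\<close>, which is growth of order \<open>2 * b\<close> for
  \<open>b = s / 2 < s\<close>.\<close>

lemma integrable_outside_bounded: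
  fixes v :: "real^'n \<Rightarrow> real"
  assumes [measurable]: "v \<in> borel_measurable borel" and \<delta>: "0 < \<delta>" and s: "0 < s" "s < 1"
    and C: "\<And>y. \<bar>v y\<bar> \<le> C"
  shows "integrable lborel (\<lambda>z. indicator (- ball 0 \<delta>) z * (v z / norm z powr (real CARD('n) + 2 * s)))"
proof -
  have C0: "0 \<le> C" using C[of 0] by linarith
  have "\<bar>v z\<bar> \<le> (C * \<delta> powr (- s)) * norm z powr (2 * (s / 2))" if "\<delta> \<le> norm z" for z
  proof -
    have "1 = \<delta> powr (- s) * \<delta> powr s" using \<delta> by (simp add: powr_add[symmetric])
    also have "\<dots> \<le> \<delta> powr (- s) * norm z powr s"
      using that \<delta> s by (intro mult_left_mono powr_mono2) auto
    finally have "C * 1 \<le> C * (\<delta> powr (- s) * norm z powr s)"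
      using C0 by (intro mult_left_mono)
    then show ?thesis using C[of z] by (simp add: mult.assoc)
  qed
  then show ?thesis
    using integrable_kernel_outside[of "s / 2" s \<delta> v "C * \<delta> powr (- s)"] s \<delta> by simp
qed

text \<open>\<open>E_visc\<close> mixes the test function \<open>g\<close> inside the ball with the
  solution \<open>v\<close> outside. The touching inequality lets \<open>g\<close> replace
  \<open>v\<close> outside at the cost of an inequality in the useful direction; the two pieces then
  combine into one symmetric integral of \<open>g\<close> over the whole space, which scaling can
  evaluate.\<close>

lemma frac_op_split_ge:
  fixes g v :: "real^'n \<Rightarrow> real"
  assumes g [measurable]: "g \<in> borel_measurable borel" and v [measurable]: "v \<in> borel_measurable borel"
    and \<delta>: "0 < \<delta>" and s: "0 < s" "s < 1"
    and bdd: "\<And>y. y \<in> ball x \<delta> \<Longrightarrow> \<bar>g y\<bar> \<le> C" and bddv: "\<And>y. \<bar>v y\<bar> \<le> C'"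
    and int: "integrable lborel (kernel_sdiff s g x)"
    and out: "integrable lborel (\<lambda>z. indicator (- ball 0 \<delta>) z * ((g x - g (x + z)) / norm z powr (real CARD('n) + 2 * s)))"
    and le: "\<And>y. y \<notin> ball x \<delta> \<Longrightarrow> g x - g y \<le> v x - v y"
  shows "frac_const TYPE('n) s * (1/2 * (\<integral>z. kernel_sdiff s g x z \<partial>lborel)) \<le>
    frac_op s (ball x \<delta>) g x + frac_op s (- ball x \<delta>) v x"
proof -
  let ?k = "real CARD('n) + 2 * s"
  have intA: "integrable lborel (\<lambda>z. indicator A z * kernel_sdiff s g x z)" if "A \<in> sets borel" for A
    using integrable_mult_indicator[OF _ int, of A] that by simp
  have "set_lebesgue_integral lebesgue (- ball x \<delta>) (\<lambda>y. (g x - g y) / norm (x - y) powr ?k) \<le>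
    set_lebesgue_integral lebesgue (- ball x \<delta>) (\<lambda>y. (v x - v y) / norm (x - y) powr ?k)"
    (is "?L \<le> ?R")
  proof -
    have tr: "set_lebesgue_integral lebesgue (- ball x \<delta>) (\<lambda>y. (f x - f y) / norm (x - y) powr ?k) =
      (\<integral>z. indicator (- ball 0 \<delta>) z * ((f x - f (x + z)) / norm z powr ?k) \<partial>lborel)"
      if [measurable]: "f \<in> borel_measurable borel" for f
    proof -
      have "set_lebesgue_integral lebesgue (- ball x \<delta>) (\<lambda>y. (f x - f y) / norm (x - y) powr ?k) =
        (\<integral>y. indicator (- ball x \<delta>) y * ((f x - f y) / norm (x - y) powr ?k) \<partial>lborel)"
        unfolding set_lebesgue_integral_def by (subst integral_completion) auto
      also have "\<dots> = (\<integral>z. indicator (- ball 0 \<delta>) z * ((f x - f (x + z)) / norm z powr ?k) \<partial>lborel)"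
        by (subst integral_affine[of _ 1 x])
          (auto simp: indicator_def dist_norm intro!: Bochner_Integration.integral_cong)
      finally show ?thesis .
    qed
    have "\<bar>v x - v (x + z)\<bar> \<le> 2 * C'" for z using bddv[of x] bddv[of "x + z"] by linarith
    then have "integrable lborel (\<lambda>z. indicator (- ball 0 \<delta>) z * ((v x - v (x + z)) / norm z powr ?k))"
      using \<delta> s by (intro integrable_outside_bounded) auto
    then show ?thesis
      unfolding tr[OF g] tr[OF v] using out
    proof (intro integral_mono)
      fix z :: "real^'n"
      show "indicator (- ball 0 \<delta>) z * ((g x - g (x + z)) / norm z powr ?k) \<le>
        indicator (- ball 0 \<delta>) z * ((v x - v (x + z)) / norm z powr ?k)"
        using le[of "x + z"] by (auto simp: indicator_def dist_norm intro!: divide_right_mono)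
    qed
  qed
  moreover have "?L = 1/2 * (\<integral>z. indicator (- ball 0 \<delta>) z * kernel_sdiff s g x z \<partial>lborel)"
    by (rule set_integral_symmetrize[OF g _ _ _ out]) (auto simp: dist_norm norm_minus_commute)
  ultimately have 1: "1/2 * (\<integral>z. indicator (- ball 0 \<delta>) z * kernel_sdiff s g x z \<partial>lborel) \<le> ?R"
    by simp
  have "(\<integral>z. kernel_sdiff s g x z \<partial>lborel) =
     (\<integral>z. indicator (ball 0 \<delta>) z * kernel_sdiff s g x z + indicator (- ball 0 \<delta>) z * kernel_sdiff s g x z \<partial>lborel)"
    by (intro Bochner_Integration.integral_cong) (auto simp: indicator_def)
  also have "\<dots> = (\<integral>z. indicator (ball 0 \<delta>) z * kernel_sdiff s g x z \<partial>lborel) +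
     (\<integral>z. indicator (- ball 0 \<delta>) z * kernel_sdiff s g x z \<partial>lborel)"
    by (intro Bochner_Integration.integral_add intA) auto
  finally have 2: "1/2 * (\<integral>z. kernel_sdiff s g x z \<partial>lborel) \<le>
     1/2 * (\<integral>z. indicator (ball 0 \<delta>) z * kernel_sdiff s g x z \<partial>lborel) + ?R"
    using 1 by simp
  have "frac_op s (ball x \<delta>) g x + frac_op s (- ball x \<delta>) v x =
    frac_const TYPE('n) s * (1/2 * (\<integral>z. indicator (ball 0 \<delta>) z * kernel_sdiff s g x z \<partial>lborel) + ?R)"
    using frac_op_ball[OF g \<delta> s(1) bdd intA] frac_op_outside[OF \<delta>, of s x v]
    by (simp add: distrib_left)
  then show ?thesis using 2 frac_const_pos[OF s, where ?'n = 'n] by simp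
qed

section \<open>Scaling of the barrier\<close>

text \<open>The scaling \<open>z = (D / 2\<rho>) w\<close>, with \<open>\<rho>\<close> the distance to the centre, reduces the barrier to the
  profile function.\<close>

definition barrier :: "real \<Rightarrow> real^'n \<Rightarrow> real \<Rightarrow> real^'n \<Rightarrow> real" where
  "barrier b c r y = pospow b ((norm (y - c))\<^sup>2 - r\<^sup>2)"

lemma borel_measurable_barrier [measurable]: "barrier b c r \<in> borel_measurable borel"
  unfolding barrier_def[abs_def] by measurable

context
  fixes b s r :: real and x c :: "real^'n"
  assumes b: "0 < b" "b < s" and s: "s < 1" and r: "0 < r" "r < norm (x - c)"
begin

private definition "D = (norm (x - c))\<^sup>2 - r\<^sup>2"
private definition "\<rho> = norm (x - c)"

lemma barrier_scale_bounds: "0 < D" "0 < \<rho>" "0 < D / (2 * \<rho>)" "D / (4 * \<rho>\<^sup>2) \<le> 1/4"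
proof -
  show "0 < \<rho>" using r unfolding \<rho>_def by linarith
  show D: "0 < D" using r by (simp add: D_def power_strict_mono)
  then show "0 < D / (2 * \<rho>)" using \<open>0 < \<rho>\<close> by simp
  show "D / (4 * \<rho>\<^sup>2) \<le> 1/4" using \<open>0 < \<rho>\<close> by (simp add: D_def \<rho>_def)
qed

text \<open>Expanding the squared distance at \<open>x + t *\<^sub>R h *\<^sub>R w\<close> gives
  \<open>D + 2 * t * h * (w \<bullet> (x - c)) + h\<^sup>2 * (norm w)\<^sup>2\<close> for
  \<open>t = \<plusminus>1\<close>. With \<open>h = D / (2 * \<rho>)\<close> all terms contain
  \<open>D\<close>, the linear one with a unit direction, and the coefficient left in the quadratic
  one is \<open>D / (4 * \<rho>\<^sup>2)\<close>.\<close>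

lemma kernel_sdiff_barrier_scaled:
  "kernel_sdiff s (\<lambda>y. A * barrier b c r y) x ((D / (2 * \<rho>)) *\<^sub>R w) =
    A * D powr b * (D / (2 * \<rho>)) powr (- (real CARD('n) + 2 * s)) *
    (sdiff b (w \<bullet> ((x - c) /\<^sub>R \<rho>)) (D / (4 * \<rho>\<^sup>2) * (norm w)\<^sup>2) / norm w powr (real CARD('n) + 2 * s))"
proof -
  define h where "h = D / (2 * \<rho>)"
  have h: "0 < h" using barrier_scale_bounds by (simp add: h_def)
  have [simp]: "D \<noteq> 0" "\<rho> \<noteq> 0" using barrier_scale_bounds by auto
  have key: "barrier b c r (x + t *\<^sub>R h *\<^sub>R w) =
      D powr b * pospow b (1 + t * (w \<bullet> ((x - c) /\<^sub>R \<rho>)) + D / (4 * \<rho>\<^sup>2) * (norm w)\<^sup>2)"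
    if "t = 1 \<or> t = - 1" for t
  proof -
    have "(norm (x + t *\<^sub>R h *\<^sub>R w - c))\<^sup>2 - r\<^sup>2 = (norm ((x - c) + (t * h) *\<^sub>R w))\<^sup>2 - r\<^sup>2"
      by (simp add: algebra_simps)
    also have "\<dots> = D + 2 * (t * h) * (w \<bullet> (x - c)) + h\<^sup>2 * (norm w)\<^sup>2"
      using that unfolding D_def power2_norm_eq_inner
      by (auto simp: algebra_simps inner_commute power2_eq_square)
    also have "\<dots> = D * (1 + t * (w \<bullet> ((x - c) /\<^sub>R \<rho>)) + D / (4 * \<rho>\<^sup>2) * (norm w)\<^sup>2)"
      unfolding h_def inner_scaleR_right by (simp add: field_simps power2_eq_square)
    finally show ?thesis
      unfolding barrier_def using barrier_scale_bounds by (simp add: pospow_mult)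
  qed
  have x0: "barrier b c r x = D powr b"
    unfolding barrier_def using barrier_scale_bounds by (simp add: D_def pospow_pos_eq)
  have "2 * (A * barrier b c r x) - A * barrier b c r (x + h *\<^sub>R w) - A * barrier b c r (x - h *\<^sub>R w)
    = A * D powr b * sdiff b (w \<bullet> ((x - c) /\<^sub>R \<rho>)) (D / (4 * \<rho>\<^sup>2) * (norm w)\<^sup>2)"
    using key[of 1] key[of "- 1"] unfolding x0 by (simp add: sdiff_def algebra_simps)
  moreover have "norm (h *\<^sub>R w) powr k = norm w powr k / h powr (- k)" for k
    using h by (simp add: powr_mult powr_minus_divide)
  ultimately show ?thesis
    unfolding kernel_sdiff_def h_def[symmetric] by (simp only:) simp
qed

text \<open>The Jacobian and the kernel scale as \<open>h powr N\<close> and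
  \<open>h powr (- (N + 2 * s))\<close>, where \<open>N\<close> is the dimension, which leaves
  \<open>h powr (- 2 * s)\<close>. With \<open>D powr b\<close> this is the order
  \<open>D powr (b - 2 * s)\<close> that has to beat the gradient term.\<close>

lemma integrable_kernel_sdiff_barrier:
  "integrable lborel (kernel_sdiff s (\<lambda>y. A * barrier b c r y) x)"
  and integral_kernel_sdiff_barrier:
  "(\<integral>z. kernel_sdiff s (\<lambda>y. A * barrier b c r y) x z \<partial>lborel) =
    A * D powr b * (D / (2 * \<rho>)) powr (- 2 * s) * profile b s ((x - c) /\<^sub>R \<rho>) (D / (4 * \<rho>\<^sup>2))"
proof -
  define h where "h = D / (2 * \<rho>)"
  have h: "0 < h" using barrier_scale_bounds by (simp add: h_def)
  have e: "norm ((x - c) /\<^sub>R \<rho>) = 1" using barrier_scale_bounds(2) by (simp add: \<rho>_def)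
  have \<eta>: "0 \<le> D / (4 * \<rho>\<^sup>2)" using barrier_scale_bounds(1) by simp
  have int: "integrable lborel (\<lambda>w. sdiff b (w \<bullet> ((x - c) /\<^sub>R \<rho>)) (D / (4 * \<rho>\<^sup>2) * (norm w)\<^sup>2) /
      norm w powr (real CARD('n) + 2 * s))"
    using integrable_profile[OF b s e \<eta> barrier_scale_bounds(4)] by simp
  have "integrable lborel (\<lambda>w. kernel_sdiff s (\<lambda>y. A * barrier b c r y) x (0 + h *\<^sub>R w))"
    unfolding h_def add_0 kernel_sdiff_barrier_scaled by (intro integrable_mult_right int)
  then show "integrable lborel (kernel_sdiff s (\<lambda>y. A * barrier b c r y) x)"
    using h by (subst (asm) integrable_affine) auto
  have "(\<integral>z. kernel_sdiff s (\<lambda>y. A * barrier b c r y) x z \<partial>lborel) =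
      \<bar>h\<bar> ^ CARD('n) * (\<integral>w. kernel_sdiff s (\<lambda>y. A * barrier b c r y) x (0 + h *\<^sub>R w) \<partial>lborel)"
    using h by (subst integral_affine[of _ h 0]) auto
  also have "\<dots> = h ^ CARD('n) * (A * D powr b * h powr (- (real CARD('n) + 2 * s)) *
      profile b s ((x - c) /\<^sub>R \<rho>) (D / (4 * \<rho>\<^sup>2)))"
  proof -
    have "\<bar>h\<bar> = h" using h by simp
    moreover have "(\<integral>w. sdiff b (w \<bullet> ((x - c) /\<^sub>R \<rho>)) (D / (4 * \<rho>\<^sup>2) * (norm w)\<^sup>2) /
      norm w powr (real CARD('n) + 2 * s) \<partial>lborel) = profile b s ((x - c) /\<^sub>R \<rho>) (D / (4 * \<rho>\<^sup>2))"
      by (simp add: profile_def)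
    ultimately show ?thesis
      unfolding h_def add_0 kernel_sdiff_barrier_scaled integral_mult_right_zero by (simp only:)
  qed
  also have "h ^ CARD('n) = h powr (real CARD('n))" using h by (simp add: powr_realpow)
  also have "h powr (real CARD('n)) * (A * D powr b * h powr (- (real CARD('n) + 2 * s)) *
      profile b s ((x - c) /\<^sub>R \<rho>) (D / (4 * \<rho>\<^sup>2))) =
      A * D powr b * (h powr real CARD('n) * h powr (- (real CARD('n) + 2 * s))) *
      profile b s ((x - c) /\<^sub>R \<rho>) (D / (4 * \<rho>\<^sup>2))"
    by (simp only: mult_ac)
  also have "h powr real CARD('n) * h powr (- (real CARD('n) + 2 * s)) = h powr (- 2 * s)"
    by (simp add: powr_add[symmetric])
  finally show "(\<integral>z. kernel_sdiff s (\<lambda>y. A * barrier b c r y) x z \<partial>lborel) =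
    A * D powr b * (D / (2 * \<rho>)) powr (- 2 * s) * profile b s ((x - c) /\<^sub>R \<rho>) (D / (4 * \<rho>\<^sup>2))"
    unfolding h_def .
qed

lemmas barrier_integrable = integrable_kernel_sdiff_barrier[unfolded D_def \<rho>_def]
lemmas barrier_integral = integral_kernel_sdiff_barrier[unfolded D_def \<rho>_def]

end

section \<open>Twice continuously differentiable functions\<close>

lemma C2_onI:
  assumes "\<And>x. x \<in> S \<Longrightarrow> (f has_derivative blinfun_apply (f' x)) (at x)"
    and "\<And>x. x \<in> S \<Longrightarrow> (f' has_derivative blinfun_apply (f'' x)) (at x)"
    and "continuous_on S f''"
  shows "C2_on S f"
  using assms unfolding C2_on_def by blast

lemma C2_on_imp_continuous_on: "C2_on S f \<Longrightarrow> continuous_on S f"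
  unfolding C2_on_def
  by (meson continuous_at_imp_continuous_on has_derivative_continuous)

lemma C2_on_cong:
  assumes "C2_on S f" "open S" "\<And>x. x \<in> S \<Longrightarrow> f x = g x"
  shows "C2_on S g"
proof -
  obtain f' f'' where f: "\<And>x. x \<in> S \<Longrightarrow> (f has_derivative blinfun_apply (f' x)) (at x)"
    "\<And>x. x \<in> S \<Longrightarrow> (f' has_derivative blinfun_apply (f'' x)) (at x)" "continuous_on S f''"
    using assms(1) unfolding C2_on_def by blast
  show ?thesis
    by (rule C2_onI[OF _ f(2,3)])
      (use f(1) assms(2,3) in \<open>auto intro: has_derivative_transform_within_open\<close>)
qed

lemma C2_on_bounded_linear:
  assumes "bounded_linear f"
  shows "C2_on S f"
proof (rule C2_onI[where f' = "\<lambda>_. Blinfun f" and f'' = "\<lambda>_. 0"])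
  show "(f has_derivative blinfun_apply (Blinfun f)) (at x)" for x
    using assms by (simp add: bounded_linear_Blinfun_apply bounded_linear_imp_has_derivative)
qed (auto simp: zero_blinfun.rep_eq)

lemma C2_on_const: "C2_on S (\<lambda>_. c)"
  by (rule C2_onI[where f' = "\<lambda>_. 0" and f'' = "\<lambda>_. 0"]) (auto simp: zero_blinfun.rep_eq)

lemma C2_on_add:
  assumes "C2_on S f" "C2_on S g"
  shows "C2_on S (\<lambda>x. f x + g x)"
proof -
  obtain f' f'' where f: "\<And>x. x \<in> S \<Longrightarrow> (f has_derivative blinfun_apply (f' x)) (at x)"
    "\<And>x. x \<in> S \<Longrightarrow> (f' has_derivative blinfun_apply (f'' x)) (at x)" "continuous_on S f''"
    using assms(1) unfolding C2_on_def by blast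
  obtain g' g'' where g: "\<And>x. x \<in> S \<Longrightarrow> (g has_derivative blinfun_apply (g' x)) (at x)"
    "\<And>x. x \<in> S \<Longrightarrow> (g' has_derivative blinfun_apply (g'' x)) (at x)" "continuous_on S g''"
    using assms(2) unfolding C2_on_def by blast
  show ?thesis
    by (rule C2_onI[where f' = "\<lambda>x. f' x + g' x" and f'' = "\<lambda>x. f'' x + g'' x"])
      (use f g in \<open>auto simp: plus_blinfun.rep_eq intro!: has_derivative_add continuous_on_add\<close>)
qed

lemma C2_on_compose:
  fixes h :: "real \<Rightarrow> real"
  assumes f: "C2_on S f"
    and h: "\<And>y. y \<in> f ` S \<Longrightarrow> (h has_real_derivative h' y) (at y)"
      "\<And>y. y \<in> f ` S \<Longrightarrow> (h' has_real_derivative h'' y) (at y)"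
      "continuous_on (f ` S) h''"
  shows "C2_on S (\<lambda>x. h (f x))"
proof -
  obtain f' f'' where f': "\<And>x. x \<in> S \<Longrightarrow> (f has_derivative blinfun_apply (f' x)) (at x)"
    "\<And>x. x \<in> S \<Longrightarrow> (f' has_derivative blinfun_apply (f'' x)) (at x)" "continuous_on S f''"
    using f unfolding C2_on_def by blast
  have c: "continuous_on S f" "continuous_on S f'"
    using f'(1,2) by (meson continuous_at_imp_continuous_on has_derivative_continuous)+
  have ch': "continuous_on (f ` S) h'"
    using h(2) by (meson continuous_at_imp_continuous_on DERIV_isCont)
  show ?thesis
  proof (rule C2_onI[where f' = "\<lambda>x. h' (f x) *\<^sub>R f' x" and
        f'' = "\<lambda>x. h'' (f x) *\<^sub>R (blinfun_scaleR_left (f' x) o\<^sub>L f' x) + h' (f x) *\<^sub>R f'' x"])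
    fix x assume x: "x \<in> S"
    have d1: "((\<lambda>x. h (f x)) has_derivative (\<lambda>v. blinfun_apply (f' x) v * h' (f x))) (at x)"
      using has_derivative_compose[OF f'(1)[OF x], of h "(*) (h' (f x))"] h(1)[of "f x"] x
      by (simp add: has_field_derivative_def mult.commute)
    then show "((\<lambda>x. h (f x)) has_derivative blinfun_apply (h' (f x) *\<^sub>R f' x)) (at x)"
      by (simp add: scaleR_blinfun.rep_eq mult.commute)
    have d2: "((\<lambda>x. h' (f x)) has_derivative (\<lambda>v. blinfun_apply (f' x) v * h'' (f x))) (at x)"
      using has_derivative_compose[OF f'(1)[OF x], of h' "(*) (h'' (f x))"] h(2)[of "f x"] x
      by (simp add: has_field_derivative_def mult.commute)
    have "((\<lambda>x. h' (f x) *\<^sub>R f' x) has_derivative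
       (\<lambda>v. h' (f x) *\<^sub>R blinfun_apply (f'' x) v + (blinfun_apply (f' x) v * h'' (f x)) *\<^sub>R f' x)) (at x)"
      by (rule has_derivative_scaleR[OF d2 f'(2)[OF x]])
    then show "((\<lambda>x. h' (f x) *\<^sub>R f' x) has_derivative blinfun_apply
       (h'' (f x) *\<^sub>R (blinfun_scaleR_left (f' x) o\<^sub>L f' x) + h' (f x) *\<^sub>R f'' x)) (at x)"
      by (rule has_derivative_eq_rhs)
        (simp add: fun_eq_iff plus_blinfun.rep_eq scaleR_blinfun.rep_eq algebra_simps)
  next
    show "continuous_on S (\<lambda>x. h'' (f x) *\<^sub>R (blinfun_scaleR_left (f' x) o\<^sub>L f' x) + h' (f x) *\<^sub>R f'' x)"
      by (intro continuous_intros continuous_on_compose2[OF h(3)] continuous_on_compose2[OF ch'] c f'(3)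
         bounded_linear.continuous_on[OF bounded_linear_blinfun_scaleR_left]) auto
  qed
qed

lemma C2_on_cmult: "C2_on S f \<Longrightarrow> C2_on S (\<lambda>x. c * f x)" for c :: real
  by (rule C2_on_compose[where h' = "\<lambda>_. c" and h'' = "\<lambda>_. 0"])
    (auto intro!: derivative_eq_intros)

lemma C2_on_power2: "C2_on S f \<Longrightarrow> C2_on S (\<lambda>x. (f x)\<^sup>2)"
  by (rule C2_on_compose[where h' = "\<lambda>x. 2 * x" and h'' = "\<lambda>_. 2"])
    (auto intro!: derivative_eq_intros)

lemma C2_on_powr:
  assumes "C2_on S f" "\<And>x. x \<in> S \<Longrightarrow> 0 < f x"
  shows "C2_on S (\<lambda>x. f x powr b)"
proof (rule C2_on_compose[where h' = "\<lambda>y. b * y powr (b - 1)" and h'' = "\<lambda>y. b * ((b - 1) * y powr (b - 2))", OF assms(1)])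
  show "((\<lambda>y. y powr b) has_real_derivative b * y powr (b - 1)) (at y)" if "y \<in> f ` S" for y
    using that assms(2) by (auto intro!: derivative_eq_intros)
  show "((\<lambda>y. b * y powr (b - 1)) has_real_derivative b * ((b - 1) * y powr (b - 2))) (at y)" if "y \<in> f ` S" for y
    using that assms(2) by (auto intro!: derivative_eq_intros)
  have "\<forall>y\<in>f ` S. y \<noteq> 0" using assms(2) by force
  then show "continuous_on (f ` S) (\<lambda>y. b * ((b - 1) * y powr (b - 2)))"
    by (intro continuous_intros) auto
qed

text \<open>Polarization reduces products to squares, which are covered by the chain rule for
  functions of one variable.\<close>

lemma C2_on_mult:
  assumes "C2_on S f" "C2_on S g"
  shows "C2_on S (\<lambda>x. f x * g x)"
proof -
  have "C2_on S (\<lambda>x. (1/4) * (f x + g x)\<^sup>2 + (- 1/4) * (f x + (- 1) * g x)\<^sup>2)"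
    by (intro C2_on_add C2_on_cmult C2_on_power2 assms)
  moreover have "(1/4) * (a + b)\<^sup>2 + (- 1/4) * (a + (- 1) * b)\<^sup>2 = a * b" for a b :: real
    by (simp add: power2_eq_square algebra_simps)
  ultimately show ?thesis by simp
qed

lemma C2_on_sum:
  "finite I \<Longrightarrow> (\<And>i. i \<in> I \<Longrightarrow> C2_on S (f i)) \<Longrightarrow> C2_on S (\<lambda>x. \<Sum>i\<in>I. f i x)"
  by (induction I rule: finite_induct) (auto intro: C2_on_const C2_on_add)

lemma C2_on_dist_sq: "C2_on S (\<lambda>z :: 'a::euclidean_space \<times> real. (norm (fst z - c))\<^sup>2)"
proof -
  have "C2_on S (\<lambda>z :: 'a \<times> real. \<Sum>i\<in>Basis. (fst z \<bullet> i + (- (c \<bullet> i)))\<^sup>2)"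
    by (intro C2_on_sum C2_on_power2 C2_on_add C2_on_const C2_on_bounded_linear finite_Basis)
      (intro bounded_linear_compose[OF bounded_linear_inner_left bounded_linear_fst])
  moreover have "(\<Sum>i\<in>Basis. (fst z \<bullet> i + (- (c \<bullet> i)))\<^sup>2) = (norm (fst z - c))\<^sup>2" for z :: "'a \<times> real"
    unfolding power2_norm_eq_inner euclidean_inner[of "fst z - c" "fst z - c"]
    by (simp add: inner_diff_left power2_eq_square)
  ultimately show ?thesis by simp
qed

lemma C2_on_snd: "C2_on S (\<lambda>z :: 'a::real_normed_vector \<times> real. snd z)"
  by (rule C2_on_bounded_linear) (rule bounded_linear_snd)

lemma open_cylinder: "open (cylinder \<delta> x t)"
  unfolding cylinder_def by (intro open_Times) auto

lemma gradient_eq: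
  assumes "GDERIV f x :> D"
  shows "gradient f x = D"
  unfolding gradient_def
proof (rule the_equality[where P = "\<lambda>D. GDERIV f x :> D", OF assms])
  fix D' assume "GDERIV f x :> D'"
  then have "(\<lambda>h. h \<bullet> D') = (\<lambda>h. h \<bullet> D)"
    using assms unfolding gderiv_def by (rule has_derivative_unique)
  then show "D' = D" by (metis inner_commute vector_eq_ldot)
qed

lemma GDERIV_dist_sq: "GDERIV (\<lambda>y. (norm (y - c))\<^sup>2) x :> 2 *\<^sub>R (x - c)"
  unfolding gderiv_def power2_norm_eq_inner
  by (auto intro!: derivative_eq_intros simp: inner_commute algebra_simps)

section \<open>Exterior balls\<close>

text \<open>The second derivative is bounded on the compact ball, so the first is Lipschitz there
  and Taylor's remainder is quadratic. Both points vary while \<open>C\<close> is fixed; this is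
  what gives nearby boundary points a common exterior radius.\<close>

lemma C2_on_UNIV_quadratic_bound:
  fixes \<gamma> :: "'a::euclidean_space \<Rightarrow> real"
  assumes "C2_on UNIV \<gamma>"
  shows "\<exists>\<gamma>' C. 0 \<le> C \<and> (\<forall>x\<in>cball z R. \<forall>y\<in>cball z R.
    \<bar>\<gamma> y - \<gamma> x - blinfun_apply (\<gamma>' x) (y - x)\<bar> \<le> C * (norm (y - x))\<^sup>2)"
proof -
  obtain \<gamma>' \<gamma>'' where \<gamma>: "\<And>x. (\<gamma> has_derivative blinfun_apply (\<gamma>' x)) (at x)"
    "\<And>x. (\<gamma>' has_derivative blinfun_apply (\<gamma>'' x)) (at x)" "continuous_on UNIV \<gamma>''"
    using assms unfolding C2_on_def by blast
  have "bounded (\<gamma>'' ` cball z R)"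
    using \<gamma>(3) by (intro compact_imp_bounded compact_continuous_image) (auto intro: continuous_on_subset)
  then obtain C where C: "\<And>x. x \<in> cball z R \<Longrightarrow> norm (\<gamma>'' x) \<le> C" "0 < C"
    by (metis bounded_pos imageI)
  have lip: "norm (\<gamma>' y - \<gamma>' x) \<le> C * norm (y - x)" if "x \<in> cball z R" "y \<in> cball z R" for x y
    by (rule differentiable_bound[OF convex_cball, where f' = "\<lambda>x. blinfun_apply (\<gamma>'' x)"])
      (use that \<gamma>(2) C in \<open>auto intro: has_derivative_at_withinI simp: norm_blinfun.rep_eq[symmetric]\<close>)
  show ?thesis
  proof (intro exI conjI ballI)
    fix x y assume xy: "x \<in> cball z R" "y \<in> cball z R"
    have seg: "x + t *\<^sub>R (y - x) \<in> cball z R \<and> norm (x + t *\<^sub>R (y - x) - x) \<le> norm (y - x)"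
      if "t \<in> {0..1}" for t
    proof
      have "(1 - t) *\<^sub>R x + t *\<^sub>R y \<in> cball z R"
        using that xy by (intro convexD[OF convex_cball]) auto
      then show "x + t *\<^sub>R (y - x) \<in> cball z R" by (simp add: algebra_simps)
      show "norm (x + t *\<^sub>R (y - x) - x) \<le> norm (y - x)"
        using that by (simp add: mult_left_le_one_le)
    qed
    have "norm (\<gamma> y - \<gamma> x - blinfun_apply (\<gamma>' x) (y - x)) \<le> norm (y - x) * (C * norm (y - x))"
    proof (rule differentiable_bound_linearization[where S = "cball z R \<inter> cball x (norm (y - x))"
          and f' = "\<lambda>w. blinfun_apply (\<gamma>' w)"])
      show "x + t *\<^sub>R (y - x) \<in> cball z R \<inter> cball x (norm (y - x))" if "t \<in> {0..1}" for t
        using seg[OF that] by (simp add: dist_norm norm_minus_commute)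
      show "(\<gamma> has_derivative blinfun_apply (\<gamma>' w)) (at w within cball z R \<inter> cball x (norm (y - x)))" for w
        using \<gamma>(1) by (rule has_derivative_at_withinI)
      show "onorm (blinfun_apply (\<gamma>' w) - blinfun_apply (\<gamma>' x)) \<le> C * norm (y - x)"
        if "w \<in> cball z R \<inter> cball x (norm (y - x))" for w
      proof -
        have "onorm (blinfun_apply (\<gamma>' w) - blinfun_apply (\<gamma>' x)) = norm (\<gamma>' w - \<gamma>' x)"
          by (simp add: norm_blinfun.rep_eq minus_blinfun.rep_eq fun_diff_def)
        also have "\<dots> \<le> C * norm (w - x)" using lip[of x w] xy that by auto
        also have "\<dots> \<le> C * norm (y - x)"
          using that C by (intro mult_left_mono) (auto simp: dist_norm norm_minus_commute)
        finally show ?thesis .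
      qed
    qed (use xy in auto)
    then show "\<bar>\<gamma> y - \<gamma> x - blinfun_apply (\<gamma>' x) (y - x)\<bar> \<le> C * (norm (y - x))\<^sup>2"
      by (simp add: power2_eq_square mult_ac)
  qed (use C in auto)
qed

definition exterior_ball :: "'a::euclidean_space set \<Rightarrow> real \<Rightarrow> 'a \<Rightarrow> bool" where
  "exterior_ball \<Omega> r z \<longleftrightarrow> (\<exists>c. norm (z - c) = r \<and> ball c r \<inter> \<Omega> = {})"

lemma exterior_ball_mono:
  assumes "exterior_ball \<Omega> r z" "0 < r'" "r' \<le> r"
  shows "exterior_ball \<Omega> r' z"
proof -
  obtain c where c: "norm (z - c) = r" "ball c r \<inter> \<Omega> = {}"
    using assms(1) unfolding exterior_ball_def by blast
  define c' where "c' = z + (r' / r) *\<^sub>R (c - z)"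
  have r: "0 < r" using assms by simp
  have 1: "norm (z - c') = r'"
    using c(1) r assms by (simp add: c'_def norm_minus_commute)
  have "c - c' = (1 - r' / r) *\<^sub>R (c - z)" by (simp add: c'_def algebra_simps)
  then have "dist c c' = \<bar>1 - r' / r\<bar> * r"
    using c(1) by (simp only: dist_norm norm_scaleR norm_minus_commute)
  also have "\<dots> = r - r'" using r assms by (simp add: abs_of_nonneg field_simps)
  finally have "dist c c' = r - r'" .
  then have "ball c' r' \<subseteq> ball c r"
    by (simp add: ball_subset_ball_iff dist_commute)
  then show ?thesis using 1 c(2) unfolding exterior_ball_def by blast
qed

text \<open>In a graph chart \<Omega> is \<open>{g > 0}\<close>. If \<open>n\<close> represents the
  derivative of \<open>g\<close> at a boundary point \<open>y\<close>, then \<open>h = x - y\<close>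
  satisfies \<open>h \<bullet> n > - 4 * C * (norm h)\<^sup>2\<close> for \<open>x\<close> in
  \<Omega>. For \<open>x\<close> in the ball of radius \<rho> touching \<open>y\<close> from the
  side of \<open>- n\<close> it satisfies
  \<open>2 * \<rho> * (h \<bullet> n) < - (norm h)\<^sup>2\<close>. Both cannot hold once
  \<open>8 * C * \<rho> \<le> 1\<close>.\<close>

lemma local_exterior_ball:
  fixes \<Omega> :: "(real^'n) set"
  assumes "open \<Omega>" and "C2_boundary \<Omega>" and z: "z \<in> frontier \<Omega>"
  obtains r \<rho> where "0 < r" "0 < \<rho>" "\<And>y. y \<in> frontier \<Omega> \<inter> ball z r \<Longrightarrow> exterior_ball \<Omega> \<rho> y"
proof -
  obtain r e \<gamma> where r: "0 < r" and e: "norm e = 1" and C2: "C2_on UNIV \<gamma>" and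
    loc: "\<Omega> \<inter> ball z r = {x \<in> ball z r. x \<bullet> e > \<gamma> (x - (x \<bullet> e) *\<^sub>R e)}"
    using assms(2) z unfolding C2_boundary_def by blast
  define P where "P x = x - (x \<bullet> e) *\<^sub>R e" for x
  define g where "g x = x \<bullet> e - \<gamma> (P x)" for x
  have loc': "x \<in> \<Omega> \<longleftrightarrow> 0 < g x" if "x \<in> ball z r" for x
    using arg_cong[OF loc, of "\<lambda>S. x \<in> S"] that
    by (simp only: Int_iff mem_Collect_eq simp_thms g_def P_def diff_gt_0_iff_gt)
  have P_lin: "P (x - y) = P x - P y" for x y by (simp add: P_def algebra_simps inner_diff_left)
  have P_bl: "bounded_linear P" unfolding P_def
    by (intro bounded_linear_sub bounded_linear_ident
        bounded_linear_scaleR_left[THEN bounded_linear_compose] bounded_linear_inner_left)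
  have Pn: "norm (P x) \<le> 2 * norm x" for x
  proof -
    have "norm (P x) \<le> norm x + \<bar>x \<bullet> e\<bar> * norm e"
      unfolding P_def using norm_triangle_ineq4[of x "(x \<bullet> e) *\<^sub>R e"] by simp
    then show ?thesis using e Cauchy_Schwarz_ineq2[of x e] by simp
  qed
  have Pe: "P e = 0" using e by (simp add: P_def dot_square_norm)
  \<comment> \<open>By the crude bound \<open>Pn\<close> the projection at most doubles distances,
    so it maps \<open>ball z r\<close> into this ball.\<close>
  obtain \<gamma>' C where C0: "0 \<le> C" and
    C: "\<And>x y. x \<in> cball (P z) (2 * r) \<Longrightarrow> y \<in> cball (P z) (2 * r) \<Longrightarrow>
       \<bar>\<gamma> y - \<gamma> x - blinfun_apply (\<gamma>' x) (y - x)\<bar> \<le> C * (norm (y - x))\<^sup>2"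
    using C2_on_UNIV_quadratic_bound[OF C2, of "P z" "2 * r"] by blast
  have cont_g: "continuous_on UNIV g"
  proof -
    have "continuous_on UNIV (\<lambda>x. \<gamma> (P x))"
      by (rule continuous_on_compose2[OF C2_on_imp_continuous_on[OF C2]
          bounded_linear.continuous_on[OF P_bl continuous_on_id]]) simp
    then show ?thesis unfolding g_def
      by (intro continuous_on_diff continuous_on_inner continuous_on_id continuous_on_const)
  qed
  \<comment> \<open>A point of the exterior ball is within \<open>2 * \<rho> \<le> r / 4\<close> of
    \<open>y\<close>, which is within \<open>r / 2\<close> of \<open>z\<close>, so it stays in the
    chart. The second entry gives \<open>8 * C * \<rho> \<le> 1\<close>, also when
    \<open>C = 0\<close>.\<close>
  define \<rho> where "\<rho> = min (r / 8) (1 / (8 * C + 8))"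
  have \<rho>: "0 < \<rho>" "\<rho> \<le> r / 8" "4 * C * (2 * \<rho>) \<le> 1"
  proof -
    show "0 < \<rho>" "\<rho> \<le> r / 8" using r C0 by (auto simp: \<rho>_def)
    have "8 * C * \<rho> \<le> 8 * C * (1 / (8 * C + 8))"
      using C0 by (intro mult_left_mono) (auto simp: \<rho>_def)
    also have "\<dots> \<le> 1" using C0 by (simp add: field_simps)
    finally show "4 * C * (2 * \<rho>) \<le> 1" by simp
  qed
  show thesis
  proof (rule that[of "r / 2" \<rho>])
    fix y assume y: "y \<in> frontier \<Omega> \<inter> ball z (r / 2)"
    then have yr: "y \<in> ball z r" using r by auto
    have yO: "y \<notin> \<Omega>" using y assms(1) by (simp add: frontier_def interior_open)
    have g0: "g y = 0"
    proof (rule antisym)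
      show "g y \<le> 0" using loc'[OF yr] yO by simp
      show "0 \<le> g y"
      proof (rule ccontr)
        assume "\<not> 0 \<le> g y"
        then have "y \<in> {x. g x < 0} \<inter> ball z r" using yr by simp
        moreover have "open ({x. g x < 0} \<inter> ball z r)"
          by (intro open_Int open_Collect_less cont_g) auto
        moreover have "y \<in> closure \<Omega>" using y by (simp add: frontier_def)
        ultimately obtain x where "x \<in> \<Omega>" "x \<in> {x. g x < 0} \<inter> ball z r"
          using open_Int_closure_eq_empty by blast
        then show False using loc' by fastforce
      qed
    qed
    define L where "L v = v \<bullet> e - blinfun_apply (\<gamma>' (P y)) (P v)" for v
    have "linear L"
    proof -
      have "linear (\<lambda>v. blinfun_apply (\<gamma>' (P y)) (P v))"
        using linear_compose[of P "blinfun_apply (\<gamma>' (P y))"] P_bl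
        by (simp add: o_def bounded_linear.linear blinfun.bounded_linear_right)
      moreover have "linear (\<lambda>v. v \<bullet> e)"
        by (intro bounded_linear.linear bounded_linear_inner_left)
      ultimately show ?thesis unfolding L_def by (intro linear_compose_sub)
    qed
    define n where "n = (\<Sum>i\<in>Basis. L i *\<^sub>R i)"
    have Ln: "L v = v \<bullet> n" for v
    proof -
      have "L v = L (\<Sum>i\<in>Basis. (v \<bullet> i) *\<^sub>R i)" by (simp add: euclidean_representation)
      also have "\<dots> = (\<Sum>i\<in>Basis. (v \<bullet> i) * L i)"
        using \<open>linear L\<close> by (simp add: linear_sum linear_cmul o_def)
      also have "\<dots> = v \<bullet> n" by (simp add: n_def inner_sum_right mult.commute)
      finally show ?thesis .
    qed
    \<comment> \<open>The graph direction \<open>e\<close> is killed by the projection, so the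
      derivative of \<open>g\<close> along it is 1 whatever the slope of \<gamma>. This bounds
      \<open>norm n\<close> below.\<close>
    have "e \<bullet> n = 1" unfolding Ln[symmetric] L_def using e by (simp add: Pe dot_square_norm)
    then have n1: "1 \<le> norm n" using norm_cauchy_schwarz[of e n] e by simp
    then have n0: "0 < norm n" by linarith
    define c where "c = y - (\<rho> / norm n) *\<^sub>R n"
    have yc: "norm (y - c) = \<rho>" using n0 \<rho> by (simp add: c_def)
    have "ball c \<rho> \<inter> \<Omega> = {}"
    proof (intro equals0I)
      fix x assume "x \<in> ball c \<rho> \<inter> \<Omega>"
      then have xc: "norm (x - c) < \<rho>" and xO: "x \<in> \<Omega>" by (auto simp: dist_norm norm_minus_commute)
      define h where "h = x - y"
      have "norm h \<le> norm (x - c) + norm (y - c)"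
        using norm_triangle_ineq4[of "x - c" "y - c"] by (simp add: h_def)
      then have h2: "norm h < 2 * \<rho>" using xc yc by simp
      have yz: "dist z y < r / 2" using y by simp
      have xz: "dist z x < r"
        using h2 yz \<rho>(2) r dist_triangle[of z x y] by (simp add: h_def dist_norm norm_minus_commute)
      have gx: "0 < g x" using loc'[of x] xz xO by simp
      have "\<bar>\<gamma> (P x) - \<gamma> (P y) - blinfun_apply (\<gamma>' (P y)) (P x - P y)\<bar> \<le> C * (norm (P x - P y))\<^sup>2"
      proof (rule C)
        show "P y \<in> cball (P z) (2 * r)" using Pn[of "z - y"] yz r by (simp add: dist_norm P_lin)
        show "P x \<in> cball (P z) (2 * r)" using Pn[of "z - x"] xz r by (simp add: dist_norm P_lin)
      qed
      also have "\<dots> \<le> C * (2 * norm h)\<^sup>2"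
        using C0 Pn[of h] by (intro mult_left_mono power_mono) (auto simp: h_def P_lin)
      finally have "- (C * (2 * norm h)\<^sup>2) \<le> \<gamma> (P x) - \<gamma> (P y) - blinfun_apply (\<gamma>' (P y)) (P h)"
        by (simp add: h_def P_lin abs_le_iff)
      moreover have "x \<bullet> e - y \<bullet> e = h \<bullet> e" by (simp add: h_def inner_diff_left)
      ultimately have "g x - g y \<le> L h + C * (2 * norm h)\<^sup>2"
        unfolding g_def L_def by linarith
      then have pos: "0 < h \<bullet> n + 4 * C * (norm h)\<^sup>2"
        using gx g0 by (simp add: Ln power_mult_distrib)
      have "x - c = h + (\<rho> / norm n) *\<^sub>R n" by (simp add: h_def c_def)
      then have "(norm (x - c))\<^sup>2 = (norm h)\<^sup>2 + 2 * (\<rho> / norm n) * (h \<bullet> n) + (\<rho> / norm n)\<^sup>2 * (norm n)\<^sup>2"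
        unfolding power2_norm_eq_inner
        by (simp add: inner_add_left inner_add_right inner_commute power2_eq_square algebra_simps)
      moreover have "(\<rho> / norm n)\<^sup>2 * (norm n)\<^sup>2 = \<rho>\<^sup>2" using n0 by (simp add: power_divide)
      moreover have "(norm (x - c))\<^sup>2 < \<rho>\<^sup>2" using xc by (intro power_strict_mono) auto
      ultimately have "(norm h)\<^sup>2 + 2 * (\<rho> / norm n) * (h \<bullet> n) < 0" by linarith
      then have "(norm h)\<^sup>2 * norm n + 2 * \<rho> * (h \<bullet> n) < 0"
        using n0 by (simp add: field_simps)
      moreover have "(norm h)\<^sup>2 * 1 \<le> (norm h)\<^sup>2 * norm n" using n1 by (intro mult_left_mono) auto
      ultimately have A: "(norm h)\<^sup>2 + 2 * \<rho> * (h \<bullet> n) < 0" by linarith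
      have "2 * \<rho> * (- (4 * C * (norm h)\<^sup>2)) < 2 * \<rho> * (h \<bullet> n)"
        using pos \<rho>(1) by (intro mult_strict_left_mono) auto
      moreover have "(4 * C * (2 * \<rho>)) * (norm h)\<^sup>2 \<le> 1 * (norm h)\<^sup>2"
        using \<rho>(3) by (intro mult_right_mono) auto
      moreover have "(4 * C * (2 * \<rho>)) * u = - (2 * \<rho> * (- (4 * C * u)))" for u by algebra
      from this[of "(norm h)\<^sup>2"] calculation show False using A by linarith
    qed
    then show "exterior_ball \<Omega> \<rho> y" using yc unfolding exterior_ball_def by blast
  qed (use r \<rho> in auto)
qed

lemma uniform_exterior_ball:
  fixes \<Omega> :: "(real^'n) set"
  assumes "bounded_C2_domain \<Omega>"
  obtains r where "0 < r" "\<And>z. z \<in> frontier \<Omega> \<Longrightarrow> exterior_ball \<Omega> r z"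
proof -
  have \<Omega>: "open \<Omega>" "bounded \<Omega>" "C2_boundary \<Omega>" using assms unfolding bounded_C2_domain_def by auto
  have "\<exists>r \<rho>. 0 < r \<and> 0 < \<rho> \<and> (\<forall>y \<in> frontier \<Omega> \<inter> ball z r. exterior_ball \<Omega> \<rho> y)"
    if "z \<in> frontier \<Omega>" for z
    using local_exterior_ball[OF \<Omega>(1,3) that] by metis
  then obtain r \<rho> where r: "\<And>z. z \<in> frontier \<Omega> \<Longrightarrow> 0 < r z" "\<And>z. z \<in> frontier \<Omega> \<Longrightarrow> 0 < \<rho> z"
    "\<And>z y. z \<in> frontier \<Omega> \<Longrightarrow> y \<in> frontier \<Omega> \<inter> ball z (r z) \<Longrightarrow> exterior_ball \<Omega> (\<rho> z) y"
    by metis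
  have "compact (frontier \<Omega>)" using \<Omega> by (simp add: compact_frontier_bounded)
  then obtain Z where Z: "Z \<subseteq> frontier \<Omega>" "finite Z" "frontier \<Omega> \<subseteq> (\<Union>z\<in>Z. ball z (r z))"
    using compactE_image[of "frontier \<Omega>" "frontier \<Omega>" "\<lambda>z. ball z (r z)"] r(1) by force
  \<comment> \<open>Inserting 1 keeps the minimum meaningful even for an empty cover.\<close>
  define \<rho>0 where "\<rho>0 = Min (insert 1 (\<rho> ` Z))"
  have "0 < \<rho>0" unfolding \<rho>0_def using Z r(2) by (subst Min_gr_iff) auto
  moreover have "exterior_ball \<Omega> \<rho>0 y" if y: "y \<in> frontier \<Omega>" for y
  proof -
    obtain z where z: "z \<in> Z" "y \<in> ball z (r z)" using Z(3) y by blast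
    have "exterior_ball \<Omega> (\<rho> z) y" using r(3)[of z y] z Z(1) y by blast
    moreover have "\<rho>0 \<le> \<rho> z" unfolding \<rho>0_def using Z(2) z(1) by (intro Min_le) auto
    ultimately show ?thesis using exterior_ball_mono \<open>0 < \<rho>0\<close> by blast
  qed
  ultimately show thesis using that by blast
qed

lemma closure_away_from_exterior_ball:
  assumes "open \<Omega>" "ball c r \<inter> \<Omega> = {}" "x \<in> closure \<Omega>"
  shows "r \<le> norm (x - c)"
proof (rule ccontr)
  assume "\<not> r \<le> norm (x - c)"
  then have "x \<in> ball c r" by (simp add: dist_norm norm_minus_commute)
  then show False using assms(2,3) open_Int_closure_eq_empty[of "ball c r" \<Omega>] by blast
qed

lemma boundary_point_toward_ball:
  fixes \<Omega> :: "'a::euclidean_space set"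
  assumes "open \<Omega>" "0 < r" "ball c r \<inter> \<Omega> = {}" "x \<in> closure \<Omega>"
  obtains w where "w \<in> frontier \<Omega>" "norm (x - w) \<le> norm (x - c) - r"
proof (cases "x \<in> \<Omega>")
  case False
  then have "x \<in> frontier \<Omega>" using assms by (simp add: frontier_def interior_open)
  then show thesis using that[of x] closure_away_from_exterior_ball[OF assms(1,3,4)] by simp
next
  case True
  have rx: "r \<le> norm (x - c)" by (rule closure_away_from_exterior_ball[OF assms(1,3,4)])
  define q where "q = c + (r / norm (x - c)) *\<^sub>R (x - c)"
  have pos: "0 < norm (x - c)" using rx assms(2) by linarith
  have "norm (q - c) = r" using pos assms(2) by (simp add: q_def)
  then have "q \<in> closure (ball c r)" using assms(2) by (simp add: dist_norm norm_minus_commute)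
  then have "q \<notin> \<Omega>" using assms(1,3) open_Int_closure_eq_empty[of \<Omega> "ball c r"] by blast
  have "closed_segment x q \<inter> frontier \<Omega> \<noteq> {}"
    by (rule connected_Int_frontier) (use True \<open>q \<notin> \<Omega>\<close> in auto)
  then obtain w where w: "w \<in> closed_segment x q" "w \<in> frontier \<Omega>" by blast
  have "norm (x - w) \<le> norm (x - q)" using segment_bound(1)[OF w(1)] by (simp add: norm_minus_commute)
  also have "x - q = (1 - r / norm (x - c)) *\<^sub>R (x - c)" by (simp add: q_def algebra_simps)
  also have "norm \<dots> = \<bar>1 - r / norm (x - c)\<bar> * norm (x - c)" by (rule norm_scaleR)
  also have "\<dots> = norm (x - c) - r" using pos rx by (simp add: abs_of_nonneg left_diff_distrib)
  finally show thesis using that w(2) by blast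
qed

section \<open>Supersolution inequality for the barrier\<close>

text \<open>The geometry enters only through the numbers \<rho>, \<open>D\<close> and the value
  \<open>F\<close> of the profile, so \<open>K\<close> is chosen before the boundary point, the
  radius \<open>r\<close> and the solution. For small \<open>D\<close> the nonlocal term wins; for
  the other \<open>D\<close> all losses are bounded and \<open>K\<close> pays for them.\<close>

lemma barrier_inequality:
  fixes b s p A r0 R \<kappa> \<eta>0 H C :: real
  assumes b: "0 < b" "b < s" and s: "s < 1" and p: "0 < p" and crit: "p - 2 * s < b * (p - 1)"
    and pos: "0 < A" "0 < r0" "r0 \<le> R" "0 < \<kappa>" "0 < \<eta>0" "0 \<le> H" "0 < C"
  obtains K where "0 < K"
    "\<And>D \<rho> F A'. r0 \<le> \<rho> \<Longrightarrow> \<rho> \<le> R \<Longrightarrow> 0 < D \<Longrightarrow> D \<le> R\<^sup>2 \<Longrightarrow> A \<le> A' \<Longrightarrow> A' \<le> 2 * A \<Longrightarrow> - H \<le> F \<Longrightarrow>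
      (D / (4 * \<rho>\<^sup>2) \<le> \<eta>0 \<Longrightarrow> \<kappa> \<le> F) \<Longrightarrow>
      0 < A * K * D powr b + C * (1/2 * (A' * D powr b * (D / (2 * \<rho>)) powr (- 2 * s) * F))
        - (A' * (b * D powr (b - 1)) * (2 * \<rho>)) powr p"
proof -
  have R: "0 < R" using pos by linarith
  \<comment> \<open>The amount by which the exponent \<open>(b - 1) * p\<close> of the gradient term
    exceeds the exponent \<open>b - 2 * s\<close> of the nonlocal term. It is positive exactly when
    \<open>b\<close> exceeds the critical exponent.\<close>
  define \<theta> where "\<theta> = (b - 1) * p - b + 2 * s"
  have \<theta>: "0 < \<theta>" using crit by (simp add: \<theta>_def algebra_simps)
  define c2 where "c2 = C / 2 * A * \<kappa> * (2 * r0) powr (2 * s)"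
  define c3 where "c3 = (4 * A * b * R) powr p"
  have c2: "0 < c2" and c3: "0 < c3" using pos b R by (auto simp: c2_def c3_def)
  \<comment> \<open>The first entry forces \<open>D / (4 * \<rho>\<^sup>2) \<le> \<eta>0\<close> for
    every \<open>\<rho> \<ge> r0\<close>. The second gives
    \<open>c3 * D powr \<theta> \<le> c2 / 2\<close>, and the half makes the comparison
    strict.\<close>
  define D1 where "D1 = min (4 * r0\<^sup>2 * \<eta>0) ((c2 / (2 * c3)) powr (1 / \<theta>))"
  have D1: "0 < D1" using pos c2 c3 by (simp add: D1_def)
  have D1_small: "c3 * D powr ((b - 1) * p) < c2 * D powr (b - 2 * s)" if D: "0 < D" "D \<le> D1" for D
  proof -
    have "D powr \<theta> \<le> ((c2 / (2 * c3)) powr (1 / \<theta>)) powr \<theta>"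
      using D \<theta> by (intro powr_mono2) (auto simp: D1_def)
    also have "\<dots> = c2 / (2 * c3)" using \<theta> c2 c3 by (simp add: powr_powr)
    finally have "c3 * D powr \<theta> \<le> c2 / 2" using c3 by (simp add: field_simps)
    then have "c3 * D powr \<theta> < c2" using c2 by linarith
    then have "c3 * D powr \<theta> * D powr (b - 2 * s) < c2 * D powr (b - 2 * s)"
      using D by (intro mult_strict_right_mono) auto
    moreover have "D powr \<theta> * D powr (b - 2 * s) = D powr ((b - 1) * p)"
      unfolding powr_add[symmetric] by (rule arg_cong[where f = "\<lambda>z. D powr z"]) (simp add: \<theta>_def)
    ultimately show ?thesis by (simp add: mult.assoc)
  qed
  \<comment> \<open>\<open>L2\<close> and \<open>L3\<close> bound what the nonlocal and the gradient
    term can take away when \<open>D > D1\<close>. Then \<open>K\<close> makes the time derivative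
    at \<open>D1\<close> equal to their sum plus 1, the 1 giving strictness.\<close>
  define L2 where "L2 = C * (A * R powr (2 * b) * (D1 / (2 * R)) powr (- 2 * s) * H)"
  define L3 where "L3 = c3 * D1 powr ((b - 1) * p)"
  define K where "K = (L2 + L3 + 1) / (A * D1 powr b)"
  have L: "0 \<le> L2" "0 \<le> L3" using pos c3 by (auto simp: L2_def L3_def)
  have K: "0 < K" using L pos D1 by (auto simp: K_def intro!: divide_pos_pos)
  show thesis
  proof (rule that[OF K])
    fix D \<rho> F A'
    assume \<rho>: "r0 \<le> \<rho>" "\<rho> \<le> R" and D: "0 < D" "D \<le> R\<^sup>2" and A': "A \<le> A'" "A' \<le> 2 * A"
      and F: "- H \<le> F" "D / (4 * \<rho>\<^sup>2) \<le> \<eta>0 \<Longrightarrow> \<kappa> \<le> F"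
    have \<rho>0: "0 < \<rho>" and A0: "0 < A'" using \<rho> A' pos by auto
    have third: "(A' * (b * D powr (b - 1)) * (2 * \<rho>)) powr p \<le> c3 * D powr ((b - 1) * p)"
    proof -
      have "A' * (b * D powr (b - 1)) * (2 * \<rho>) \<le> 2 * A * (b * D powr (b - 1)) * (2 * R)"
        using A' \<rho> \<rho>0 A0 b by (intro mult_mono) auto
      then have "(A' * (b * D powr (b - 1)) * (2 * \<rho>)) powr p \<le> (2 * A * (b * D powr (b - 1)) * (2 * R)) powr p"
        using A0 b \<rho>0 p by (intro powr_mono2) auto
      also have "2 * A * (b * D powr (b - 1)) * (2 * R) = (4 * A * b * R) * D powr (b - 1)" by simp
      also have "((4 * A * b * R) * D powr (b - 1)) powr p = c3 * D powr ((b - 1) * p)"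
        by (simp add: powr_mult powr_powr c3_def)
      finally show ?thesis .
    qed
    let ?I = "A' * D powr b * (D / (2 * \<rho>)) powr (- 2 * s) * F"
    show "0 < A * K * D powr b + C * (1/2 * ?I) - (A' * (b * D powr (b - 1)) * (2 * \<rho>)) powr p"
    proof (cases "D \<le> D1")
      case True
      have "D / (4 * \<rho>\<^sup>2) \<le> \<eta>0"
      proof -
        have "D \<le> 4 * r0\<^sup>2 * \<eta>0" using True by (simp add: D1_def)
        also have "\<dots> \<le> 4 * \<rho>\<^sup>2 * \<eta>0"
          using \<rho> pos by (intro mult_right_mono mult_left_mono power_mono) auto
        finally show ?thesis using \<rho>0 by (simp add: field_simps)
      qed
      then have \<kappa>: "\<kappa> \<le> F" by (rule F(2))
      have "(D / (2 * r0)) powr (- 2 * s) \<le> (D / (2 * \<rho>)) powr (- 2 * s)"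
        using D \<rho> \<rho>0 pos b by (intro powr_mono2' divide_left_mono) auto
      moreover have "(D / (2 * r0)) powr (- 2 * s) = D powr (- 2 * s) * (2 * r0) powr (2 * s)"
        using D pos powr_minus_divide[of "2 * r0" "2 * s"] by (simp add: powr_divide)
      ultimately have "A * D powr b * (D powr (- 2 * s) * (2 * r0) powr (2 * s)) * \<kappa> \<le> ?I"
        using A' \<kappa> pos by (intro mult_mono) auto
      moreover have "D powr b * D powr (- 2 * s) = D powr (b - 2 * s)"
        by (simp add: powr_add[symmetric])
      then have "c2 * D powr (b - 2 * s) = C * (1/2 * (A * D powr b * (D powr (- 2 * s) * (2 * r0) powr (2 * s)) * \<kappa>))"
        unfolding c2_def by (simp add: mult_ac)
      ultimately have "c2 * D powr (b - 2 * s) \<le> C * (1/2 * ?I)"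
        using pos by simp
      moreover have "0 \<le> A * K * D powr b" using pos K by simp
      ultimately show ?thesis using third D1_small[OF D(1) True] by linarith
    next
      case False
      have "D powr b \<le> R powr (2 * b)"
      proof -
        have "D powr b \<le> (R\<^sup>2) powr b" using D b by (intro powr_mono2) auto
        also have "\<dots> = R powr (2 * b)" using R by (simp add: powr_powr[symmetric])
        finally show ?thesis .
      qed
      moreover have "(D / (2 * \<rho>)) powr (- 2 * s) \<le> (D1 / (2 * R)) powr (- 2 * s)"
        using False D1 \<rho> \<rho>0 b by (intro powr_mono2' frac_le) auto
      ultimately have "A' * D powr b * (D / (2 * \<rho>)) powr (- 2 * s) * H \<le>
          (2 * A) * R powr (2 * b) * (D1 / (2 * R)) powr (- 2 * s) * H"
        using A' A0 pos by (intro mult_mono) auto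
      moreover have "A' * D powr b * (D / (2 * \<rho>)) powr (- 2 * s) * (- H) \<le> ?I"
        using F(1) A0 by (intro mult_left_mono) auto
      ultimately have "- ((2 * A) * R powr (2 * b) * (D1 / (2 * R)) powr (- 2 * s) * H) \<le> ?I"
        by simp
      then have "C * (1/2 * - ((2 * A) * R powr (2 * b) * (D1 / (2 * R)) powr (- 2 * s) * H)) \<le> C * (1/2 * ?I)"
        using pos by (intro mult_left_mono) auto
      then have second: "- L2 \<le> C * (1/2 * ?I)" unfolding L2_def by (simp add: mult_ac)
      have "(b - 1) * p \<le> 0" using b s p by (intro mult_nonpos_nonneg) auto
      then have "D powr ((b - 1) * p) \<le> D1 powr ((b - 1) * p)"
        using False D1 by (intro powr_mono2') auto
      then have third': "(A' * (b * D powr (b - 1)) * (2 * \<rho>)) powr p \<le> L3"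
        using third c3 unfolding L3_def by (meson mult_left_mono order_trans less_imp_le)
      have "A * K * D1 powr b \<le> A * K * D powr b"
        using False D1 b pos K by (intro mult_left_mono powr_mono2) auto
      moreover have "A * K * D1 powr b = L2 + L3 + 1"
        using pos D1 by (simp add: K_def)
      ultimately show ?thesis using second third' by linarith
    qed
  qed
qed

section \<open>Test functions\<close>

lemma test_function_quadratic:
  fixes x1 :: "real^'n"
  shows "test_function \<delta> x t (\<lambda>z. L * (norm (fst z - x1))\<^sup>2 + C * snd z)"
proof -
  have "bounded ((\<lambda>y. L * (norm (y - x1))\<^sup>2 + C * t) ` cball x \<delta>)"
    by (intro compact_imp_bounded compact_continuous_image continuous_intros) auto
  then have "bounded ((\<lambda>y. L * (norm (y - x1))\<^sup>2 + C * t) ` ball x \<delta>)"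
    by (rule bounded_subset) auto
  then show ?thesis
    unfolding test_function_def
    by (auto intro!: C2_on_add C2_on_cmult C2_on_dist_sq C2_on_snd)
qed

lemma E_visc_quadratic:
  fixes x1 :: "real^'n"
  shows "E_visc s p \<delta> v (\<lambda>z. L * (norm (fst z - x1))\<^sup>2 + C * snd z) x t =
    C + frac_op s (ball x \<delta>) (\<lambda>y. L * (norm (y - x1))\<^sup>2 + C * t) x
      + frac_op s (- ball x \<delta>) (\<lambda>y. v (y, t)) x - norm ((2 * L) *\<^sub>R (x - x1)) powr p"
proof -
  have "deriv (\<lambda>\<tau>. L * (norm (x - x1))\<^sup>2 + C * \<tau>) t = C"
    by (rule DERIV_imp_deriv) (auto intro!: derivative_eq_intros)
  moreover have "GDERIV (\<lambda>y. L * (norm (y - x1))\<^sup>2 + C * t) x :> L *\<^sub>R 2 *\<^sub>R (x - x1) + (norm (x - x1))\<^sup>2 *\<^sub>R 0 + 0"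
    by (intro GDERIV_add GDERIV_mult GDERIV_const GDERIV_dist_sq)
  then have "gradient (\<lambda>y. L * (norm (y - x1))\<^sup>2 + C * t) x = (2 * L) *\<^sub>R (x - x1)"
    by (intro gradient_eq) (simp add: mult.commute)
  ultimately show ?thesis by (simp add: E_visc_def)
qed

text \<open>The radius 1/2 is the threshold in \<open>sdiff_bound\<close>, so integrability here is
  inherited from its kernel.\<close>

definition quadratic_mass :: "'n::finite itself \<Rightarrow> real \<Rightarrow> real" where
  "quadratic_mass _ s = (\<integral>z. indicator (ball 0 (1/2)) z *
     ((norm (z :: real^'n))\<^sup>2 / norm z powr (real CARD('n) + 2 * s)) \<partial>lborel)"

definition tail_mass :: "'n::finite itself \<Rightarrow> real \<Rightarrow> real" where
  "tail_mass _ s = (\<integral>z. indicator (- ball 0 (1/2)) z *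
     (1 / norm (z :: real^'n) powr (real CARD('n) + 2 * s)) \<partial>lborel)"

lemma quadratic_mass_nonneg: "0 \<le> quadratic_mass TYPE('n::finite) s"
  unfolding quadratic_mass_def by (intro Bochner_Integration.integral_nonneg) auto

lemma tail_mass_nonneg: "0 \<le> tail_mass TYPE('n::finite) s"
  unfolding tail_mass_def by (intro Bochner_Integration.integral_nonneg) auto

text \<open>By the parallelogram law the second difference of a quadratic does not depend on the
  base point. This is why a single constant \<open>C\<close> can serve at a touching point whose
  position is unknown.\<close>

lemma frac_op_quadratic:
  fixes x x1 :: "real^'n"
  assumes s: "0 < s" "s < 1"
  shows "frac_op s (ball x (1/2)) (\<lambda>y. L * (norm (y - x1))\<^sup>2 + C) x =
    - (frac_const TYPE('n) s * L * quadratic_mass TYPE('n) s)"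
proof -
  let ?k = "real CARD('n) + 2 * s"
  let ?g = "\<lambda>y. L * (norm (y - x1))\<^sup>2 + C"
  have "bounded (?g ` cball x (1/2))"
    by (intro compact_imp_bounded compact_continuous_image continuous_intros) auto
  then obtain B where "\<forall>w\<in>?g ` cball x (1/2). norm w \<le> B"
    unfolding bounded_iff by blast
  then have B: "\<bar>?g y\<bar> \<le> B" if "y \<in> cball x (1/2)" for y using that by auto
  have k: "kernel_sdiff s ?g x z = - 2 * L * ((norm z)\<^sup>2 / norm z powr ?k)" for z
  proof -
    have "(norm (x + z - x1))\<^sup>2 + (norm (x - z - x1))\<^sup>2 = 2 * (norm (x - x1))\<^sup>2 + 2 * (norm z)\<^sup>2"
      unfolding power2_norm_eq_inner
      by (simp add: inner_add_left inner_add_right inner_diff_left inner_diff_right inner_commute)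
    then have "L * ((norm (x + z - x1))\<^sup>2 + (norm (x - z - x1))\<^sup>2) = L * (2 * (norm (x - x1))\<^sup>2 + 2 * (norm z)\<^sup>2)"
      by simp
    then have "2 * ?g x - ?g (x + z) - ?g (x - z) = - 2 * L * (norm z)\<^sup>2"
      by (simp add: algebra_simps)
    then show ?thesis unfolding kernel_sdiff_def by simp
  qed
  have int: "integrable lborel (\<lambda>z. indicator (ball 0 (1/2)) z * ((norm (z::real^'n))\<^sup>2 / norm z powr ?k))"
  proof (rule Bochner_Integration.integrable_bound)
    show "integrable lborel (\<lambda>z::real^'n. sdiff_bound (s/2) (norm z) / norm z powr ?k)"
      using integrable_sdiff_bound_kernel[of "s/2" s, where ?'a = "real^'n"] s by simp
    show "AE z in lborel. norm (indicator (ball 0 (1/2)) z * ((norm (z::real^'n))\<^sup>2 / norm z powr ?k)) \<le>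
        norm (sdiff_bound (s/2) (norm z) / norm z powr ?k)"
      by (intro always_eventually allI)
        (auto simp: indicator_def sdiff_bound_nonneg sdiff_bound_def intro!: divide_right_mono)
  qed measurable
  have "frac_op s (ball x (1/2)) ?g x =
    frac_const TYPE('n) s * (1/2 * (\<integral>z. indicator (ball 0 (1/2)) z * kernel_sdiff s ?g x z \<partial>lborel))"
  proof (rule frac_op_ball)
    show "\<bar>?g y\<bar> \<le> B" if "y \<in> ball x (1/2)" for y using B[of y] that by simp
    have "integrable lborel (\<lambda>z. (- 2 * L) * (indicator (ball 0 (1/2)) z * ((norm (z::real^'n))\<^sup>2 / norm z powr ?k)))"
      by (rule integrable_mult_right[OF int])
    then show "integrable lborel (\<lambda>z. indicator (ball 0 (1/2)) z * kernel_sdiff s ?g x z)"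
      unfolding k by (simp add: mult_ac)
  qed (use s in auto)
  also have "(\<integral>z. indicator (ball 0 (1/2)) z * kernel_sdiff s ?g x z \<partial>lborel) =
      (\<integral>z. (- 2 * L) * (indicator (ball 0 (1/2)) z * ((norm (z::real^'n))\<^sup>2 / norm z powr ?k)) \<partial>lborel)"
    unfolding k by (simp only: mult.left_commute)
  also have "\<dots> = (- 2 * L) * quadratic_mass TYPE('n) s"
    unfolding quadratic_mass_def by (rule integral_mult_right_zero)
  finally show ?thesis by simp
qed

lemma frac_op_outside_bound:
  fixes v :: "real^'n \<Rightarrow> real"
  assumes v [measurable]: "v \<in> borel_measurable borel" and s: "0 < s" "s < 1" and B: "\<And>y. \<bar>v y\<bar> \<le> B"
  shows "\<bar>frac_op s (- ball x (1/2)) v x\<bar> \<le> frac_const TYPE('n) s * (2 * B * tail_mass TYPE('n) s)"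
proof -
  let ?k = "real CARD('n) + 2 * s"
  let ?J = "set_lebesgue_integral lebesgue (- ball x (1/2)) (\<lambda>y. (v x - v y) / norm (x - y) powr ?k)"
  have diff: "\<bar>v x - v (x + z)\<bar> \<le> 2 * B" for z using B[of x] B[of "x + z"] by linarith
  have "?J = (\<integral>y. indicator (- ball x (1/2)) y * ((v x - v y) / norm (x - y) powr ?k) \<partial>lborel)"
    unfolding set_lebesgue_integral_def by (subst integral_completion) auto
  also have "\<dots> = (\<integral>z. indicator (- ball 0 (1/2)) z * ((v x - v (x + z)) / norm z powr ?k) \<partial>lborel)"
    by (subst integral_affine[of _ 1 x])
      (auto simp: indicator_def dist_norm intro!: Bochner_Integration.integral_cong)
  also have "\<bar>\<dots>\<bar> \<le> (\<integral>z. \<bar>indicator (- ball 0 (1/2)) z * ((v x - v (x + z)) / norm z powr ?k)\<bar> \<partial>lborel)"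
    by (rule integral_abs_bound)
  also have "\<dots> \<le> (\<integral>z. (2 * B) * (indicator (- ball 0 (1/2)) z * (1 / norm (z::real^'n) powr ?k)) \<partial>lborel)"
  proof (rule integral_mono)
    show "integrable lborel (\<lambda>z. \<bar>indicator (- ball 0 (1/2)) z * ((v x - v (x + z)) / norm z powr ?k)\<bar>)"
      by (intro integrable_abs integrable_outside_bounded[where C = "2 * B"]) (use s diff in auto)
    show "integrable lborel (\<lambda>z. (2 * B) * (indicator (- ball 0 (1/2)) z * (1 / norm (z::real^'n) powr ?k)))"
      by (intro integrable_mult_right integrable_outside_bounded[where C = 1]) (use s in auto)
    show "\<bar>indicator (- ball 0 (1/2)) z * ((v x - v (x + z)) / norm z powr ?k)\<bar> \<le>
        (2 * B) * (indicator (- ball 0 (1/2)) z * (1 / norm (z::real^'n) powr ?k))" for z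
      using diff[of z] by (auto simp: indicator_def intro!: divide_right_mono)
  qed
  also have "\<dots> = 2 * B * tail_mass TYPE('n) s"
    unfolding tail_mass_def by (rule integral_mult_right_zero)
  finally have "\<bar>?J\<bar> \<le> 2 * B * tail_mass TYPE('n) s" .
  then have "frac_const TYPE('n) s * \<bar>?J\<bar> \<le> frac_const TYPE('n) s * (2 * B * tail_mass TYPE('n) s)"
    using frac_const_pos[OF s, where ?'n = 'n] by (intro mult_left_mono) auto
  moreover have "\<bar>frac_op s (- ball x (1/2)) v x\<bar> = frac_const TYPE('n) s * \<bar>?J\<bar>"
    using frac_op_outside[of "1/2" s x v] frac_const_pos[OF s, where ?'n = 'n] by (simp add: abs_mult)
  ultimately show ?thesis by simp
qed

section \<open>The barrier as a test function\<close>

lemma barrier_pos: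
  assumes "0 < r" "r < norm (y - c)"
  shows "0 < (norm (y - c))\<^sup>2 - r\<^sup>2"
  using assms by (simp add: power_strict_mono)

lemma continuous_on_barrier: "0 < b \<Longrightarrow> continuous_on S (barrier b c r)"
  unfolding barrier_def[abs_def] by (intro continuous_intros)

text \<open>The radius keeps the ball away from the sphere \<open>norm (y - c) = r\<close>, where
  the positive part fails to be smooth.\<close>

lemma test_function_barrier:
  assumes b: "0 < b" and r: "0 < r" and \<delta>: "\<delta> \<le> norm (x - c) - r"
  shows "test_function \<delta> x t (\<lambda>z. A * (1 + K * snd z) * barrier b c r (fst z))"
proof -
  have far: "r < norm (y - c)" if "y \<in> ball x \<delta>" for y
  proof -
    have "norm (x - c) \<le> norm (x - y) + norm (y - c)"
      using norm_triangle_ineq[of "x - y" "y - c"] by simp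
    then show ?thesis using that \<delta> by (simp add: dist_norm)
  qed
  have "C2_on (cylinder \<delta> x t) (\<lambda>z. A * (1 + K * snd z) * ((norm (fst z - c))\<^sup>2 + (- (r\<^sup>2))) powr b)"
    using barrier_pos[OF r far]
    by (intro C2_on_mult C2_on_cmult C2_on_add C2_on_const C2_on_snd C2_on_powr C2_on_dist_sq)
      (auto simp: cylinder_def)
  then have "C2_on (cylinder \<delta> x t) (\<lambda>z. A * (1 + K * snd z) * barrier b c r (fst z))"
    by (rule C2_on_cong[OF _ open_cylinder])
      (use barrier_pos[OF r far] in \<open>auto simp: cylinder_def barrier_def pospow_pos_eq\<close>)
  moreover have "bounded ((\<lambda>y. A * (1 + K * t) * barrier b c r y) ` cball x \<delta>)"
    using b by (intro compact_imp_bounded compact_continuous_image continuous_on_mult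
        continuous_on_const continuous_on_barrier) auto
  then have "bounded ((\<lambda>y. A * (1 + K * t) * barrier b c r y) ` ball x \<delta>)"
    by (rule bounded_subset) auto
  ultimately show ?thesis unfolding test_function_def by simp
qed

lemma DERIV_pospow:
  assumes "0 < x"
  shows "(pospow b has_real_derivative b * x powr (b - 1)) (at x)"
proof -
  have "((\<lambda>x. x powr b) has_real_derivative b * x powr (b - 1)) (at x)"
    using assms by (auto intro!: derivative_eq_intros)
  then show ?thesis
    by (rule has_field_derivative_transform_within_open[where S = "{0<..}"])
      (use assms in \<open>auto simp: pospow_pos_eq\<close>)
qed

lemma E_visc_barrier:
  assumes r: "0 < r" "r < norm (x - c)" and a: "0 \<le> A * (1 + K * t)" "0 < b"
  defines "D \<equiv> (norm (x - c))\<^sup>2 - r\<^sup>2"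
  shows "E_visc s p \<delta> v (\<lambda>z. A * (1 + K * snd z) * barrier b c r (fst z)) x t =
    A * K * D powr b + (frac_op s (ball x \<delta>) (\<lambda>y. A * (1 + K * t) * barrier b c r y) x
      + frac_op s (- ball x \<delta>) (\<lambda>y. v (y, t)) x)
      - (A * (1 + K * t) * (b * D powr (b - 1)) * (2 * norm (x - c))) powr p"
proof -
  have D: "0 < D" using barrier_pos[OF r] by (simp add: D_def)
  have "deriv (\<lambda>\<tau>. A * (1 + K * \<tau>) * barrier b c r x) t = A * K * D powr b"
    by (rule DERIV_imp_deriv)
      (use D in \<open>auto intro!: derivative_eq_intros simp: barrier_def D_def[symmetric] pospow_pos_eq\<close>)
  moreover have "gradient (\<lambda>y. A * (1 + K * t) * barrier b c r y) x =
      (A * (1 + K * t) * (b * D powr (b - 1))) *\<^sub>R 2 *\<^sub>R (x - c)"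
  proof (rule gradient_eq)
    have "GDERIV (\<lambda>y. (norm (y - c))\<^sup>2 - r\<^sup>2) x :> 2 *\<^sub>R (x - c) - 0"
      by (intro GDERIV_diff GDERIV_const GDERIV_dist_sq)
    then have "GDERIV (barrier b c r) x :> (b * D powr (b - 1)) *\<^sub>R 2 *\<^sub>R (x - c)"
      unfolding barrier_def[abs_def]
      using DERIV_pospow[OF D, of b] unfolding D_def
      by (intro GDERIV_DERIV_compose[where f = "\<lambda>y. (norm (y - c))\<^sup>2 - r\<^sup>2" and g = "pospow b"]) simp_all
    then have "GDERIV (\<lambda>y. A * (1 + K * t) * barrier b c r y) x :>
       (A * (1 + K * t)) *\<^sub>R ((b * D powr (b - 1)) *\<^sub>R 2 *\<^sub>R (x - c)) + barrier b c r x *\<^sub>R 0"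
      by (intro GDERIV_mult GDERIV_const)
    then show "GDERIV (\<lambda>y. A * (1 + K * t) * barrier b c r y) x :>
       (A * (1 + K * t) * (b * D powr (b - 1))) *\<^sub>R 2 *\<^sub>R (x - c)"
      by (simp add: mult.assoc)
  qed
  moreover have "norm ((A * (1 + K * t) * (b * D powr (b - 1))) *\<^sub>R 2 *\<^sub>R (x - c)) =
      A * (1 + K * t) * (b * D powr (b - 1)) * (2 * norm (x - c))"
  proof -
    have "0 \<le> A * (1 + K * t) * (b * D powr (b - 1))"
      by (rule mult_nonneg_nonneg[OF a(1)]) (use a(2) in simp)
    then show ?thesis by (simp only: norm_scaleR abs_of_nonneg abs_numeral)
  qed
  ultimately show ?thesis by (simp only: E_visc_def fst_conv snd_conv add.assoc)
qed

text \<open>The factor \<open>norm (x - c) / \<delta> + 1\<close> makes both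
  \<open>norm (x - c)\<close> and \<open>norm (x + z - c)\<close> at most a multiple of
  \<open>norm z\<close> once \<open>norm z \<ge> \<delta>\<close>. The barrier then grows like
  \<open>norm z powr (2 * b)\<close>, which \<open>integrable_kernel_outside\<close> admits.\<close>

lemma barrier_growth:
  assumes b: "0 < b" and \<delta>: "0 < \<delta>" "\<delta> \<le> norm z" and a: "0 \<le> a"
  shows "\<bar>a * barrier b c r x - a * barrier b c r (x + z)\<bar> \<le>
    a * (norm (x - c) / \<delta> + 1) powr (2 * b) * norm z powr (2 * b)"
proof -
  define q where "q = norm (x - c) / \<delta> + 1"
  have le: "norm (x - c) + norm z \<le> q * norm z"
  proof -
    have "norm (x - c) / \<delta> * \<delta> \<le> norm (x - c) / \<delta> * norm z"
      using \<delta> by (intro mult_left_mono) auto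
    then show ?thesis using \<delta> by (simp add: q_def distrib_right)
  qed
  have q: "0 \<le> q" using \<delta> by (simp add: q_def)
  have bound: "barrier b c r y \<le> q powr (2 * b) * norm z powr (2 * b)" if "norm (y - c) \<le> q * norm z" for y
  proof -
    have "barrier b c r y \<le> pospow b ((q * norm z)\<^sup>2)"
      unfolding barrier_def using that b power_mono[OF that, of 2]
      by (intro pospow_mono) (auto simp: diff_le_eq add_increasing2)
    also have "\<dots> = ((q * norm z) powr 2) powr b"
      using q by (simp add: pospow_def)
    also have "\<dots> = q powr (2 * b) * norm z powr (2 * b)"
      using q by (simp only: powr_powr powr_mult norm_ge_zero)
    finally show ?thesis .
  qed
  have "norm (x - c) \<le> q * norm z" "norm (x + z - c) \<le> q * norm z"
  proof -
    show "norm (x - c) \<le> q * norm z" using le norm_ge_zero[of z] by linarith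
    have "norm ((x - c) + z) \<le> q * norm z" using norm_triangle_ineq[of "x - c" z] le by linarith
    then show "norm (x + z - c) \<le> q * norm z" by (simp add: algebra_simps)
  qed
  then have 1: "barrier b c r x \<le> q powr (2 * b) * norm z powr (2 * b)"
    "barrier b c r (x + z) \<le> q powr (2 * b) * norm z powr (2 * b)"
    by (auto intro: bound)
  have "0 \<le> barrier b c r x" "0 \<le> barrier b c r (x + z)" by (auto simp: barrier_def)
  with 1 have "\<bar>barrier b c r x - barrier b c r (x + z)\<bar> \<le> q powr (2 * b) * norm z powr (2 * b)"
    by linarith
  then have "a * \<bar>barrier b c r x - barrier b c r (x + z)\<bar> \<le> a * (q powr (2 * b) * norm z powr (2 * b))"
    using a by (rule mult_left_mono)
  then show ?thesis using a by (simp add: q_def abs_mult mult.assoc flip: right_diff_distrib)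
qed

section \<open>Touching a continuous solution with test functions\<close>

text \<open>Together with its lower counterpart this removes the envelopes from the definition of a
  solution, since the global solution is continuous up to the boundary.\<close>

lemma usc_envelope_eq:
  fixes u :: "'a::metric_space \<Rightarrow> real"
  assumes cont: "continuous_on S u" and bdd: "bounded (u ` S)" and z: "z \<in> S"
  shows "usc_envelope S u z = u z"
proof (rule antisym)
  have bdd': "bdd_above (u ` (S \<inter> ball z r))" for r
    using bdd by (meson bdd_above_mono bounded_imp_bdd_above image_mono inf_le1)
  have ge: "u z \<le> (SUP w\<in>S \<inter> ball z r. u w)" if "0 < r" for r
    using that z by (intro cSUP_upper bdd') auto
  show "u z \<le> usc_envelope S u z"
    unfolding usc_envelope_def by (intro cINF_greatest) (auto intro: ge)
  show "usc_envelope S u z \<le> u z"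
  proof (rule field_le_epsilon)
    fix e :: real assume "0 < e"
    then obtain r where r: "0 < r" "\<And>w. w \<in> S \<Longrightarrow> dist w z < r \<Longrightarrow> dist (u w) (u z) < e"
      using cont z unfolding continuous_on_iff by metis
    have "usc_envelope S u z \<le> (SUP w\<in>S \<inter> ball z r. u w)"
      unfolding usc_envelope_def using r(1) ge by (intro cINF_lower bdd_belowI2[where m = "u z"]) auto
    also have "\<dots> \<le> u z + e"
    proof (rule cSUP_least)
      show "S \<inter> ball z r \<noteq> {}" using z r(1) by force
      show "u w \<le> u z + e" if "w \<in> S \<inter> ball z r" for w
        using r(2)[of w] that by (auto simp: dist_commute dist_real_def)
    qed
    finally show "usc_envelope S u z \<le> u z + e" .
  qed
qed

lemma lsc_envelope_eq:
  fixes u :: "'a::metric_space \<Rightarrow> real"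
  assumes cont: "continuous_on S u" and bdd: "bounded (u ` S)" and z: "z \<in> S"
  shows "lsc_envelope S u z = u z"
proof (rule antisym)
  have bdd': "bdd_below (u ` (S \<inter> ball z r))" for r
    using bdd by (meson bdd_below_mono bounded_imp_bdd_below image_mono inf_le1)
  have le: "(INF w\<in>S \<inter> ball z r. u w) \<le> u z" if "0 < r" for r
    using that z by (intro cINF_lower bdd') auto
  show "lsc_envelope S u z \<le> u z"
    unfolding lsc_envelope_def by (intro cSUP_least) (auto intro: le)
  show "u z \<le> lsc_envelope S u z"
  proof (rule field_le_epsilon)
    fix e :: real assume "0 < e"
    then obtain r where r: "0 < r" "\<And>w. w \<in> S \<Longrightarrow> dist w z < r \<Longrightarrow> dist (u w) (u z) < e"
      using cont z unfolding continuous_on_iff by metis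
    have "u z - e \<le> (INF w\<in>S \<inter> ball z r. u w)"
    proof (rule cINF_greatest)
      show "S \<inter> ball z r \<noteq> {}" using z r(1) by force
      show "u z - e \<le> u w" if "w \<in> S \<inter> ball z r" for w
        using r(2)[of w] that by (auto simp: dist_commute dist_real_def)
    qed
    also have "\<dots> \<le> lsc_envelope S u z"
      unfolding lsc_envelope_def using r(1) le by (intro cSUP_upper bdd_aboveI2[where M = "u z"]) auto
    finally show "u z \<le> lsc_envelope S u z + e" by simp
  qed
qed

locale continuous_solution =
  fixes \<Omega> :: "(real^'n) set" and s p :: real and u0 :: "real^'n \<Rightarrow> real"
    and u :: "(real^'n) \<times> real \<Rightarrow> real"
  assumes \<Omega>: "open \<Omega>" "bounded \<Omega>" and s: "0 < s" "s < 1" and p: "0 < p"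
    and sol: "global_visc_solution \<Omega> s p u0 u"
    and u0_nonneg: "\<And>x. x \<in> closure \<Omega> \<Longrightarrow> 0 \<le> u0 x"
    and u0_cont: "continuous_on (closure \<Omega>) u0"
begin

lemma cont_u: "continuous_on (closure \<Omega> \<times> {0..T}) u"
  using sol unfolding global_visc_solution_def by (auto intro: continuous_on_subset)

lemma compact_cyl: "compact (closure \<Omega> \<times> {0..T::real})"
  using \<Omega> by (intro compact_Times compact_Icc) (simp add: compact_closure)

lemma bounded_u: "bounded (u ` (closure \<Omega> \<times> {0..T}))"
  by (intro compact_imp_bounded compact_continuous_image cont_u compact_cyl)

lemma frontier_iff: "x \<in> frontier \<Omega> \<longleftrightarrow> x \<in> closure \<Omega> \<and> x \<notin> \<Omega>"
  using \<Omega> by (simp add: frontier_def interior_open)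

lemma closure_iff: "x \<in> closure \<Omega> \<longleftrightarrow> x \<in> \<Omega> \<or> x \<in> frontier \<Omega>"
  using frontier_iff closure_subset by blast

lemma measurable_slice:
  assumes "0 \<le> t"
  shows "(\<lambda>y. upper_ext \<Omega> u (y, t)) \<in> borel_measurable borel"
    and "(\<lambda>y. lower_ext \<Omega> u (y, t)) \<in> borel_measurable borel"
proof -
  define f where "f y = indicator (closure \<Omega>) y *\<^sub>R u (y, t)" for y
  have "continuous_on (closure \<Omega>) (\<lambda>y. u (y, t))"
    using assms by (intro continuous_on_compose2[OF cont_u[of t]] continuous_intros) auto
  then have [measurable]: "f \<in> borel_measurable borel"
    unfolding f_def by (intro borel_measurable_continuous_on_indicator) auto
  have [measurable]: "\<Omega> \<in> sets borel" "frontier \<Omega> \<in> sets borel" using \<Omega> by auto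
  have "(\<lambda>y. upper_ext \<Omega> u (y, t)) =
      (\<lambda>y. if y \<in> \<Omega> then f y else if y \<in> frontier \<Omega> then max (f y) 0 else 0)"
    "(\<lambda>y. lower_ext \<Omega> u (y, t)) =
      (\<lambda>y. if y \<in> \<Omega> then f y else if y \<in> frontier \<Omega> then min (f y) 0 else 0)"
    by (auto simp: fun_eq_iff upper_ext_def lower_ext_def f_def closure_iff)
  then show "(\<lambda>y. upper_ext \<Omega> u (y, t)) \<in> borel_measurable borel"
    "(\<lambda>y. lower_ext \<Omega> u (y, t)) \<in> borel_measurable borel" by simp_all
qed

lemma bounded_slices:
  obtains B where "0 < B" "\<And>y t. t \<in> {0..T} \<Longrightarrow> \<bar>upper_ext \<Omega> u (y, t)\<bar> \<le> B"
    "\<And>y t. t \<in> {0..T} \<Longrightarrow> \<bar>lower_ext \<Omega> u (y, t)\<bar> \<le> B"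
    "\<And>y t. y \<in> closure \<Omega> \<Longrightarrow> t \<in> {0..T} \<Longrightarrow> \<bar>u (y, t)\<bar> \<le> B"
proof -
  obtain B where B: "0 < B" "\<forall>w\<in>u ` (closure \<Omega> \<times> {0..T}). norm w \<le> B"
    using bounded_u[of T] unfolding bounded_pos by blast
  then have B': "\<bar>u (y, t)\<bar> \<le> B" if "y \<in> closure \<Omega>" "t \<in> {0..T}" for y t using that by auto
  show thesis
  proof (rule that[OF B(1) _ _ B'])
    fix y t assume t: "t \<in> {0..T}"
    show "\<bar>upper_ext \<Omega> u (y, t)\<bar> \<le> B" "\<bar>lower_ext \<Omega> u (y, t)\<bar> \<le> B"
      using B'[OF _ t, of y] B(1) by (auto simp: upper_ext_def lower_ext_def closure_iff abs_le_iff)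
  qed auto
qed

lemma E_visc_cong: "(\<And>y. v (y, t) = w (y, t)) \<Longrightarrow> E_visc s p \<delta> v \<phi> x t = E_visc s p \<delta> w \<phi> x t"
  unfolding E_visc_def by simp

text \<open>From \<open>0 \<le> \<phi> < u\<close> at the touching point \<open>u\<close> is
  positive there, which rules out the alternative \<open>u \<le> 0\<close> on the boundary;
  \<open>init\<close> rules out the one at time zero. Nonnegativity of \<phi> also makes the maximum
  global, as the extension vanishes outside the closure, and the second conclusion records this for
  the nonlocal term.\<close>

lemma E_visc_touch_above:
  assumes T: "0 < T" and x: "x \<in> closure \<Omega>" and t: "t \<in> {0..T}" and \<delta>: "0 < \<delta>"
    and \<phi>: "test_function \<delta> x t \<phi>"
    and max: "\<And>y \<tau>. y \<in> closure \<Omega> \<Longrightarrow> \<tau> \<in> {0..T} \<Longrightarrow> u (y, \<tau>) - \<phi> (y, \<tau>) \<le> u (x, t) - \<phi> (x, t)"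
    and nonneg: "\<And>y \<tau>. \<tau> \<in> {0..T} \<Longrightarrow> 0 \<le> \<phi> (y, \<tau>)"
    and pos: "\<phi> (x, t) < u (x, t)" and init: "t = 0 \<Longrightarrow> u0 x < u (x, 0)"
  shows "E_visc s p \<delta> (upper_ext \<Omega> u) \<phi> x t \<le> 0"
    and "\<And>y. \<phi> (x, t) - \<phi> (y, t) \<le> upper_ext \<Omega> u (x, t) - upper_ext \<Omega> u (y, t)"
proof -
  let ?S = "closure \<Omega> \<times> {0..T}"
  have env: "usc_envelope ?S u (y, \<tau>) = u (y, \<tau>)" if "y \<in> closure \<Omega>" "\<tau> \<in> {0..T}" for y \<tau>
    using that by (intro usc_envelope_eq cont_u bounded_u) auto
  have ext: "upper_ext \<Omega> (usc_envelope ?S u) (y, \<tau>) = upper_ext \<Omega> u (y, \<tau>)" if "\<tau> \<in> {0..T}" for y \<tau>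
    using env[OF _ that, of y] by (auto simp: upper_ext_def closure_iff)
  have ux: "0 < u (x, t)" using nonneg[OF t, of x] pos by linarith
  then have ext_x: "upper_ext \<Omega> u (x, t) = u (x, t)"
    using x by (auto simp: upper_ext_def closure_iff)
  have le: "upper_ext \<Omega> u (y, \<tau>) - \<phi> (y, \<tau>) \<le> upper_ext \<Omega> u (x, t) - \<phi> (x, t)" if "\<tau> \<in> {0..T}" for y \<tau>
    using max[OF _ that, of y] nonneg[OF that, of y] pos unfolding ext_x
    by (auto simp: upper_ext_def closure_iff)
  show "\<phi> (x, t) - \<phi> (y, t) \<le> upper_ext \<Omega> u (x, t) - upper_ext \<Omega> u (y, t)" for y
    using le[OF t, of y] by linarith
  have mp: "max_point T \<delta> (\<lambda>z. upper_ext \<Omega> (usc_envelope ?S u) z - \<phi> z) x t"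
    unfolding max_point_def using le t by (auto simp: ext)
  have "visc_subsolution \<Omega> s p u0 T (usc_envelope ?S u)"
    using sol T unfolding global_visc_solution_def visc_solution_def by blast
  then have *: "(x \<in> \<Omega> \<and> 0 < t \<longrightarrow> E_visc s p \<delta> (upper_ext \<Omega> (usc_envelope ?S u)) \<phi> x t \<le> 0) \<and>
     (x \<in> frontier \<Omega> \<and> 0 < t \<longrightarrow> min (E_visc s p \<delta> (upper_ext \<Omega> (usc_envelope ?S u)) \<phi> x t) (usc_envelope ?S u (x, t)) \<le> 0) \<and>
     (t = 0 \<longrightarrow> min (E_visc s p \<delta> (upper_ext \<Omega> (usc_envelope ?S u)) \<phi> x t) (usc_envelope ?S u (x, t) - u0 x) \<le> 0)"
    using \<delta> x t \<phi> mp unfolding visc_subsolution_def by blast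
  have E: "E_visc s p \<delta> (upper_ext \<Omega> (usc_envelope ?S u)) \<phi> x t = E_visc s p \<delta> (upper_ext \<Omega> u) \<phi> x t"
    by (rule E_visc_cong) (rule ext[OF t])
  show "E_visc s p \<delta> (upper_ext \<Omega> u) \<phi> x t \<le> 0"
    using * ux init x t unfolding E env[OF x t] by (cases "t = 0") (auto simp: closure_iff min_le_iff_disj)
qed

text \<open>The mirror image of \<open>E_visc_touch_above\<close>. The test functions used here may
  be negative, so the comparison outside \<Omega> and the sign on the boundary are separate
  hypotheses.\<close>

lemma E_visc_touch_below:
  assumes T: "0 < T" and x: "x \<in> closure \<Omega>" and t: "t \<in> {0..T}" and \<delta>: "0 < \<delta>"
    and \<phi>: "test_function \<delta> x t \<phi>"
    and min: "\<And>y \<tau>. y \<in> \<Omega> \<Longrightarrow> \<tau> \<in> {0..T} \<Longrightarrow> u (x, t) - \<phi> (x, t) \<le> u (y, \<tau>) - \<phi> (y, \<tau>)"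
    and out: "\<And>y \<tau>. y \<notin> \<Omega> \<Longrightarrow> \<tau> \<in> {0..T} \<Longrightarrow> u (x, t) - \<phi> (x, t) \<le> lower_ext \<Omega> u (y, \<tau>) - \<phi> (y, \<tau>)"
    and neg: "x \<in> frontier \<Omega> \<Longrightarrow> u (x, t) < 0" and init: "t = 0 \<Longrightarrow> u (x, 0) < u0 x"
  shows "0 \<le> E_visc s p \<delta> (lower_ext \<Omega> u) \<phi> x t"
    and "\<And>y. lower_ext \<Omega> u (x, t) - lower_ext \<Omega> u (y, t) \<le> \<phi> (x, t) - \<phi> (y, t)"
proof -
  let ?S = "closure \<Omega> \<times> {0..T}"
  have env: "lsc_envelope ?S u (y, \<tau>) = u (y, \<tau>)" if "y \<in> closure \<Omega>" "\<tau> \<in> {0..T}" for y \<tau>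
    using that by (intro lsc_envelope_eq cont_u bounded_u) auto
  have ext: "lower_ext \<Omega> (lsc_envelope ?S u) (y, \<tau>) = lower_ext \<Omega> u (y, \<tau>)" if "\<tau> \<in> {0..T}" for y \<tau>
    using env[OF _ that, of y] by (auto simp: lower_ext_def closure_iff)
  have ext_x: "lower_ext \<Omega> u (x, t) = u (x, t)"
    using x neg by (auto simp: lower_ext_def closure_iff)
  have le: "lower_ext \<Omega> u (x, t) - \<phi> (x, t) \<le> lower_ext \<Omega> u (y, \<tau>) - \<phi> (y, \<tau>)" if "\<tau> \<in> {0..T}" for y \<tau>
    unfolding ext_x using min[OF _ that, of y] out[OF _ that, of y]
    by (cases "y \<in> \<Omega>") (auto simp: lower_ext_def)
  show "lower_ext \<Omega> u (x, t) - lower_ext \<Omega> u (y, t) \<le> \<phi> (x, t) - \<phi> (y, t)" for y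
    using le[OF t, of y] by linarith
  have mp: "min_point T \<delta> (\<lambda>z. lower_ext \<Omega> (lsc_envelope ?S u) z - \<phi> z) x t"
    unfolding min_point_def using le t by (auto simp: ext)
  have "visc_supersolution \<Omega> s p u0 T (lsc_envelope ?S u)"
    using sol T unfolding global_visc_solution_def visc_solution_def by blast
  then have *: "(x \<in> \<Omega> \<and> 0 < t \<longrightarrow> E_visc s p \<delta> (lower_ext \<Omega> (lsc_envelope ?S u)) \<phi> x t \<ge> 0) \<and>
     (x \<in> frontier \<Omega> \<and> 0 < t \<longrightarrow> max (E_visc s p \<delta> (lower_ext \<Omega> (lsc_envelope ?S u)) \<phi> x t) (lsc_envelope ?S u (x, t)) \<ge> 0) \<and>
     (t = 0 \<longrightarrow> max (E_visc s p \<delta> (lower_ext \<Omega> (lsc_envelope ?S u)) \<phi> x t) (lsc_envelope ?S u (x, t) - u0 x) \<ge> 0)"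
    using \<delta> x t \<phi> mp unfolding visc_supersolution_def by blast
  have E: "E_visc s p \<delta> (lower_ext \<Omega> (lsc_envelope ?S u)) \<phi> x t = E_visc s p \<delta> (lower_ext \<Omega> u) \<phi> x t"
    by (rule E_visc_cong) (rule ext[OF t])
  show "0 \<le> E_visc s p \<delta> (lower_ext \<Omega> u) \<phi> x t"
    using * neg init x t unfolding E env[OF x t] by (cases "t = 0") (auto simp: closure_iff le_max_iff_disj)
qed

section \<open>Sign of the solution and the initial condition\<close>

text \<open>The test function depends on time only, with slope \<open>C < 0\<close>. At a negative
  global minimum the gradient term and the nonlocal term inside the ball vanish, and the nonlocal
  term outside is nonpositive, so \<open>E_visc\<close> is at most \<open>C\<close>.\<close>

lemma solution_nonneg:
  assumes "x1 \<in> closure \<Omega>" "0 \<le> t1"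
  shows "0 \<le> u (x1, t1)"
proof (rule ccontr)
  assume "\<not> 0 \<le> u (x1, t1)"
  then have neg: "u (x1, t1) < 0" by simp
  define T where "T = t1 + 1"
  \<comment> \<open>Over \<open>[0, T]\<close> the function \<open>C * t\<close> falls only to half
    of the negative value, so the minimum of \<open>u - \<phi>\<close> stays negative. Taking
    \<open>T = t1 + 1\<close> keeps \<open>T\<close> positive when \<open>t1 = 0\<close>.\<close>
  define C where "C = u (x1, t1) / (2 * T)"
  have T: "0 < T" "t1 \<in> {0..T}" using assms by (auto simp: T_def)
  have C: "C < 0" using neg T by (simp add: C_def divide_neg_pos)
  define \<phi> where "\<phi> z = 0 * (norm (fst z - x1))\<^sup>2 + C * snd z" for z :: "(real^'n) \<times> real"
  have "continuous_on (closure \<Omega> \<times> {0..T}) (\<lambda>z. u z - \<phi> z)"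
    unfolding \<phi>_def by (intro continuous_intros cont_u)
  then obtain z where z: "z \<in> closure \<Omega> \<times> {0..T}" "\<And>w. w \<in> closure \<Omega> \<times> {0..T} \<Longrightarrow> u z - \<phi> z \<le> u w - \<phi> w"
    using continuous_attains_inf[OF compact_cyl, of T "\<lambda>z. u z - \<phi> z"] assms T by force
  obtain x t where xt: "z = (x, t)" by force
  have x: "x \<in> closure \<Omega>" and t: "t \<in> {0..T}" using z xt by auto
  have m: "u (x, t) - C * t < 0"
  proof -
    have "u (x, t) - C * t \<le> u (x1, t1) - C * t1"
      using z(2)[of "(x1, t1)"] assms T by (simp add: xt \<phi>_def)
    also have "C * t1 \<ge> C * T" using C by (intro mult_left_mono_neg) (auto simp: T_def)
    then have "u (x1, t1) - C * t1 \<le> u (x1, t1) - C * T" by simp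
    also have "C * T = u (x1, t1) / 2" using T by (simp add: C_def)
    finally show ?thesis using neg by simp
  qed
  have Ct: "C * \<tau> \<le> 0" if "\<tau> \<in> {0..T}" for \<tau>
    using C that by (intro mult_nonpos_nonneg) auto
  have ux: "u (x, t) < 0" using m Ct[OF t] by linarith
  have min: "u (x, t) - \<phi> (x, t) \<le> u (y, \<tau>) - \<phi> (y, \<tau>)" if "y \<in> closure \<Omega>" "\<tau> \<in> {0..T}" for y \<tau>
    using z(2)[of "(y, \<tau>)"] that xt by simp
  have out: "u (x, t) - \<phi> (x, t) \<le> lower_ext \<Omega> u (y, \<tau>) - \<phi> (y, \<tau>)" if "y \<notin> \<Omega>" "\<tau> \<in> {0..T}" for y \<tau>
    using min[of y \<tau>] that m Ct[OF that(2)]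
    by (auto simp: lower_ext_def closure_iff \<phi>_def min_def)
  have test: "test_function 1 x t \<phi>" unfolding \<phi>_def[abs_def] by (rule test_function_quadratic)
  have init: "u (x, 0) < u0 x" if "t = 0" using ux u0_nonneg[OF x] that by simp
  note touch = E_visc_touch_below[OF T(1) x t zero_less_one test min[OF subsetD[OF closure_subset]] out ux init]
  have "frac_op s (ball x 1) (\<lambda>y. 0 * (norm (y - x1))\<^sup>2 + C * t) x = 0"
  proof -
    have "((\<lambda>\<epsilon>. 0 :: real) \<longlongrightarrow> 0) (at_right 0)" by simp
    then have "Lim (at_right (0::real)) (\<lambda>\<epsilon>. 0 :: real) = 0" by (intro tendsto_Lim) auto
    then show ?thesis by (simp add: frac_op_def pv_integral_def set_lebesgue_integral_def)
  qed
  moreover have "frac_op s (- ball x 1) (\<lambda>y. lower_ext \<Omega> u (y, t)) x \<le> 0"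
  proof -
    let ?f = "\<lambda>y. (lower_ext \<Omega> u (x, t) - lower_ext \<Omega> u (y, t)) / norm (x - y) powr (real CARD('n) + 2 * s)"
    have "?f y \<le> 0" for y using touch(2)[of y] by (intro divide_nonpos_nonneg) (auto simp: \<phi>_def)
    then have "0 \<le> (\<integral>y. - (indicator (- ball x 1) y *\<^sub>R ?f y) \<partial>lebesgue)"
      by (intro Bochner_Integration.integral_nonneg) (simp add: indicator_def)
    then have "set_lebesgue_integral lebesgue (- ball x 1) ?f \<le> 0"
      unfolding set_lebesgue_integral_def Bochner_Integration.integral_minus by simp
    then show ?thesis
      using frac_const_pos[OF s, where ?'n = 'n] by (simp add: frac_op_outside mult_nonneg_nonpos)
  qed
  ultimately have "E_visc s p 1 (lower_ext \<Omega> u) \<phi> x t \<le> C"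
    unfolding \<phi>_def[abs_def] E_visc_quadratic by simp
  then show False using touch(1) C by simp
qed

text \<open>The initial alternative in the definition permits \<open>u\<close> to exceed
  \<open>u0\<close> as long as the equation holds at time zero. A steep enough slope in time
  violates the equation at every possible touching point, so that alternative is excluded.\<close>

lemma initial_le:
  assumes x1: "x1 \<in> closure \<Omega>"
  shows "u (x1, 0) \<le> u0 x1"
proof (rule ccontr)
  assume "\<not> u (x1, 0) \<le> u0 x1"
  then have gt: "u0 x1 < u (x1, 0)" by simp
  obtain B where B: "0 < B" "\<And>y t. t \<in> {0..1} \<Longrightarrow> \<bar>upper_ext \<Omega> u (y, t)\<bar> \<le> B"
    "\<And>y t. t \<in> {0..1} \<Longrightarrow> \<bar>lower_ext \<Omega> u (y, t)\<bar> \<le> B"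
    "\<And>y t. y \<in> closure \<Omega> \<Longrightarrow> t \<in> {0..1} \<Longrightarrow> \<bar>u (y, t)\<bar> \<le> B"
    using bounded_slices[of 1] by blast
  obtain \<eta> where \<eta>: "0 < \<eta>" "\<And>y. y \<in> closure \<Omega> \<Longrightarrow> norm (y - x1) < \<eta> \<Longrightarrow> u0 y < u (x1, 0)"
  proof -
    obtain d where "0 < d" "\<forall>y\<in>closure \<Omega>. dist y x1 < d \<longrightarrow> dist (u0 y) (u0 x1) < u (x1, 0) - u0 x1"
      using u0_cont x1 gt unfolding continuous_on_iff by (metis diff_gt_0_iff_gt)
    then show thesis using that[of d] by (force simp: dist_norm)
  qed
  \<comment> \<open>With \<open>L * \<eta>\<^sup>2 > B\<close> the maximum point lies within \<eta>
    of \<open>x1\<close>, where \<open>u0\<close> is below \<open>u (x1, 0)\<close>.\<close>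
  define L where "L = (B + 1) / \<eta>\<^sup>2"
  have L: "0 < L" "B < L * \<eta>\<^sup>2" using B \<eta> by (auto simp: L_def)
  define FC where "FC = frac_const TYPE('n) s"
  have FC: "0 < FC" unfolding FC_def by (rule frac_const_pos[OF s])
  \<comment> \<open>The summands after 1 bound, in order, the nonlocal term inside the ball, the one
    outside, and the gradient term at distance less than \<eta> from \<open>x1\<close>, so
    \<open>E_visc\<close> is at least 1.\<close>
  define C where "C = 1 + FC * L * quadratic_mass TYPE('n) s + FC * (2 * B * tail_mass TYPE('n) s)
     + (2 * L * \<eta>) powr p"
  have C: "0 < C" using FC L B quadratic_mass_nonneg[of s, where ?'n = 'n] tail_mass_nonneg[of s, where ?'n = 'n]
    by (auto simp: C_def intro!: add_pos_nonneg mult_nonneg_nonneg)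
  define \<phi> where "\<phi> z = L * (norm (fst z - x1))\<^sup>2 + C * snd z" for z :: "(real^'n) \<times> real"
  have "continuous_on (closure \<Omega> \<times> {0..1}) (\<lambda>z. u z - \<phi> z)"
    unfolding \<phi>_def by (intro continuous_intros cont_u)
  then obtain z where z: "z \<in> closure \<Omega> \<times> {0..1}" "\<And>w. w \<in> closure \<Omega> \<times> {0..1} \<Longrightarrow> u w - \<phi> w \<le> u z - \<phi> z"
    using continuous_attains_sup[OF compact_cyl, of 1 "\<lambda>z. u z - \<phi> z"] x1 by force
  obtain x t where xt: "z = (x, t)" by force
  have x: "x \<in> closure \<Omega>" and t: "t \<in> {0..1}" using z xt by auto
  have m: "u (x1, 0) \<le> u (x, t) - \<phi> (x, t)"
    using z(2)[of "(x1, 0)"] x1 by (simp add: xt \<phi>_def)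
  have \<phi>0: "0 \<le> \<phi> (y, \<tau>)" if "\<tau> \<in> {0..1}" for y \<tau>
    using that L C by (simp add: \<phi>_def)
  have pos: "0 < u (x1, 0)" using gt u0_nonneg[OF x1] by linarith
  have near: "norm (x - x1) < \<eta>"
  proof (rule ccontr)
    assume "\<not> norm (x - x1) < \<eta>"
    then have "L * \<eta>\<^sup>2 \<le> L * (norm (x - x1))\<^sup>2"
      using L \<eta> by (intro mult_left_mono power_mono) auto
    also have "\<dots> \<le> \<phi> (x, t)" using C t by (simp add: \<phi>_def)
    finally show False using m pos B(4)[OF x t] L by linarith
  qed
  have init: "u0 x < u (x, 0)" if "t = 0"
    using m \<phi>0[OF t, of x] \<eta>(2)[OF x near] that by simp
  have "E_visc s p (1/2) (upper_ext \<Omega> u) \<phi> x t \<le> 0"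
  proof (rule E_visc_touch_above[OF zero_less_one x t])
    show "test_function (1/2) x t \<phi>" unfolding \<phi>_def[abs_def] by (rule test_function_quadratic)
    show "u (y, \<tau>) - \<phi> (y, \<tau>) \<le> u (x, t) - \<phi> (x, t)" if "y \<in> closure \<Omega>" "\<tau> \<in> {0..1}" for y \<tau>
      using z(2)[of "(y, \<tau>)"] that xt by simp
    show "\<phi> (x, t) < u (x, t)" using m pos by linarith
  qed (use \<phi>0 init in auto)
  moreover have "\<bar>frac_op s (- ball x (1/2)) (\<lambda>y. upper_ext \<Omega> u (y, t)) x\<bar> \<le> FC * (2 * B * tail_mass TYPE('n) s)"
    unfolding FC_def using t B(2) by (intro frac_op_outside_bound measurable_slice s) auto
  moreover have "norm ((2 * L) *\<^sub>R (x - x1)) powr p \<le> (2 * L * \<eta>) powr p"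
    using near L p by (intro powr_mono2) auto
  ultimately show False
    unfolding \<phi>_def[abs_def] E_visc_quadratic frac_op_quadratic[OF s] FC_def[symmetric] C_def
    by linarith
qed

text \<open>An interior \<open>x1\<close> leaves room for a ball in \<Omega> that traps the minimum
  point, so no boundary alternative occurs. At boundary points the inequality follows from
  \<open>solution_nonneg\<close> once \<open>u0\<close> vanishes there.\<close>

lemma initial_ge:
  assumes x1: "x1 \<in> \<Omega>"
  shows "u0 x1 \<le> u (x1, 0)"
proof (rule ccontr)
  assume "\<not> u0 x1 \<le> u (x1, 0)"
  then have lt: "u (x1, 0) < u0 x1" by simp
  have x1c: "x1 \<in> closure \<Omega>" using x1 closure_subset by blast
  obtain B where B: "0 < B" "\<And>y t. t \<in> {0..1} \<Longrightarrow> \<bar>upper_ext \<Omega> u (y, t)\<bar> \<le> B"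
    "\<And>y t. t \<in> {0..1} \<Longrightarrow> \<bar>lower_ext \<Omega> u (y, t)\<bar> \<le> B"
    "\<And>y t. y \<in> closure \<Omega> \<Longrightarrow> t \<in> {0..1} \<Longrightarrow> \<bar>u (y, t)\<bar> \<le> B"
    using bounded_slices[of 1] by blast
  obtain \<eta> where \<eta>: "0 < \<eta>" "\<And>y. y \<in> closure \<Omega> \<Longrightarrow> norm (y - x1) < \<eta> \<Longrightarrow> u (x1, 0) < u0 y"
    "\<And>y. y \<notin> \<Omega> \<Longrightarrow> \<eta> \<le> norm (y - x1)"
  proof -
    obtain d where d: "0 < d" "\<forall>y\<in>closure \<Omega>. dist y x1 < d \<longrightarrow> dist (u0 y) (u0 x1) < u0 x1 - u (x1, 0)"
      using u0_cont x1c lt unfolding continuous_on_iff by (metis diff_gt_0_iff_gt)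
    obtain e where e: "0 < e" "ball x1 e \<subseteq> \<Omega>" using \<Omega>(1) x1 open_contains_ball by blast
    show thesis
    proof (rule that[of "min d e"])
      show "u (x1, 0) < u0 y" if "y \<in> closure \<Omega>" "norm (y - x1) < min d e" for y
        using d(2) that by (force simp: dist_norm)
      show "min d e \<le> norm (y - x1)" if "y \<notin> \<Omega>" for y
        using e(2) that by (force simp: dist_norm norm_minus_commute)
    qed (use d e in auto)
  qed
  define L where "L = (B + 1) / \<eta>\<^sup>2"
  have L: "0 < L" "B < L * \<eta>\<^sup>2" using B \<eta> by (auto simp: L_def)
  define FC where "FC = frac_const TYPE('n) s"
  have FC: "0 < FC" unfolding FC_def by (rule frac_const_pos[OF s])
  \<comment> \<open>No gradient summand is needed: the term \<open>- |D\<phi>|^p\<close> only lowers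
    \<open>E_visc\<close>, which is to be shown negative.\<close>
  define C where "C = 1 + FC * L * quadratic_mass TYPE('n) s + FC * (2 * B * tail_mass TYPE('n) s)"
  have C: "0 < C" using FC L B quadratic_mass_nonneg[of s, where ?'n = 'n] tail_mass_nonneg[of s, where ?'n = 'n]
    by (auto simp: C_def intro!: add_pos_nonneg mult_nonneg_nonneg)
  define \<phi> where "\<phi> z = (- L) * (norm (fst z - x1))\<^sup>2 + (- C) * snd z" for z :: "(real^'n) \<times> real"
  have "continuous_on (closure \<Omega> \<times> {0..1}) (\<lambda>z. u z - \<phi> z)"
    unfolding \<phi>_def by (intro continuous_intros cont_u)
  then obtain z where z: "z \<in> closure \<Omega> \<times> {0..1}" "\<And>w. w \<in> closure \<Omega> \<times> {0..1} \<Longrightarrow> u z - \<phi> z \<le> u w - \<phi> w"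
    using continuous_attains_inf[OF compact_cyl, of 1 "\<lambda>z. u z - \<phi> z"] x1c by force
  obtain x t where xt: "z = (x, t)" by force
  have x: "x \<in> closure \<Omega>" and t: "t \<in> {0..1}" using z xt by auto
  have min: "u (x, t) - \<phi> (x, t) \<le> u (y, \<tau>) - \<phi> (y, \<tau>)" if "y \<in> closure \<Omega>" "\<tau> \<in> {0..1}" for y \<tau>
    using z(2)[of "(y, \<tau>)"] that xt by simp
  have m: "u (x, t) - \<phi> (x, t) \<le> u (x1, 0)"
    using min[of x1 0] x1c by (simp add: \<phi>_def)
  have far: "B \<le> - \<phi> (y, \<tau>)" if "\<eta> \<le> norm (y - x1)" "\<tau> \<in> {0..1}" for y \<tau>
  proof -
    have "L * \<eta>\<^sup>2 \<le> L * (norm (y - x1))\<^sup>2"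
      using L \<eta> that by (intro mult_left_mono power_mono) auto
    moreover have "0 \<le> C * \<tau>" using C that by simp
    ultimately show ?thesis using L(2) by (simp add: \<phi>_def)
  qed
  have near: "norm (x - x1) < \<eta>"
  proof (rule ccontr)
    assume "\<not> norm (x - x1) < \<eta>"
    then have "L * \<eta>\<^sup>2 \<le> L * (norm (x - x1))\<^sup>2"
      using L \<eta> by (intro mult_left_mono power_mono) auto
    also have "\<dots> \<le> - \<phi> (x, t)" using C t by (simp add: \<phi>_def)
    finally have "B < - \<phi> (x, t)" using L by linarith
    moreover have "0 \<le> u (x, t)" using solution_nonneg[OF x] t by simp
    moreover have "u (x1, 0) \<le> B" using B(4)[OF x1c, of 0] by simp
    ultimately show False using m by linarith
  qed
  then have x\<Omega>: "x \<in> \<Omega>" using \<eta>(3)[of x] by fastforce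
  have "0 \<le> L * (norm (x - x1))\<^sup>2" "0 \<le> C * t" using L C t by simp_all
  then have \<phi>0: "\<phi> (x, t) \<le> 0" by (simp add: \<phi>_def)
  have init: "u (x, 0) < u0 x" if "t = 0"
    using m \<phi>0 \<eta>(2)[OF x near] that by simp
  have "0 \<le> E_visc s p (1/2) (lower_ext \<Omega> u) \<phi> x t"
  proof (rule E_visc_touch_below[OF zero_less_one x t])
    show "test_function (1/2) x t \<phi>" unfolding \<phi>_def[abs_def] by (rule test_function_quadratic)
    show "u (x, t) - \<phi> (x, t) \<le> u (y, \<tau>) - \<phi> (y, \<tau>)" if "y \<in> \<Omega>" "\<tau> \<in> {0..1}" for y \<tau>
      using min[of y \<tau>] that closure_subset by blast
    show "u (x, t) - \<phi> (x, t) \<le> lower_ext \<Omega> u (y, \<tau>) - \<phi> (y, \<tau>)" if "y \<notin> \<Omega>" "\<tau> \<in> {0..1}" for y \<tau>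
    proof -
      have "lower_ext \<Omega> u (y, \<tau>) = 0"
        using that solution_nonneg[of y \<tau>] by (auto simp: lower_ext_def closure_iff min_def)
      moreover have "u (x1, 0) \<le> B" using B(4)[OF x1c, of 0] by simp
      ultimately show ?thesis using m far[OF \<eta>(3)[OF that(1)] that(2)] by linarith
    qed
  qed (use init x\<Omega> frontier_iff in auto)
  moreover have "\<bar>frac_op s (- ball x (1/2)) (\<lambda>y. lower_ext \<Omega> u (y, t)) x\<bar> \<le> FC * (2 * B * tail_mass TYPE('n) s)"
    unfolding FC_def using t B(3) by (intro frac_op_outside_bound measurable_slice s) auto
  moreover have "E_visc s p (1/2) (lower_ext \<Omega> u) \<phi> x t \<le> - C + FC * L * quadratic_mass TYPE('n) s
      + frac_op s (- ball x (1/2)) (\<lambda>y. lower_ext \<Omega> u (y, t)) x"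
    unfolding \<phi>_def[abs_def] E_visc_quadratic frac_op_quadratic[OF s] FC_def by simp
  ultimately show False unfolding C_def by linarith
qed

end

section \<open>Comparison with the barrier\<close>

context continuous_solution
begin

text \<open>\<open>ineq\<close> says that the barrier is a strict supersolution, with
  \<open>A'\<close> in place of the amplitude \<open>A * (1 + K * t)\<close>, which
  \<open>K * T \<le> 1\<close> keeps between \<open>A\<close> and \<open>2 * A\<close>. If
  \<open>u\<close> exceeded the barrier, then at the maximum of the difference \<open>E_visc\<close>
  would be both nonpositive and positive.\<close>

lemma barrier_comparison:
  assumes b: "0 < b" "b < s" and r: "0 < r" and far: "\<And>y. y \<in> closure \<Omega> \<Longrightarrow> r < norm (y - c)"
    and A: "0 < A" and K: "0 < K" and T: "0 < T" "K * T \<le> 1"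
    and init: "\<And>y. y \<in> closure \<Omega> \<Longrightarrow> u0 y \<le> A * barrier b c r y"
    and ineq: "\<And>y A' D. y \<in> closure \<Omega> \<Longrightarrow> A \<le> A' \<Longrightarrow> A' \<le> 2 * A \<Longrightarrow> D = (norm (y - c))\<^sup>2 - r\<^sup>2 \<Longrightarrow>
      0 < A * K * D powr b + frac_const TYPE('n) s * (1/2 * (A' * D powr b * (D / (2 * norm (y - c))) powr (- 2 * s) *
          profile b s ((y - c) /\<^sub>R norm (y - c)) (D / (4 * (norm (y - c))\<^sup>2))))
        - (A' * (b * D powr (b - 1)) * (2 * norm (y - c))) powr p"
    and x1: "x1 \<in> closure \<Omega>" "t1 \<in> {0..T}"
  shows "u (x1, t1) \<le> A * (1 + K * t1) * barrier b c r x1"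
proof (rule ccontr)
  assume "\<not> ?thesis"
  then have gt: "A * (1 + K * t1) * barrier b c r x1 < u (x1, t1)" by simp
  define \<phi> where "\<phi> z = A * (1 + K * snd z) * barrier b c r (fst z)" for z :: "(real^'n) \<times> real"
  have "continuous_on (closure \<Omega> \<times> {0..T}) (\<lambda>z. u z - \<phi> z)"
    unfolding \<phi>_def
    by (intro continuous_intros cont_u continuous_on_compose2[OF continuous_on_barrier[OF b(1), of UNIV]]) auto
  then obtain z where z: "z \<in> closure \<Omega> \<times> {0..T}" "\<And>w. w \<in> closure \<Omega> \<times> {0..T} \<Longrightarrow> u w - \<phi> w \<le> u z - \<phi> z"
    using continuous_attains_sup[OF compact_cyl, of T "\<lambda>z. u z - \<phi> z"] x1 by force
  obtain x t where xt: "z = (x, t)" by force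
  have x: "x \<in> closure \<Omega>" and t: "t \<in> {0..T}" using z xt by auto
  have \<phi>0: "0 \<le> \<phi> (y, \<tau>)" if "\<tau> \<in> {0..T}" for y \<tau>
    using that A K by (simp add: \<phi>_def barrier_def)
  have max: "u (y, \<tau>) - \<phi> (y, \<tau>) \<le> u (x, t) - \<phi> (x, t)" if "y \<in> closure \<Omega>" "\<tau> \<in> {0..T}" for y \<tau>
    using z(2)[of "(y, \<tau>)"] that xt by simp
  have pos: "\<phi> (x, t) < u (x, t)"
    using max[OF x1] gt by (simp add: \<phi>_def)
  have init': "u0 x < u (x, 0)" if "t = 0"
    using pos init[OF x] that by (simp add: \<phi>_def)
  \<comment> \<open>The largest radius allowed by \<open>test_function_barrier\<close>. It depends
    on the touching point, which is harmless because the inequality holds for every radius.\<close>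
  define \<delta> where "\<delta> = norm (x - c) - r"
  have \<delta>: "0 < \<delta>" using far[OF x] by (simp add: \<delta>_def)
  have test: "test_function \<delta> x t \<phi>"
    unfolding \<phi>_def[abs_def] using b r by (intro test_function_barrier) (auto simp: \<delta>_def)
  note touch = E_visc_touch_above[OF T(1) x t \<delta> test max \<phi>0 pos init']
  define A' where "A' = A * (1 + K * t)"
  have A': "A \<le> A'" "A' \<le> 2 * A"
  proof -
    have "0 \<le> K * t" using K t by simp
    moreover have "K * t \<le> K * T" using K t by (intro mult_left_mono) auto
    ultimately have "A * 1 \<le> A'" "A' \<le> A * 2"
      unfolding A'_def using A T by (intro mult_left_mono; linarith)+
    then show "A \<le> A'" "A' \<le> 2 * A" by simp_all
  qed
  define D where "D = (norm (x - c))\<^sup>2 - r\<^sup>2"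
  define v where "v y = upper_ext \<Omega> u (y, t)" for y
  define g where "g y = A' * barrier b c r y" for y
  obtain B where B: "\<And>y. \<bar>v y\<bar> \<le> B"
    using bounded_slices[of T] t unfolding v_def by metis
  have "bounded (g ` cball x \<delta>)"
    unfolding g_def using b by (intro compact_imp_bounded compact_continuous_image continuous_on_mult
        continuous_on_const continuous_on_barrier) auto
  then obtain G where "\<forall>w\<in>g ` cball x \<delta>. norm w \<le> G" unfolding bounded_iff by blast
  then have G: "\<bar>g y\<bar> \<le> G" if "y \<in> ball x \<delta>" for y using that by auto
  have "frac_const TYPE('n) s * (1/2 * (\<integral>z. kernel_sdiff s g x z \<partial>lborel)) \<le>
    frac_op s (ball x \<delta>) g x + frac_op s (- ball x \<delta>) v x"
  proof (rule frac_op_split_ge[OF _ _ \<delta> s G B])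
    show "v \<in> borel_measurable borel" unfolding v_def using t by (intro measurable_slice) auto
    show [measurable]: "g \<in> borel_measurable borel" unfolding g_def by measurable
    show "integrable lborel (kernel_sdiff s g x)"
      unfolding g_def using b s r far[OF x] by (intro barrier_integrable)
    show "integrable lborel (\<lambda>z. indicator (- ball 0 \<delta>) z * ((g x - g (x + z)) / norm z powr (real CARD('n) + 2 * s)))"
    proof -
      have "\<bar>g x - g (x + z)\<bar> \<le> A' * (norm (x - c) / \<delta> + 1) powr (2 * b) * norm z powr (2 * b)"
        if "\<delta> \<le> norm z" for z
        unfolding g_def using A A' by (intro barrier_growth b \<delta> that) linarith
      then have "integrable lborel (\<lambda>z. indicator (- ball 0 \<delta>) z *
          ((g x - g (x + z)) / norm z powr (real DIM(real^'n) + 2 * s)))"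
        by (intro integrable_kernel_outside[OF b s(2) \<delta>]) auto
      then show ?thesis by simp
    qed
    show "g x - g y \<le> v x - v y" for y
      using touch(2)[of y] by (simp add: g_def v_def \<phi>_def A'_def)
  qed
  also have "(\<integral>z. kernel_sdiff s g x z \<partial>lborel) = A' * D powr b * (D / (2 * norm (x - c))) powr (- 2 * s) *
      profile b s ((x - c) /\<^sub>R norm (x - c)) (D / (4 * (norm (x - c))\<^sup>2))"
    unfolding g_def D_def using b s r far[OF x] by (intro barrier_integral)
  finally have lower: "frac_const TYPE('n) s * (1/2 * (A' * D powr b * (D / (2 * norm (x - c))) powr (- 2 * s) *
      profile b s ((x - c) /\<^sub>R norm (x - c)) (D / (4 * (norm (x - c))\<^sup>2)))) \<le>
    frac_op s (ball x \<delta>) g x + frac_op s (- ball x \<delta>) v x" .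
  have "E_visc s p \<delta> (upper_ext \<Omega> u) \<phi> x t = A * K * D powr b +
     (frac_op s (ball x \<delta>) g x + frac_op s (- ball x \<delta>) v x)
     - (A' * (b * D powr (b - 1)) * (2 * norm (x - c))) powr p"
    unfolding \<phi>_def[abs_def] D_def A'_def g_def v_def
    using A K t b by (intro E_visc_barrier r far[OF x]) auto
  then show False
    using touch(1) lower ineq[OF x A' D_def] by linarith
qed

end

section \<open>The existence time\<close>

lemma holder_imp_continuous_on:
  fixes f :: "real^'n \<Rightarrow> real"
  assumes "0 < \<beta>" and h: "\<And>x y. x \<in> S \<Longrightarrow> y \<in> S \<Longrightarrow> \<bar>f x - f y\<bar> \<le> M * norm (x - y) powr \<beta>"
  shows "continuous_on S f"
  unfolding continuous_on_def
proof
  fix x assume x: "x \<in> S"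
  have "((\<lambda>y. norm (y - x)) \<longlongrightarrow> 0) (at x within S)"
    by (intro tendsto_norm_zero LIM_zero tendsto_ident_at)
  then have "((\<lambda>y. M * norm (y - x) powr \<beta>) \<longlongrightarrow> M * 0) (at x within S)"
    by (intro tendsto_mult tendsto_const tendsto_zero_powrI[OF _ tendsto_const _ assms(1)]) auto
  then have lim: "((\<lambda>y. M * norm (y - x) powr \<beta>) \<longlongrightarrow> 0) (at x within S)" by simp
  have "\<forall>\<^sub>F y in at x within S. norm (f y - f x) \<le> M * norm (y - x) powr \<beta>"
    unfolding eventually_at_filter using h[OF _ x] by (intro always_eventually allI impI) simp
  then have "((\<lambda>y. f y - f x) \<longlongrightarrow> 0) (at x within S)"
    using lim by (rule Lim_null_comparison)
  then show "(f \<longlongrightarrow> f x) (at x within S)" by (rule LIM_zero_cancel)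
qed

lemma holder_on_bound:
  assumes "holder_on \<beta> S f" "x \<in> S" "y \<in> S"
  shows "\<bar>f x - f y\<bar> \<le> holder_seminorm \<beta> S f * norm (x - y) powr \<beta>"
proof (cases "x = y")
  case False
  then have "\<bar>f x - f y\<bar> / norm (x - y) powr \<beta> \<le> holder_seminorm \<beta> S f"
    unfolding holder_seminorm_def using assms
    by (intro cSup_upper) (auto simp: holder_on_def holder_quotients_def)
  then show ?thesis using False by (simp add: field_simps)
qed simp

text \<open>The time is \<open>1 / K\<close>. The constant \<open>M\<close> enters \<open>K\<close>
  only through the amplitude \<open>A\<close>, and everything else is fixed by the domain, the
  dimension and the exponents, hence the dependence on the seminorm alone.\<close>

lemma classical_data_time:
  fixes \<Omega> :: "(real^'n) set" and s p \<beta> M :: real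
  assumes \<Omega>: "bounded_C2_domain \<Omega>" and s: "0 < s" "s < 1"
    and p: "s + 1 < p" "p < s / (1 - s)" and \<beta>: "\<beta> > (p - 2 * s) / (p - 1)"
  shows "\<exists>T>0. \<forall>u0 u. (\<forall>x\<in>closure \<Omega>. 0 \<le> u0 x) \<longrightarrow>
    (\<forall>x\<in>closure \<Omega>. \<forall>y\<in>closure \<Omega>. \<bar>u0 x - u0 y\<bar> \<le> M * norm (x - y) powr \<beta>) \<longrightarrow>
    (\<forall>x\<in>frontier \<Omega>. u0 x = 0) \<longrightarrow> global_visc_solution \<Omega> s p u0 u \<longrightarrow>
    (\<forall>x\<in>frontier \<Omega>. \<forall>t\<in>{0..T}. u (x, t) = 0) \<and> (\<forall>x\<in>closure \<Omega>. u (x, 0) = u0 x)"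
proof -
  have o: "open \<Omega>" and bdd: "bounded \<Omega>" using \<Omega> by (auto simp: bounded_C2_domain_def)
  have fr_cl: "x \<in> frontier \<Omega> \<Longrightarrow> x \<in> closure \<Omega>" for x by (simp add: frontier_def)
  define \<beta>s where "\<beta>s = (p - 2 * s) / (p - 1)"
  have \<beta>s: "0 < \<beta>s" "\<beta>s < s"
  proof -
    show "0 < \<beta>s" unfolding \<beta>s_def using p s by (intro divide_pos_pos) auto
    have "p * (1 - s) < s" using p s by (simp add: field_simps)
    then show "\<beta>s < s" unfolding \<beta>s_def using p s by (simp add: field_simps)
  qed
  \<comment> \<open>The midpoint lies strictly between the critical exponent and \<open>s\<close>;
    the cap by \<beta> lets the initial bound with exponent \<beta> be weakened to exponent
    \<open>b\<close> on the bounded domain.\<close>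
  define b where "b = min \<beta> ((\<beta>s + s) / 2)"
  have b: "0 < b" "b < s" "\<beta>s < b" "b \<le> \<beta>" using \<beta>s \<beta>[folded \<beta>s_def] by (auto simp: b_def min_less_iff_disj)
  have crit: "p - 2 * s < b * (p - 1)"
    using b(3) p s unfolding \<beta>s_def by (simp add: field_simps)
  obtain r0 where r0: "0 < r0" "\<And>z. z \<in> frontier \<Omega> \<Longrightarrow> exterior_ball \<Omega> r0 z"
    using uniform_exterior_ball[OF \<Omega>] by blast
  obtain d where d: "0 < d" "\<And>x y. x \<in> closure \<Omega> \<Longrightarrow> y \<in> closure \<Omega> \<Longrightarrow> norm (x - y) \<le> d"
  proof -
    obtain a where a: "0 < a" "\<forall>x\<in>closure \<Omega>. norm x \<le> a"
      using bounded_closure[OF bdd] unfolding bounded_pos by blast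
    show thesis
    proof (rule that[of "2 * a"])
      show "norm (x - y) \<le> 2 * a" if "x \<in> closure \<Omega>" "y \<in> closure \<Omega>" for x y
      proof -
        have "norm x \<le> a" "norm y \<le> a" using a(2) that by blast+
        then show ?thesis using norm_triangle_ineq4[of x y] by linarith
      qed
    qed (use a in simp)
  qed
  \<comment> \<open>An upper bound for the distance from a point of the closure to the centre of an
    exterior ball, which is \<open>r0\<close> away from a boundary point.\<close>
  define R where "R = r0 + d"
  define H where "H = (\<integral>z. sdiff_bound b (norm (z::real^'n)) / norm z powr (real DIM(real^'n) + 2 * s) \<partial>lborel)"
  have H: "0 \<le> H" unfolding H_def
    by (intro Bochner_Integration.integral_nonneg divide_nonneg_nonneg sdiff_bound_nonneg) auto
  obtain \<kappa> \<eta>0 where \<kappa>: "0 < \<kappa>" "0 < \<eta>0"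
    "\<And>(e::real^'n) \<eta>. norm e = 1 \<Longrightarrow> 0 \<le> \<eta> \<Longrightarrow> \<eta> \<le> \<eta>0 \<Longrightarrow> \<eta> \<le> 1/4 \<Longrightarrow> \<kappa> \<le> profile b s e \<eta>"
    using profile_uniform_pos[OF b(1,2) s(2), where ?'a = "real^'n"] by blast
  \<comment> \<open>Chosen so that the barrier dominates \<open>u0\<close>: with \<open>w\<close> on
    the boundary and \<open>norm (y - w) \<le> \<rho> - r0\<close>, the initial value at
    \<open>y\<close> is at most \<open>M * d powr (\<beta> - b) * (\<rho> - r0) powr b\<close> for
    \<open>M \<ge> 0\<close>. The factor \<open>r0 powr (- b)\<close> converts
    \<open>\<rho> - r0\<close> into \<open>(\<rho> - r0) * r0 \<le> D\<close>. The maximum and the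
    added 1 keep \<open>A\<close> positive for every real \<open>M\<close>.\<close>
  define A where "A = (max M 0 * d powr (\<beta> - b) + 1) * r0 powr (- b)"
  have A: "0 < A" unfolding A_def using r0 by (intro mult_pos_pos add_nonneg_pos) auto
  obtain K where K: "0 < K"
    "\<And>D \<rho> F A'. r0 \<le> \<rho> \<Longrightarrow> \<rho> \<le> R \<Longrightarrow> 0 < D \<Longrightarrow> D \<le> R\<^sup>2 \<Longrightarrow> A \<le> A' \<Longrightarrow> A' \<le> 2 * A \<Longrightarrow> - H \<le> F \<Longrightarrow>
      (D / (4 * \<rho>\<^sup>2) \<le> \<eta>0 \<Longrightarrow> \<kappa> \<le> F) \<Longrightarrow>
      0 < A * K * D powr b + frac_const TYPE('n) s * (1/2 * (A' * D powr b * (D / (2 * \<rho>)) powr (- 2 * s) * F))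
        - (A' * (b * D powr (b - 1)) * (2 * \<rho>)) powr p"
    using barrier_inequality[OF b(1,2) s(2) _ crit A r0(1) _ \<kappa>(1,2) H frac_const_pos[OF s, where ?'n = 'n], of R]
      p s d by (auto simp: R_def)
  show ?thesis
  proof (intro exI[of _ "1 / K"] conjI allI impI)
    show "0 < 1 / K" using K by simp
    fix u0 :: "real^'n \<Rightarrow> real" and u :: "(real^'n) \<times> real \<Rightarrow> real"
    assume u0: "\<forall>x\<in>closure \<Omega>. 0 \<le> u0 x"
      and hol: "\<forall>x\<in>closure \<Omega>. \<forall>y\<in>closure \<Omega>. \<bar>u0 x - u0 y\<bar> \<le> M * norm (x - y) powr \<beta>"
      and bd: "\<forall>x\<in>frontier \<Omega>. u0 x = 0" and sol: "global_visc_solution \<Omega> s p u0 u"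
    have "continuous_on (closure \<Omega>) u0"
      by (rule holder_imp_continuous_on[where \<beta> = \<beta> and M = M]) (use b hol in auto)
    then interpret continuous_solution \<Omega> s p u0 u
      by unfold_locales (use o bdd s p sol u0 in auto)
    show "\<forall>x\<in>closure \<Omega>. u (x, 0) = u0 x"
    proof
      fix x assume x: "x \<in> closure \<Omega>"
      have "u0 x \<le> u (x, 0)"
        using initial_ge[of x] solution_nonneg[OF x, of 0] bd x by (auto simp: closure_iff)
      then show "u (x, 0) = u0 x" using initial_le[OF x] by simp
    qed
    show "\<forall>x\<in>frontier \<Omega>. \<forall>t\<in>{0..1 / K}. u (x, t) = 0"
    proof (intro ballI)
      fix z t assume z: "z \<in> frontier \<Omega>" and t: "t \<in> {0..1 / K}"
      obtain c where c: "norm (z - c) = r0" "ball c r0 \<inter> \<Omega> = {}"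
        using r0(2)[OF z] unfolding exterior_ball_def by blast
      have far: "r0 \<le> norm (y - c)" if "y \<in> closure \<Omega>" for y
        by (rule closure_away_from_exterior_ball[OF o c(2) that])
      have near: "norm (y - c) \<le> R" if "y \<in> closure \<Omega>" for y
        using d(2)[OF that fr_cl[OF z]] c(1) norm_triangle_ineq[of "y - z" "z - c"] by (simp add: R_def)
      have le: "u (z, t) \<le> 2 * A * pospow b (r0\<^sup>2 - r\<^sup>2)" if r: "0 < r" "r < r0" for r
      proof -
        have "u (z, t) \<le> A * (1 + K * t) * barrier b c r z"
        proof (rule barrier_comparison[OF b(1,2) r(1) _ A K(1)])
          show "r < norm (y - c)" if "y \<in> closure \<Omega>" for y using far[OF that] r by linarith
          show "0 < 1 / K" "K * (1 / K) \<le> 1" "z \<in> closure \<Omega>" "t \<in> {0..1 / K}"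
            using K(1) t fr_cl[OF z] by auto
          fix y assume y: "y \<in> closure \<Omega>"
          define \<rho> where "\<rho> = norm (y - c)"
          have \<rho>: "r0 \<le> \<rho>" "\<rho> \<le> R" using far[OF y] near[OF y] by (simp_all add: \<rho>_def)
          have D0: "(\<rho> - r0) * r0 \<le> \<rho>\<^sup>2 - r\<^sup>2"
          proof -
            have "(\<rho> - r0) * r0 \<le> (\<rho> - r0) * (\<rho> + r0)" using \<rho> r0 by (intro mult_left_mono) auto
            also have "\<dots> = \<rho>\<^sup>2 - r0\<^sup>2" by (simp add: power2_eq_square algebra_simps)
            finally have "(\<rho> - r0) * r0 \<le> \<rho>\<^sup>2 - r0\<^sup>2" .
            moreover have "r\<^sup>2 \<le> r0\<^sup>2" using r by (intro power_mono) auto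
            ultimately show ?thesis by linarith
          qed
          obtain w where w: "w \<in> frontier \<Omega>" "norm (y - w) \<le> \<rho> - r0"
            using boundary_point_toward_ball[OF o r0(1) c(2) y] unfolding \<rho>_def by blast
          show "u0 y \<le> A * barrier b c r y"
          proof -
            have "u0 y = \<bar>u0 y - u0 w\<bar>" using bd w u0 y by simp
            also have "\<dots> \<le> M * norm (y - w) powr \<beta>" using hol y fr_cl[OF w(1)] by blast
            also have "\<dots> \<le> max M 0 * norm (y - w) powr \<beta>" by (intro mult_right_mono) auto
            also have "\<dots> = max M 0 * (norm (y - w) powr (\<beta> - b) * norm (y - w) powr b)"
              by (simp add: powr_add[symmetric])
            also have "\<dots> \<le> max M 0 * (d powr (\<beta> - b) * (\<rho> - r0) powr b)"
              using b d(2)[OF y fr_cl[OF w(1)]] w(2)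
              by (intro mult_left_mono mult_mono powr_mono2) auto
            also have "\<dots> \<le> (max M 0 * d powr (\<beta> - b) + 1) * (\<rho> - r0) powr b"
              by (simp add: distrib_right mult.assoc)
            also have "(\<rho> - r0) powr b = r0 powr (- b) * ((\<rho> - r0) * r0) powr b"
              using r0 \<rho> by (simp add: powr_mult powr_minus_divide)
            also have "(max M 0 * d powr (\<beta> - b) + 1) * (r0 powr (- b) * ((\<rho> - r0) * r0) powr b)
                = A * pospow b ((\<rho> - r0) * r0)"
              using r0 \<rho> by (simp add: A_def pospow_def)
            also have "\<dots> \<le> A * pospow b (\<rho>\<^sup>2 - r\<^sup>2)"
              using A D0 b by (intro mult_left_mono pospow_mono) auto
            finally show ?thesis by (simp add: barrier_def \<rho>_def)
          qed
          fix A' D assume A': "A \<le> A'" "A' \<le> 2 * A" and "D = (norm (y - c))\<^sup>2 - r\<^sup>2"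
          then have D: "D = \<rho>\<^sup>2 - r\<^sup>2" by (simp add: \<rho>_def)
          have \<rho>0: "0 < \<rho>" using \<rho> r0 by linarith
          have Dpos: "0 < D" unfolding D \<rho>_def using far[OF y] r by (intro barrier_pos) auto
          have DR: "D \<le> R\<^sup>2"
            unfolding D using power_mono[OF \<rho>(2), of 2] \<rho>0 by (simp add: diff_le_eq add_increasing2)
          have \<eta>: "0 \<le> D / (4 * \<rho>\<^sup>2)" "D / (4 * \<rho>\<^sup>2) \<le> 1/4"
            using Dpos \<rho>0 by (auto simp: D)
          have e: "norm ((y - c) /\<^sub>R \<rho>) = 1" using \<rho>0 by (simp add: \<rho>_def)
          show "0 < A * K * D powr b + frac_const TYPE('n) s * (1/2 * (A' * D powr b *
              (D / (2 * norm (y - c))) powr (- 2 * s) *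
              profile b s ((y - c) /\<^sub>R norm (y - c)) (D / (4 * (norm (y - c))\<^sup>2))))
            - (A' * (b * D powr (b - 1)) * (2 * norm (y - c))) powr p"
            unfolding \<rho>_def[symmetric]
          proof (rule K(2)[OF \<rho> Dpos DR A'])
            show "- H \<le> profile b s ((y - c) /\<^sub>R \<rho>) (D / (4 * \<rho>\<^sup>2))"
              unfolding H_def by (rule profile_ge[OF b(1,2) s(2) e \<eta>])
            show "\<kappa> \<le> profile b s ((y - c) /\<^sub>R \<rho>) (D / (4 * \<rho>\<^sup>2))" if "D / (4 * \<rho>\<^sup>2) \<le> \<eta>0"
              by (rule \<kappa>(3)[OF e \<eta>(1) that \<eta>(2)])
          qed
        qed
        also have "\<dots> \<le> A * 2 * barrier b c r z"
        proof -
          have "K * t \<le> 1" using t K(1) by (simp add: field_simps)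
          then show ?thesis using A by (intro mult_right_mono mult_left_mono) (auto simp: barrier_def)
        qed
        finally show ?thesis by (simp add: barrier_def c(1) mult.commute)
      qed
      \<comment> \<open>\<open>A\<close> and \<open>K\<close> were fixed before \<open>r\<close>, so
        the bound at the fixed point \<open>(z, t)\<close> passes to the limit, where the barrier at
        \<open>z\<close> vanishes.\<close>
      have "((\<lambda>r. 2 * A * pospow b (r0\<^sup>2 - r\<^sup>2)) \<longlongrightarrow> 2 * A * pospow b (r0\<^sup>2 - r0\<^sup>2)) (at_left r0)"
        using b by (intro tendsto_intros)
      moreover have "\<forall>\<^sub>F r in at_left r0. u (z, t) \<le> 2 * A * pospow b (r0\<^sup>2 - r\<^sup>2)"
        using eventually_at_left_real[OF r0(1)] by eventually_elim (auto intro: le)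
      ultimately have "u (z, t) \<le> 2 * A * pospow b (r0\<^sup>2 - r0\<^sup>2)"
        by (rule tendsto_lowerbound) simp
      then have "u (z, t) \<le> 0" by (simp add: pospow_def)
      moreover have "0 \<le> u (z, t)" using solution_nonneg[OF fr_cl[OF z], of t] t by simp
      ultimately show "u (z, t) = 0" by simp
    qed
  qed
qed

theorem theorem1p1:
  fixes \<Omega> :: "(real^'n) set" and s p \<beta> :: real
  assumes "bounded_C2_domain \<Omega>"
    and "0 < s" and "s < 1"
    and "s + 1 < p" and "p < s / (1 - s)"
    and "\<beta> > (p - 2 * s) / (p - 1)"
  shows "\<exists>Tstar :: real \<Rightarrow> real. (\<forall>M\<ge>0. 0 < Tstar M) \<and>
    (\<forall>u0 :: real^'n \<Rightarrow> real.
       (\<forall>x\<in>closure \<Omega>. 0 \<le> u0 x) \<and>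
       holder_on \<beta> (closure \<Omega>) u0 \<and>
       (\<forall>x\<in>frontier \<Omega>. u0 x = 0) \<longrightarrow>
       (\<forall>u :: (real^'n) \<times> real \<Rightarrow> real.
          global_visc_solution \<Omega> s p u0 u \<longrightarrow>
          (\<forall>x\<in>frontier \<Omega>. \<forall>t\<in>{0..Tstar (holder_seminorm \<beta> (closure \<Omega>) u0)}. u (x, t) = 0) \<and>
          (\<forall>x\<in>closure \<Omega>. u (x, 0) = u0 x)))"
proof -
  have "\<forall>M. \<exists>T>0. \<forall>u0 u. (\<forall>x\<in>closure \<Omega>. 0 \<le> u0 x) \<longrightarrow>
    (\<forall>x\<in>closure \<Omega>. \<forall>y\<in>closure \<Omega>. \<bar>u0 x - u0 y\<bar> \<le> M * norm (x - y) powr \<beta>) \<longrightarrow>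
    (\<forall>x\<in>frontier \<Omega>. u0 x = 0) \<longrightarrow> global_visc_solution \<Omega> s p u0 u \<longrightarrow>
    (\<forall>x\<in>frontier \<Omega>. \<forall>t\<in>{0..T}. u (x, t) = 0) \<and> (\<forall>x\<in>closure \<Omega>. u (x, 0) = u0 x)"
    using classical_data_time[OF assms] by blast
  \<comment> \<open>Choice turns the time into a function of the seminorm bound, fixed before the
    initial datum.\<close>
  then obtain Tstar where Tstar: "\<forall>M. 0 < Tstar M \<and> (\<forall>u0 u. (\<forall>x\<in>closure \<Omega>. 0 \<le> u0 x) \<longrightarrow>
    (\<forall>x\<in>closure \<Omega>. \<forall>y\<in>closure \<Omega>. \<bar>u0 x - u0 y\<bar> \<le> M * norm (x - y) powr \<beta>) \<longrightarrow>
    (\<forall>x\<in>frontier \<Omega>. u0 x = 0) \<longrightarrow> global_visc_solution \<Omega> s p u0 u \<longrightarrow>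
    (\<forall>x\<in>frontier \<Omega>. \<forall>t\<in>{0..Tstar M}. u (x, t) = 0) \<and> (\<forall>x\<in>closure \<Omega>. u (x, 0) = u0 x))"
    unfolding choice_iff by (rule exE)
  show ?thesis
  proof (intro exI[of _ Tstar] conjI allI impI)
    show "0 < Tstar M" for M using Tstar by blast
    fix u0 :: "real^'n \<Rightarrow> real" and u :: "(real^'n) \<times> real \<Rightarrow> real"
    assume u0: "(\<forall>x\<in>closure \<Omega>. 0 \<le> u0 x) \<and> holder_on \<beta> (closure \<Omega>) u0 \<and> (\<forall>x\<in>frontier \<Omega>. u0 x = 0)"
      and sol: "global_visc_solution \<Omega> s p u0 u"
    have hol: "\<forall>x\<in>closure \<Omega>. \<forall>y\<in>closure \<Omega>.
        \<bar>u0 x - u0 y\<bar> \<le> holder_seminorm \<beta> (closure \<Omega>) u0 * norm (x - y) powr \<beta>"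
      using u0 by (blast intro: holder_on_bound)
    show "\<forall>x\<in>frontier \<Omega>. \<forall>t\<in>{0..Tstar (holder_seminorm \<beta> (closure \<Omega>) u0)}. u (x, t) = 0"
      "\<forall>x\<in>closure \<Omega>. u (x, 0) = u0 x"
      using conjunct2[OF spec[OF Tstar]] u0 hol sol by blast+
  qed
qed

end
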